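(* Let $h_1,h_2,c_1,c_2\in\mathbb C$, let $n\in\frac12\mathbb Z_+$, and let $D_n=(d_{ij})_{1\le i,j\le p(n)}$ be the matrix with entries $d_{ij}=\langle b_i,b_j^*\rangle$, where $b_1>b_2>\dots>b_{p(n)}$ are the elements of the basis $S_n$ of $M_{\mathfrak g}(h_1,h_2,c_1,c_2)_n$ listed in decreasing order. Then $D_n$ is lower triangular for any $n\in\frac12\mathbb Z_+$. Moreover, the diagonal entries of $D_n$ are $$d_{ii}=\prod_{r\in\mathrm{supp}(\mathbf i)}r\left(2h_2+\frac{r^2-1}{12}c_2\right)^{i_r}\prod_{t\in\mathrm{supp}(\mathbf k)}\left(2h_2+\frac{4t^2-1}{12}c_2\right)^{k_t}\prod_{s\in\mathrm{supp}(\mathbf j)}s\left(2h_2+\frac{s^2-1}{12}c_2\right)^{j_s},$$ where $b_i=Q^{\mathbf k}M^{\mathbf j}L^{\mathbf i}\mathbf 1\in S_n$ with $\mathbf i=(\dots,i_2,i_1)$, $\mathbf j=(\dots,j_2,j_1)$, $\mathbf k=(\dots,k_2,k_1)$.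
   Context: $\mathbb N$ denotes nonnegative integers and $\mathbb Z_+$ positive integers. The N=1 BMS superalgebra $\mathfrak g$ is the complex Lie superalgebra with even basis $L_n,M_n$ ($n\in\mathbb Z$), $\mathbf c_1,\mathbf c_2$, odd basis $Q_r$ ($r\in\mathbb Z+\frac12$), and brackets $[L_m,L_n]=(m-n)L_{m+n}+\frac1{12}\delta_{m+n,0}(m^3-m)\mathbf c_1$, $[L_m,M_n]=(m-n)M_{m+n}+\frac1{12}\delta_{m+n,0}(m^3-m)\mathbf c_2$, $[Q_r,Q_s]=2M_{r+s}+\frac13\delta_{r+s,0}(r^2-\frac14)\mathbf c_2$, $[L_m,Q_r]=(\frac m2-r)Q_{m+r}$, $[M_m,M_n]=[M_n,Q_r]=0$, with $\mathbf c_1,\mathbf c_2$ central. Let $\mathfrak g_\pm$ be the span of $L_{\pm n},M_{\pm n}$ ($n\in\mathbb Z_+$) and $Q_{\pm r}$ ($r\in\mathbb N+\frac12$), and $\mathfrak g_0=\mathrm{span}(L_0,M_0,\mathbf c_1,\mathbf c_2)$. Verma module: $M_{\mathfrak g}(h_1,h_2,c_1,c_2)=U(\mathfrak g)\otimes_{U(\mathfrak g_0\oplus\mathfrak g_+)}\mathbb C$, where on $\mathbb C$ the elements $L_0,M_0,\mathbf c_1,\mathbf c_2$ act as $h_1,h_2,c_1,c_2$ and $\mathfrak g_+$ acts as $0$; $\mathbf 1=1\otimes1$. $M_{\mathfrak g}(h_1,h_2,c_1,c_2)_n$ is the $L_0$-eigenspace with eigenvalue $h_1+n$. Contravariant form: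 $\overline{\phantom{x}}$ is the anti-involution of $U(\mathfrak g)$ with $\overline{L_n}=L_{-n}$, $\overline{M_n}=M_{-n}$, $\overline{Q_r}=Q_{-r}$, $\overline{\mathbf c_i}=\mathbf c_i$. Let $P:U(\mathfrak g)\to U(\mathfrak g_0)$ be the projection along $U(\mathfrak g)=U(\mathfrak g_0)\oplus(\mathfrak g_-U(\mathfrak g)+U(\mathfrak g)\mathfrak g_+)$. The bilinear form on the Verma module is defined by $\langle a\mathbf 1,b\mathbf 1\rangle=\langle\mathbf 1,P(\bar ab)\mathbf 1\rangle$ for $a,b\in U(\mathfrak g_-)$, $\langle\mathbf 1,\mathbf 1\rangle=1$. Bases: $\mathbb M$ is the set of sequences $\mathbf i=(\dots,i_2,i_1)$ of nonnegative integers with finitely many nonzero entries; $\mathbb M_1\subset\mathbb M$ consists of those with all entries in $\{0,1\}$. For $\mathbf i\in\mathbb M$, $\mathrm{supp}(\mathbf i)=\{s\in\mathbb Z_+: i_s\ne0\}$. For $\mathbf i,\mathbf j\in\mathbb M$, $\mathbf k\in\mathbb M_1$ put $Q^{\mathbf k}M^{\mathbf j}L^{\mathbf i}=\cdots Q_{-2+\frac12}^{k_2}Q_{-1+\frac12}^{k_1}\cdots M_{-2}^{j_2}M_{-1}^{j_1}\cdots L_{-2}^{i_2}L_{-1}^{i_1}$, $|\mathbf i|=\sum_n n\,i_n$, $|\mathbf j|=\sum_n n\,j_n$, $|\mathbf k|=\sum_n(n-\frac12)k_n$, and $\mathrm w(\mathbf i,\mathbf j,\mathbf k)=|\mathbf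 i|+|\mathbf j|+|\mathbf k|$. $S_n=\{Q^{\mathbf k}M^{\mathbf j}L^{\mathbf i}\mathbf 1:\mathrm w(\mathbf i,\mathbf j,\mathbf k)=n\}$ is a basis of the weight space $M_{\mathfrak g}(h_1,h_2,c_1,c_2)_n$, of cardinality $p(n)$. For $u=Q^{\mathbf k}M^{\mathbf j}L^{\mathbf i}\mathbf 1\in S_n$ put $u^*=Q^{\mathbf k}M^{\mathbf i}L^{\mathbf j}\mathbf 1$. Orders: on $\mathbb M$, $\mathbf i>\mathbf j$ iff there is $r\in\mathbb Z_+$ with $i_r>j_r$ and $i_s=j_s$ for all $s>r$. On $S_n$, $Q^{\mathbf k}M^{\mathbf j}L^{\mathbf i}\mathbf 1>Q^{\mathbf k_1}M^{\mathbf j_1}L^{\mathbf i_1}\mathbf 1$ iff one of: (i) $|\mathbf j|>|\mathbf j_1|$; (ii) $|\mathbf j|=|\mathbf j_1|$ and $\mathbf j_1>\mathbf j$; (iii) $\mathbf j=\mathbf j_1$ and $|\mathbf k|>|\mathbf k_1|$; (iv) $\mathbf j=\mathbf j_1$, $|\mathbf k|=|\mathbf k_1|$ and $\mathbf k>\mathbf k_1$; (v) $\mathbf j=\mathbf j_1$, $\mathbf k=\mathbf k_1$ and $\mathbf i>\mathbf i_1$.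
   Formalization: The printed diagonal formula is false (for L_{-1}^2 1 the entry is 8h_2^2, not 4h_2^2); the theorem proved has factors i_r!(r(2h_2+...))^{i_r} and j_s!(s(2h_2+...))^{j_s}, and uses t-1/2 in place of t in the Q-factors. *)

theory Defs
  imports Complex_Main "HOL-Library.Poly_Mapping"
begin

section \<open>The N=1 BMS superalgebra\<close>

text \<open>Half-integers are encoded by integers: \<open>gQ m\<close> stands for the odd basis vector
  \<open>Q\<^sub>r\<close> with \<open>r = m + 1/2\<close>. In particular \<open>Q\<^bsub>-s+1/2\<^esub>\<close> is \<open>gQ (- s)\<close>.\<close>

datatype gen = gL int | gM int | gQ int | gC1 | gC2

definition half :: "int \<Rightarrow> complex" where
  "half m = of_int m + 1 / 2"

fun odd_gen :: "gen \<Rightarrow> bool" where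
  "odd_gen (gQ m) = True"
| "odd_gen _ = False"

text \<open>The underlying space of the superalgebra is \<open>gen \<Rightarrow>\<^sub>0 complex\<close>; \<open>bracket\<close> is the
  superbracket on basis vectors, the reversed entries coming from super-skew-symmetry.\<close>

abbreviation bas :: "gen \<Rightarrow> complex \<Rightarrow> gen \<Rightarrow>\<^sub>0 complex" where
  "bas \<equiv> Poly_Mapping.single"

fun bracket :: "gen \<Rightarrow> gen \<Rightarrow> (gen \<Rightarrow>\<^sub>0 complex)" where
  "bracket (gL m) (gL n) = bas (gL (m + n)) (of_int (m - n))
     + bas gC1 (if m + n = 0 then of_int (m ^ 3 - m) / 12 else 0)"
| "bracket (gL m) (gM n) = bas (gM (m + n)) (of_int (m - n))
     + bas gC2 (if m + n = 0 then of_int (m ^ 3 - m) / 12 else 0)"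
| "bracket (gM n) (gL m) = - (bas (gM (m + n)) (of_int (m - n))
     + bas gC2 (if m + n = 0 then of_int (m ^ 3 - m) / 12 else 0))"
| "bracket (gQ m) (gQ n) = bas (gM (m + n + 1)) 2
     + bas gC2 (if m + n + 1 = 0 then (half m ^ 2 - 1 / 4) / 3 else 0)"
| "bracket (gL m) (gQ n) = bas (gQ (m + n)) (of_int m / 2 - half n)"
| "bracket (gQ n) (gL m) = - bas (gQ (m + n)) (of_int m / 2 - half n)"
| "bracket _ _ = 0"

definition g_plus :: "gen set" where
  "g_plus = {gL n | n. n > 0} \<union> {gM n | n. n > 0} \<union> {gQ m | m. m \<ge> 0}"

definition g_minus :: "gen set" where
  "g_minus = {gL n | n. n < 0} \<union> {gM n | n. n < 0} \<union> {gQ m | m. m < 0}"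

definition g_zero :: "gen set" where
  "g_zero = {gL 0, gM 0, gC1, gC2}"


section \<open>The universal enveloping algebra\<close>

text \<open>The tensor algebra is the free associative algebra on \<open>gen\<close>, i.e. the monoid algebra of
  the words over \<open>gen\<close>. The wrapper around lists only serves to carry the monoid structure
  (concatenation, written additively) that \<open>Poly_Mapping\<close> uses for convolution.\<close>

datatype wrd = Wrd (letters: "gen list")

instantiation wrd :: monoid_add
begin

definition zero_wrd :: wrd where "zero_wrd = Wrd []"

definition plus_wrd :: "wrd \<Rightarrow> wrd \<Rightarrow> wrd" where
  "plus_wrd v w = Wrd (letters v @ letters w)"

instance
  by standard (auto simp: zero_wrd_def plus_wrd_def)

end

type_synonym tens_alg = "wrd \<Rightarrow>\<^sub>0 complex"

definition tgen :: "gen \<Rightarrow> tens_alg" where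
  "tgen x = Poly_Mapping.single (Wrd [x]) 1"

definition tscal :: "complex \<Rightarrow> tens_alg" where
  "tscal c = Poly_Mapping.single 0 c"

definition tlin :: "(gen \<Rightarrow>\<^sub>0 complex) \<Rightarrow> tens_alg" where
  "tlin v = (\<Sum>x\<in>Poly_Mapping.keys v. tscal (Poly_Mapping.lookup v x) * tgen x)"

definition super_rel :: "gen \<Rightarrow> gen \<Rightarrow> tens_alg" where
  "super_rel x y = tgen x * tgen y
     - tscal (if odd_gen x \<and> odd_gen y then - 1 else 1) * tgen y * tgen x - tlin (bracket x y)"

inductive_set super_ideal :: "tens_alg set" where
  zero: "0 \<in> super_ideal"
| rel: "a * super_rel x y * b \<in> super_ideal"
| add: "p \<in> super_ideal \<Longrightarrow> q \<in> super_ideal \<Longrightarrow> p + q \<in> super_ideal"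

lemma super_ideal_mult_left: "p \<in> super_ideal \<Longrightarrow> c * p \<in> super_ideal"
proof (induction rule: super_ideal.induct)
  case (rel a x y b)
  show ?case using super_ideal.rel[of "c * a" x y b] by (simp add: mult.assoc)
qed (auto simp: distrib_left intro: super_ideal.intros)

lemma super_ideal_mult_right: "p \<in> super_ideal \<Longrightarrow> p * c \<in> super_ideal"
proof (induction rule: super_ideal.induct)
  case (rel a x y b)
  show ?case using super_ideal.rel[of a x y "b * c"] by (simp add: mult.assoc)
qed (auto simp: distrib_right intro: super_ideal.intros)

lemma super_ideal_uminus: "p \<in> super_ideal \<Longrightarrow> - p \<in> super_ideal"
  using super_ideal_mult_left[of p "- 1"] by simp

lemma super_ideal_diff: "p \<in> super_ideal \<Longrightarrow> q \<in> super_ideal \<Longrightarrow> p - q \<in> super_ideal"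
  using super_ideal.add[of p "- q"] super_ideal_uminus by simp

definition super_cong :: "tens_alg \<Rightarrow> tens_alg \<Rightarrow> bool" where
  "super_cong p q \<longleftrightarrow> p - q \<in> super_ideal"

lemma equivp_super_cong: "equivp super_cong"
proof (rule equivpI)
  show "reflp super_cong"
    by (auto simp: reflp_def super_cong_def intro: super_ideal.zero)
  show "symp super_cong"
    using super_ideal_uminus by (force simp: symp_def super_cong_def)
  show "transp super_cong"
    unfolding transp_def super_cong_def
  proof (intro allI impI)
    fix p q r :: tens_alg
    assume "p - q \<in> super_ideal" "q - r \<in> super_ideal"
    then have "(p - q) + (q - r) \<in> super_ideal" by (rule super_ideal.add)
    then show "p - r \<in> super_ideal" by simp
  qed
qed

quotient_type uea = tens_alg / super_cong
  by (rule equivp_super_cong)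

lemma super_ideal_keys: "p \<in> super_ideal \<Longrightarrow> 0 \<notin> Poly_Mapping.keys p"
proof (induction rule: super_ideal.induct)
  case (rel a x y b)
  have "Poly_Mapping.lookup (super_rel x y) 0 = 0"
    by (simp add: super_rel_def tgen_def tscal_def tlin_def mult_single lookup_minus lookup_sum
        lookup_single plus_wrd_def zero_wrd_def)
  then have "0 \<notin> Poly_Mapping.keys (super_rel x y)"
    by (simp add: in_keys_iff)
  moreover have "u + v = 0 \<longleftrightarrow> u = 0 \<and> v = 0" for u v :: wrd
    by (cases u; cases v) (auto simp: plus_wrd_def zero_wrd_def)
  ultimately show ?case
    using keys_mult[of "a * super_rel x y" b] keys_mult[of a "super_rel x y"] by fastforce
next
  case (add p q)
  then show ?case using keys_add[of p q] by blast
qed simp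

instantiation uea :: ring_1
begin

lift_definition zero_uea :: uea is 0 .

lift_definition one_uea :: uea is 1 .

lift_definition plus_uea :: "uea \<Rightarrow> uea \<Rightarrow> uea" is "(+)"
  unfolding super_cong_def by (metis add_diff_add super_ideal.add)

lift_definition minus_uea :: "uea \<Rightarrow> uea \<Rightarrow> uea" is "(-)"
proof -
  fix p p' q q' :: tens_alg
  assume "super_cong p p'" "super_cong q q'"
  then have "(p - p') - (q - q') \<in> super_ideal"
    unfolding super_cong_def by (rule super_ideal_diff)
  then show "super_cong (p - q) (p' - q')"
    unfolding super_cong_def by (simp add: algebra_simps)
qed

lift_definition uminus_uea :: "uea \<Rightarrow> uea" is uminus
  unfolding super_cong_def using super_ideal_uminus by fastforce

lift_definition times_uea :: "uea \<Rightarrow> uea \<Rightarrow> uea" is "(*)"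
proof -
  fix p p' q q' :: tens_alg
  assume "super_cong p p'" "super_cong q q'"
  then have "(p - p') * q + p' * (q - q') \<in> super_ideal"
    unfolding super_cong_def
    by (intro super_ideal.add super_ideal_mult_left super_ideal_mult_right)
  then show "super_cong (p * q) (p' * q')"
    unfolding super_cong_def by (simp add: algebra_simps)
qed

instance
proof
  show "(0::uea) \<noteq> 1"
  proof (transfer, rule notI)
    assume "super_cong 0 1"
    then have "- 1 \<in> super_ideal" by (simp add: super_cong_def)
    then have "(1::tens_alg) \<in> super_ideal" using super_ideal_uminus by fastforce
    then show False using super_ideal_keys by fastforce
  qed
qed (transfer; simp add: algebra_simps super_cong_def super_ideal.zero)+

end

lift_definition ugen :: "gen \<Rightarrow> uea" is tgen .

lift_definition uscal :: "complex \<Rightarrow> uea" is tscal .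

text \<open>The image in \<open>U(\<gg>)\<close> of the enveloping algebra of the subalgebra spanned by \<open>G\<close>.\<close>

inductive_set usub :: "gen set \<Rightarrow> uea set" for G :: "gen set" where
  scal: "uscal c \<in> usub G"
| gen: "x \<in> G \<Longrightarrow> ugen x \<in> usub G"
| add: "u \<in> usub G \<Longrightarrow> v \<in> usub G \<Longrightarrow> u + v \<in> usub G"
| mult: "u \<in> usub G \<Longrightarrow> v \<in> usub G \<Longrightarrow> u * v \<in> usub G"


section \<open>The anti-involution\<close>

fun gbar :: "gen \<Rightarrow> gen" where
  "gbar (gL n) = gL (- n)"
| "gbar (gM n) = gM (- n)"
| "gbar (gQ m) = gQ (- m - 1)"
| "gbar gC1 = gC1"
| "gbar gC2 = gC2"

definition wbar :: "wrd \<Rightarrow> wrd" where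
  "wbar w = Wrd (rev (map gbar (letters w)))"

text \<open>\<open>wbar\<close> is an involution, so precomposing coefficients with it sends a word \<open>w\<close> to
  \<open>wbar w\<close>.\<close>

definition tbar :: "tens_alg \<Rightarrow> tens_alg" where
  "tbar = Poly_Mapping.map_key wbar"

lemma gbar_gbar [simp]: "gbar (gbar x) = x"
  by (cases x) auto

lemma wbar_wbar [simp]: "wbar (wbar w) = w"
  by (simp add: wbar_def rev_map[symmetric] comp_def)

lemma inj_wbar: "inj wbar"
  by (metis injI wbar_wbar)

lemma wbar_add: "wbar (v + w) = wbar w + wbar v"
  by (simp add: wbar_def plus_wrd_def)

lemma tbar_add: "tbar (p + q) = tbar p + tbar q"
  by (simp add: tbar_def map_key_plus inj_wbar)

lemma tbar_zero [simp]: "tbar 0 = 0"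
  by (simp add: tbar_def inj_wbar)

lemma tbar_uminus: "tbar (- p) = - tbar p"
  by (metis add_eq_0_iff tbar_add tbar_zero right_minus)

lemma tbar_diff: "tbar (p - q) = tbar p - tbar q"
  using tbar_add[of p "- q"] by (simp add: tbar_uminus)

lemma tbar_single: "tbar (Poly_Mapping.single w c) = Poly_Mapping.single (wbar w) c"
  using map_key_single[OF inj_wbar, of "wbar w" c] by (simp add: tbar_def)

lemma poly_mapping_additive_induct [case_names zero single add]:
  assumes "P 0" "\<And>k c. P (Poly_Mapping.single k c)" "\<And>p q. P p \<Longrightarrow> P q \<Longrightarrow> P (p + q)"
  shows "P (p :: 'a \<Rightarrow>\<^sub>0 'b::comm_monoid_add)"
proof -
  have "p = (\<Sum>k\<in>Poly_Mapping.keys p. Poly_Mapping.single k (Poly_Mapping.lookup p k))"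
    by (rule poly_mapping_eqI)
      (auto simp: lookup_sum lookup_single when_def in_keys_iff)
  moreover have "finite A \<Longrightarrow> P (\<Sum>k\<in>A. Poly_Mapping.single k (Poly_Mapping.lookup p k))" for A
    by (induction A rule: finite_induct) (simp_all add: assms)
  ultimately show ?thesis by (metis finite_keys)
qed

lemma tbar_mult: "tbar (p * q) = tbar q * tbar p"
proof (induction p rule: poly_mapping_additive_induct)
  case (single k c)
  show ?case
    by (induction q rule: poly_mapping_additive_induct)
      (simp_all add: tbar_single mult_single wbar_add tbar_add distrib_left distrib_right mult.commute)
qed (simp_all add: tbar_add distrib_left distrib_right)

lemma tlin_add: "tlin (u + v) = tlin u + tlin v"
  unfolding tlin_def
  by (rule setsum_keys_plus_distrib) (simp_all add: tscal_def single_add distrib_right)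

lemma tlin_zero [simp]: "tlin 0 = 0"
  by (simp add: tlin_def)

lemma tlin_uminus: "tlin (- v) = - tlin v"
  by (metis add_eq_0_iff tlin_add tlin_zero right_minus)

lemma tlin_single: "tlin (Poly_Mapping.single x c) = Poly_Mapping.single (Wrd [x]) c"
  by (cases "c = 0") (simp_all add: tlin_def tscal_def tgen_def mult_single)

lemma tbar_bracket: "tbar (tlin (bracket x y)) = tlin (bracket (gbar y) (gbar x))"
proof -
  have half_neg: "half (- m - 1) = - half m" "half (- 1 - m) = - half m" for m
    by (simp_all add: half_def)
  note simps = tbar_add tbar_uminus tlin_add tlin_uminus tlin_single tbar_single wbar_def half_neg
    single_uminus[symmetric]
  have even: "tbar (tlin (bracket (gL m) (gL n))) = tlin (bracket (gL (- n)) (gL (- m)))"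
    "tbar (tlin (bracket (gL m) (gM n))) = tlin (bracket (gM (- n)) (gL (- m)))"
    "tbar (tlin (bracket (gM n) (gL m))) = tlin (bracket (gL (- m)) (gM (- n)))" for m n
  proof -
    have comm: "- n - m = - m - n" by simp
    have eq0: "- m - n = 0 \<longleftrightarrow> m + n = 0" by linarith
    show "tbar (tlin (bracket (gL m) (gL n))) = tlin (bracket (gL (- n)) (gL (- m)))"
      by (cases "n = - m") (simp_all add: simps comm eq0 minus_divide_left)
    show "tbar (tlin (bracket (gL m) (gM n))) = tlin (bracket (gM (- n)) (gL (- m)))"
      by (cases "n = - m") (simp_all add: simps comm eq0 minus_divide_left)
    show "tbar (tlin (bracket (gM n) (gL m))) = tlin (bracket (gL (- m)) (gM (- n)))"
      by (cases "n = - m") (simp_all add: simps comm eq0 minus_divide_left)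
  qed
  have LQ: "tbar (tlin (bracket (gL m) (gQ n))) = tlin (bracket (gQ (- n - 1)) (gL (- m)))"
    "tbar (tlin (bracket (gQ n) (gL m))) = tlin (bracket (gL (- m)) (gQ (- n - 1)))" for m n
  proof -
    have comm: "- n - 1 - m = - m - n - 1" by simp
    show "tbar (tlin (bracket (gL m) (gQ n))) = tlin (bracket (gQ (- n - 1)) (gL (- m)))"
      "tbar (tlin (bracket (gQ n) (gL m))) = tlin (bracket (gL (- m)) (gQ (- n - 1)))"
      by (simp_all add: simps comm)
  qed
  have QQ: "tbar (tlin (bracket (gQ m) (gQ n))) = tlin (bracket (gQ (- n - 1)) (gQ (- m - 1)))" for m n
  proof (cases "m = - n - 1")
    case True
    show ?thesis unfolding True by (simp add: simps)
  next
    case False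
    have comm: "- n - m = - m - n" by simp
    from False have "m + n \<noteq> - 1" "- m - n \<noteq> 1" by linarith+
    then show ?thesis by (simp add: simps comm)
  qed
  show ?thesis
    by (cases x; cases y) (simp_all only: gbar.simps even LQ QQ, simp_all)
qed

lemma tbar_super_rel: "tbar (super_rel x y) = super_rel (gbar y) (gbar x)"
proof -
  have "odd_gen (gbar z) = odd_gen z" for z by (cases z) auto
  moreover have "wbar 0 = 0" by (simp add: wbar_def zero_wrd_def)
  ultimately show ?thesis
    by (simp add: super_rel_def tbar_diff tbar_mult tbar_bracket tgen_def tscal_def tbar_single
        wbar_def mult_single plus_wrd_def zero_wrd_def)
qed

lemma tbar_super_ideal: "p \<in> super_ideal \<Longrightarrow> tbar p \<in> super_ideal"
proof (induction rule: super_ideal.induct)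
  case (rel a x y b)
  have "tbar (a * super_rel x y * b) = tbar b * super_rel (gbar y) (gbar x) * tbar a"
    by (simp add: tbar_mult tbar_super_rel mult.assoc)
  then show ?case by (simp add: super_ideal.rel)
qed (auto simp: tbar_add intro: super_ideal.intros)

lift_definition ubar :: "uea \<Rightarrow> uea" is tbar
  unfolding super_cong_def using tbar_super_ideal by (metis tbar_diff)


section \<open>The Verma module\<close>

text \<open>The action of \<open>U(g\<^sub>0 \<oplus> g\<^sub>+)\<close> on the one-dimensional module \<open>\<complex>\<close>:
  \<open>acts h1 h2 c1 c2 x a\<close> means that \<open>x\<close> lies in \<open>U(g\<^sub>0 \<oplus> g\<^sub>+)\<close> and acts as multiplication
  by \<open>a\<close>.\<close>

inductive acts :: "complex \<Rightarrow> complex \<Rightarrow> complex \<Rightarrow> complex \<Rightarrow> uea \<Rightarrow> complex \<Rightarrow> bool"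
  for h1 h2 c1 c2 :: complex where
  L0: "acts h1 h2 c1 c2 (ugen (gL 0)) h1"
| M0: "acts h1 h2 c1 c2 (ugen (gM 0)) h2"
| C1: "acts h1 h2 c1 c2 (ugen gC1) c1"
| C2: "acts h1 h2 c1 c2 (ugen gC2) c2"
| plus: "x \<in> g_plus \<Longrightarrow> acts h1 h2 c1 c2 (ugen x) 0"
| scal: "acts h1 h2 c1 c2 (uscal c) c"
| add: "acts h1 h2 c1 c2 x a \<Longrightarrow> acts h1 h2 c1 c2 y b \<Longrightarrow> acts h1 h2 c1 c2 (x + y) (a + b)"
| mult: "acts h1 h2 c1 c2 x a \<Longrightarrow> acts h1 h2 c1 c2 y b \<Longrightarrow> acts h1 h2 c1 c2 (x * y) (a * b)"

text \<open>The tensor product \<open>U(g) \<otimes> \<complex>\<close> over \<open>U(g\<^sub>0 \<oplus> g\<^sub>+)\<close> as the free abelian group on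
  \<open>U(g) \<times> \<complex>\<close> modulo biadditivity and balancedness. Its elements are represented by cosets.\<close>

type_synonym pre_verma = "uea \<times> complex \<Rightarrow>\<^sub>0 int"

abbreviation pure :: "uea \<Rightarrow> complex \<Rightarrow> pre_verma" where
  "pure u z \<equiv> Poly_Mapping.single (u, z) 1"

inductive_set verma_rels :: "complex \<Rightarrow> complex \<Rightarrow> complex \<Rightarrow> complex \<Rightarrow> pre_verma set"
  for h1 h2 c1 c2 :: complex where
  zero: "0 \<in> verma_rels h1 h2 c1 c2"
| diff: "p \<in> verma_rels h1 h2 c1 c2 \<Longrightarrow> q \<in> verma_rels h1 h2 c1 c2 \<Longrightarrow>
    p - q \<in> verma_rels h1 h2 c1 c2"
| add_left: "pure (u + v) z - pure u z - pure v z \<in> verma_rels h1 h2 c1 c2"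
| add_right: "pure u (z + w) - pure u z - pure u w \<in> verma_rels h1 h2 c1 c2"
| balanced: "acts h1 h2 c1 c2 x a \<Longrightarrow> pure (u * x) z - pure u (a * z) \<in> verma_rels h1 h2 c1 c2"

definition tensor :: "complex \<Rightarrow> complex \<Rightarrow> complex \<Rightarrow> complex \<Rightarrow> uea \<Rightarrow> complex \<Rightarrow> pre_verma set" where
  "tensor h1 h2 c1 c2 u z = {p. p - pure u z \<in> verma_rels h1 h2 c1 c2}"

text \<open>The vector \<open>u \<one> = u (1 \<otimes> 1) = u \<otimes> 1\<close>.\<close>

definition on_vac :: "complex \<Rightarrow> complex \<Rightarrow> complex \<Rightarrow> complex \<Rightarrow> uea \<Rightarrow> pre_verma set" where
  "on_vac h1 h2 c1 c2 u = tensor h1 h2 c1 c2 u 1"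


section \<open>The contravariant form\<close>

text \<open>\<open>g\<^sub>- U(g) + U(g) g\<^sub>+\<close>\<close>

inductive_set off_zero :: "uea set" where
  zero: "0 \<in> off_zero"
| minus: "x \<in> g_minus \<Longrightarrow> ugen x * u \<in> off_zero"
| plus: "x \<in> g_plus \<Longrightarrow> u * ugen x \<in> off_zero"
| add: "u \<in> off_zero \<Longrightarrow> v \<in> off_zero \<Longrightarrow> u + v \<in> off_zero"

definition proj0 :: "uea \<Rightarrow> uea" where
  "proj0 u = (THE v. v \<in> usub g_zero \<and> u - v \<in> off_zero)"

text \<open>Since \<open>\<langle>\<one>, \<one>\<rangle> = 1\<close>, the number \<open>\<langle>\<one>, P(\<bar>a\<bar> b) \<one>\<rangle>\<close> is the scalar \<open>c\<close> with
  \<open>P(\<bar>a\<bar> b) \<one> = c \<one>\<close>.\<close>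

definition cform :: "complex \<Rightarrow> complex \<Rightarrow> complex \<Rightarrow> complex \<Rightarrow>
    pre_verma set \<Rightarrow> pre_verma set \<Rightarrow> complex" where
  "cform h1 h2 c1 c2 v w = (THE c. \<exists>a\<in>usub g_minus. \<exists>b\<in>usub g_minus.
     v = on_vac h1 h2 c1 c2 a \<and> w = on_vac h1 h2 c1 c2 b \<and>
     on_vac h1 h2 c1 c2 (proj0 (ubar a * b)) = on_vac h1 h2 c1 c2 (uscal c))"


section \<open>The PBW basis of a weight space and its order\<close>

text \<open>A finitely supported sequence indexed by the positive integers is a finitely supported
  function on \<open>nat\<close> vanishing at \<open>0\<close>; the support is then \<open>Poly_Mapping.keys\<close>.\<close>

type_synonym seq = "nat \<Rightarrow>\<^sub>0 nat"

definition seqs :: "seq set" where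
  "seqs = {i. Poly_Mapping.lookup i 0 = 0}"

definition seqs01 :: "seq set" where
  "seqs01 = {k \<in> seqs. \<forall>s. Poly_Mapping.lookup k s \<le> 1}"

text \<open>\<open>\<cdots> x\<^sub>2\<^bsup>i\<^sub>2\<^esup> x\<^sub>1\<^bsup>i\<^sub>1\<^esup>\<close>, with decreasing indices from left to right\<close>

definition ordered_prod :: "(nat \<Rightarrow> uea) \<Rightarrow> seq \<Rightarrow> uea" where
  "ordered_prod x i = prod_list
     (map (\<lambda>s. x s ^ Poly_Mapping.lookup i s) (rev (sorted_list_of_set (Poly_Mapping.keys i))))"

text \<open>A basis vector is given by its triple of exponents \<open>(i, j, k)\<close>.\<close>

type_synonym expo = "seq \<times> seq \<times> seq"

fun monomial :: "expo \<Rightarrow> uea" where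
  "monomial (i, j, k) = ordered_prod (\<lambda>s. ugen (gQ (- int s))) k
     * ordered_prod (\<lambda>s. ugen (gM (- int s))) j * ordered_prod (\<lambda>s. ugen (gL (- int s))) i"

definition seq_size :: "seq \<Rightarrow> real" where
  "seq_size i = (\<Sum>s\<in>Poly_Mapping.keys i. real s * real (Poly_Mapping.lookup i s))"

definition seq_size_half :: "seq \<Rightarrow> real" where
  "seq_size_half k = (\<Sum>s\<in>Poly_Mapping.keys k. (real s - 1 / 2) * real (Poly_Mapping.lookup k s))"

definition basis_expos :: "real \<Rightarrow> expo set" where
  "basis_expos n = {(i, j, k). i \<in> seqs \<and> j \<in> seqs \<and> k \<in> seqs01 \<and>
     seq_size i + seq_size j + seq_size_half k = n}"

fun star :: "expo \<Rightarrow> expo" where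
  "star (i, j, k) = (j, i, k)"

definition seq_gt :: "seq \<Rightarrow> seq \<Rightarrow> bool" where
  "seq_gt i j \<longleftrightarrow> (\<exists>r\<ge>1. Poly_Mapping.lookup i r > Poly_Mapping.lookup j r \<and>
     (\<forall>s>r. Poly_Mapping.lookup i s = Poly_Mapping.lookup j s))"

fun expo_gt :: "expo \<Rightarrow> expo \<Rightarrow> bool" where
  "expo_gt (i, j, k) (i1, j1, k1) \<longleftrightarrow>
     seq_size j > seq_size j1
   \<or> (seq_size j = seq_size j1 \<and> seq_gt j1 j)
   \<or> (j = j1 \<and> seq_size_half k > seq_size_half k1)
   \<or> (j = j1 \<and> seq_size_half k = seq_size_half k1 \<and> seq_gt k k1)
   \<or> (j = j1 \<and> k = k1 \<and> seq_gt i i1)"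

definition decreasing_listing :: "real \<Rightarrow> (nat \<Rightarrow> expo) \<Rightarrow> bool" where
  "decreasing_listing n b \<longleftrightarrow>
     bij_betw b {1..card (basis_expos n)} (basis_expos n) \<and>
     (\<forall>x\<in>{1..card (basis_expos n)}. \<forall>y\<in>{1..card (basis_expos n)}. x < y \<longrightarrow> expo_gt (b x) (b y))"

lemma seq_gt_trans: "seq_gt a b \<Longrightarrow> seq_gt b c \<Longrightarrow> seq_gt a c"
proof -
  assume "seq_gt a b" "seq_gt b c"
  then obtain r t where r: "r \<ge> 1" "Poly_Mapping.lookup a r > Poly_Mapping.lookup b r"
      "\<forall>s>r. Poly_Mapping.lookup a s = Poly_Mapping.lookup b s"
    and t: "t \<ge> 1" "Poly_Mapping.lookup b t > Poly_Mapping.lookup c t"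
      "\<forall>s>t. Poly_Mapping.lookup b s = Poly_Mapping.lookup c s"
    unfolding seq_gt_def by blast
  show "seq_gt a c"
    unfolding seq_gt_def
  proof (intro exI[of _ "max r t"] conjI allI impI)
    show "Poly_Mapping.lookup c (max r t) < Poly_Mapping.lookup a (max r t)"
      using r t by (cases r t rule: linorder_cases) (auto simp: max_def)
  qed (use r t in auto)
qed

lemma seq_gt_irrefl: "\<not> seq_gt a a"
  by (auto simp: seq_gt_def)

lemma seq_gt_total:
  assumes "a \<in> seqs" "b \<in> seqs" "a \<noteq> b"
  shows "seq_gt a b \<or> seq_gt b a"
proof -
  let ?D = "{s. Poly_Mapping.lookup a s \<noteq> Poly_Mapping.lookup b s}"
  have "?D \<subseteq> Poly_Mapping.keys a \<union> Poly_Mapping.keys b"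
  proof
    fix s assume "s \<in> ?D"
    then have "Poly_Mapping.lookup a s \<noteq> 0 \<or> Poly_Mapping.lookup b s \<noteq> 0" by (intro disjCI) simp
    then show "s \<in> Poly_Mapping.keys a \<union> Poly_Mapping.keys b" unfolding Un_iff in_keys_iff .
  qed
  then have fin: "finite ?D" by (rule finite_subset) simp
  obtain d where "Poly_Mapping.lookup a d \<noteq> Poly_Mapping.lookup b d"
    using assms(3) poly_mapping_eqI by metis
  then have "d \<in> ?D" by simp
  then have ne: "?D \<noteq> {}" by (simp only: ex_in_conv[symmetric]) (rule exI)
  define m where "m = Max ?D"
  have "m \<in> ?D" unfolding m_def using fin ne by (rule Max_in)
  then have m: "Poly_Mapping.lookup a m \<noteq> Poly_Mapping.lookup b m" by simp
  have above: "Poly_Mapping.lookup a s = Poly_Mapping.lookup b s" if "s > m" for s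
  proof (rule ccontr)
    assume "Poly_Mapping.lookup a s \<noteq> Poly_Mapping.lookup b s"
    then have "s \<le> m" unfolding m_def by (intro Max_ge[OF fin]) simp
    with that show False by simp
  qed
  have "m \<noteq> 0"
  proof
    assume "m = 0"
    with m assms(1,2) show False by (simp add: seqs_def)
  qed
  then have "m \<ge> 1" by simp
  show ?thesis
  proof (cases "Poly_Mapping.lookup a m < Poly_Mapping.lookup b m")
    case True
    then have "seq_gt b a"
      unfolding seq_gt_def using \<open>m \<ge> 1\<close> above by (intro exI[of _ m]) simp
    then show ?thesis ..
  next
    case False
    with m have "Poly_Mapping.lookup a m > Poly_Mapping.lookup b m" by linarith
    then have "seq_gt a b"
      unfolding seq_gt_def using \<open>m \<ge> 1\<close> above by (intro exI[of _ m]) simp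
    then show ?thesis ..
  qed
qed

lemma expo_gt_trans: "expo_gt a b \<Longrightarrow> expo_gt b c \<Longrightarrow> expo_gt a c"
proof -
  assume ab: "expo_gt a b" and bc: "expo_gt b c"
  obtain i j k i1 j1 k1 i2 j2 k2 where eqs: "a = (i, j, k)" "b = (i1, j1, k1)" "c = (i2, j2, k2)"
    by (metis prod_cases3)
  have "seq_gt j2 j1 \<Longrightarrow> seq_gt j1 j \<Longrightarrow> seq_gt j2 j"
    "seq_gt k k1 \<Longrightarrow> seq_gt k1 k2 \<Longrightarrow> seq_gt k k2"
    "seq_gt i i1 \<Longrightarrow> seq_gt i1 i2 \<Longrightarrow> seq_gt i i2"
    using seq_gt_trans by blast+
  with ab bc show ?thesis
    unfolding eqs expo_gt.simps by (elim disjE conjE; simp)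
qed

lemma expo_gt_irrefl: "\<not> expo_gt a a"
  by (cases a) (auto simp: seq_gt_irrefl)

lemma expo_gt_total:
  assumes "a \<in> basis_expos n" "b \<in> basis_expos n" "a \<noteq> b"
  shows "expo_gt a b \<or> expo_gt b a"
proof -
  obtain i j k i1 j1 k1 where ab: "a = (i, j, k)" "b = (i1, j1, k1)"
    by (metis prod_cases3)
  have "i \<in> seqs" "j \<in> seqs" "k \<in> seqs" "i1 \<in> seqs" "j1 \<in> seqs" "k1 \<in> seqs"
    using assms by (auto simp: ab basis_expos_def seqs01_def)
  then have J: "j \<noteq> j1 \<Longrightarrow> seq_gt j j1 \<or> seq_gt j1 j"
    and K: "k \<noteq> k1 \<Longrightarrow> seq_gt k k1 \<or> seq_gt k1 k"
    and I: "i \<noteq> i1 \<Longrightarrow> seq_gt i i1 \<or> seq_gt i1 i"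
    using seq_gt_total by blast+
  consider "j \<noteq> j1" | "j = j1" "k \<noteq> k1" | "j = j1" "k = k1" "i \<noteq> i1"
    using assms(3) ab by blast
  then show ?thesis
  proof cases
    case 1
    then show ?thesis
      unfolding ab by (cases "seq_size j" "seq_size j1" rule: linorder_cases) (use J in auto)
  next
    case 2
    then show ?thesis
      unfolding ab by (cases "seq_size_half k" "seq_size_half k1" rule: linorder_cases) (use K in auto)
  next
    case 3
    then show ?thesis unfolding ab using I by auto
  qed
qed

lemma finite_bounded_seqs:
  "finite {i :: seq. Poly_Mapping.keys i \<subseteq> {..N} \<and> (\<forall>s. Poly_Mapping.lookup i s \<le> N)}"
    (is "finite ?A")
proof -
  let ?F = "{f. \<forall>x. (x \<in> {..N} \<longrightarrow> f x \<in> {..N}) \<and> (x \<notin> {..N} \<longrightarrow> f x = (0::nat))}"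
  have "finite ?F"
    by (rule finite_set_of_finite_funs) auto
  moreover have "Poly_Mapping.lookup ` ?A \<subseteq> ?F"
  proof
    fix f assume "f \<in> Poly_Mapping.lookup ` ?A"
    then obtain i where i: "f = Poly_Mapping.lookup i" "Poly_Mapping.keys i \<subseteq> {..N}"
      "\<forall>s. Poly_Mapping.lookup i s \<le> N" by blast
    have "f x = 0" if "x \<notin> {..N}" for x
      using that i(1,2) by (metis in_keys_iff subsetD)
    with i(1,3) show "f \<in> ?F" by simp
  qed
  ultimately have "finite (Poly_Mapping.lookup ` ?A)" by (rule rev_finite_subset)
  then show ?thesis
    by (rule finite_imageD) (rule inj_onI, rule poly_mapping_eqI, simp)
qed

lemma finite_basis_expos: "finite (basis_expos n)"
proof -
  define N where "N = nat \<lceil>n\<rceil> + 1"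
  let ?B = "{i :: seq. Poly_Mapping.keys i \<subseteq> {..N} \<and> (\<forall>s. Poly_Mapping.lookup i s \<le> N)}"
  have N: "n + 1 \<le> real N" unfolding N_def by linarith
  have pos: "1 \<le> s" "1 \<le> Poly_Mapping.lookup i s"
    if "i \<in> seqs" "s \<in> Poly_Mapping.keys i" for i s
    using that by (auto simp: seqs_def in_keys_iff Suc_le_eq intro: gr0I)
  have size0: "0 \<le> seq_size i" for i
    unfolding seq_size_def by (rule sum_nonneg) simp
  have half0: "0 \<le> seq_size_half k" if "k \<in> seqs01" for k
    unfolding seq_size_half_def using that pos(1)[of k]
    by (intro sum_nonneg mult_nonneg_nonneg) (force simp: seqs01_def)+
  have i_bd: "i \<in> ?B" if i: "i \<in> seqs" "seq_size i \<le> n" for i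
  proof -
    have "s \<le> N \<and> Poly_Mapping.lookup i s \<le> N" if s: "s \<in> Poly_Mapping.keys i" for s
    proof -
      have "real s * real (Poly_Mapping.lookup i s) \<le> seq_size i"
        unfolding seq_size_def by (rule member_le_sum) (use s in auto)
      then have "real (s * Poly_Mapping.lookup i s) \<le> real N"
        using i N by simp
      then have le: "s * Poly_Mapping.lookup i s \<le> N"
        by (simp only: of_nat_le_iff)
      have "s \<le> s * Poly_Mapping.lookup i s" "Poly_Mapping.lookup i s \<le> s * Poly_Mapping.lookup i s"
        using pos[OF i(1) s] by simp_all
      with le show ?thesis by linarith
    qed
    then show ?thesis by (auto simp: in_keys_iff) (metis bot_nat_0.not_eq_extremum le0)
  qed
  have k_bd: "k \<in> ?B" if k: "k \<in> seqs01" "seq_size_half k \<le> n" for k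
  proof -
    have "k \<in> seqs" and le1: "Poly_Mapping.lookup k s \<le> 1" for s
      using k by (auto simp: seqs01_def)
    have "s \<le> N" if s: "s \<in> Poly_Mapping.keys k" for s
    proof -
      have "Poly_Mapping.lookup k s = 1"
        using pos[OF \<open>k \<in> seqs\<close> s] le1[of s] by linarith
      moreover have "(real s - 1 / 2) * real (Poly_Mapping.lookup k s) \<le> seq_size_half k"
        unfolding seq_size_half_def
        by (rule member_le_sum) (use s pos(1)[OF \<open>k \<in> seqs\<close>] in force)+
      ultimately have "real s \<le> real N" using k N by simp
      then show ?thesis by simp
    qed
    moreover have "1 \<le> N" by (simp add: N_def)
    ultimately show ?thesis using le1 by (auto intro: order_trans)
  qed
  have "basis_expos n \<subseteq> ?B \<times> ?B \<times> ?B"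
  proof
    fix e assume "e \<in> basis_expos n"
    then obtain i j k where e: "e = (i, j, k)" "i \<in> seqs" "j \<in> seqs" "k \<in> seqs01"
      "seq_size i + seq_size j + seq_size_half k = n"
      by (auto simp: basis_expos_def)
    have "seq_size i \<le> n" "seq_size j \<le> n" "seq_size_half k \<le> n"
      using e(5) size0[of i] size0[of j] half0[OF e(4)] by linarith+
    then show "e \<in> ?B \<times> ?B \<times> ?B"
      using i_bd[OF e(2)] i_bd[OF e(3)] k_bd[OF e(4)] e(1) by blast
  qed
  then show ?thesis
    by (rule finite_subset) (intro finite_cartesian_product finite_bounded_seqs)
qed

lemma decreasing_listing_exists: "\<exists>b. decreasing_listing n b"
proof -
  have "\<exists>b. bij_betw b {1..card A} A \<and>
      (\<forall>x\<in>{1..card A}. \<forall>y\<in>{1..card A}. x < y \<longrightarrow> expo_gt (b x) (b y))"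
    if "finite A" "A \<subseteq> basis_expos n" for A
    using that
  proof (induction "card A" arbitrary: A)
    case 0
    then show ?case by (simp add: bij_betw_def)
  next
    case (Suc m)
    have "A \<noteq> {}" using Suc.hyps(2) by auto
    have "\<exists>z\<in>A. \<forall>x\<in>A. x \<noteq> z \<longrightarrow> \<not> expo_gt z x"
    proof (rule Finite_Set.bex_max_element)
      show "asymp_on A expo_gt"
        by (rule asymp_onI) (metis expo_gt_trans expo_gt_irrefl)
      show "transp_on A expo_gt"
        by (rule transp_onI) (rule expo_gt_trans)
    qed (use \<open>finite A\<close> \<open>A \<noteq> {}\<close> in auto)
    then obtain z where z: "z \<in> A" "\<forall>x\<in>A. x \<noteq> z \<longrightarrow> expo_gt x z"
      using expo_gt_total Suc.prems by blast
    have card: "card (A - {z}) = m"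
      using Suc z(1) by simp
    then obtain b where b: "bij_betw b {1..m} (A - {z})"
        "\<forall>x\<in>{1..m}. \<forall>y\<in>{1..m}. x < y \<longrightarrow> expo_gt (b x) (b y)"
      using Suc.hyps(1)[of "A - {z}"] Suc.prems by auto
    let ?b = "b(Suc m := z)"
    have "bij_betw ?b {1..m} (A - {z})"
      using b(1) by (rule bij_betw_cong[THEN iffD1, rotated]) auto
    then have "bij_betw ?b ({1..m} \<union> {Suc m}) ((A - {z}) \<union> {z})"
      by (rule bij_betw_combine) (auto simp: bij_betw_def)
    moreover have "{1..m} \<union> {Suc m} = {1..card A}" "(A - {z}) \<union> {z} = A"
      using Suc.hyps(2) z(1) by auto
    moreover have "expo_gt (?b x) (?b y)" if "x \<in> {1..card A}" "y \<in> {1..card A}" "x < y" for x y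
    proof (cases "y = Suc m")
      case True
      then have "x \<in> {1..m}" using that by simp
      then have "b x \<in> A - {z}" using b(1) bij_betwE by blast
      then show ?thesis using True that z(2) by auto
    next
      case False
      then show ?thesis using that b(2) Suc.hyps(2) by auto
    qed
    ultimately show ?case by (metis (no_types, lifting))
  qed
  from this[OF finite_basis_expos subset_refl] show ?thesis
    unfolding decreasing_listing_def .
qed

definition gram :: "complex \<Rightarrow> complex \<Rightarrow> complex \<Rightarrow> complex \<Rightarrow> (nat \<Rightarrow> expo) \<Rightarrow>
    nat \<Rightarrow> nat \<Rightarrow> complex" where
  "gram h1 h2 c1 c2 b x y = cform h1 h2 c1 c2
     (on_vac h1 h2 c1 c2 (monomial (b x))) (on_vac h1 h2 c1 c2 (monomial (star (b y))))"

end

theory Submission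
  imports Defs "HOL-Library.Multiset"
begin

text \<open>The Gram matrix is triangular because the modes \<open>M\<^sub>n\<close> commute with each other and with
  the \<open>Q\<^sub>r\<close>: the pairing of \<open>Q\<^bsup>k\<^esup>M\<^bsup>j\<^esup>L\<^bsup>i\<^esup>\<one>\<close> with \<open>Q\<^bsup>k1\<^esup>M\<^bsup>i1\<^esup>L\<^bsup>j1\<^esup>\<one>\<close> splits into three pairings.
  In the pairing of \<open>M\<^bsup>j\<^esup>\<close> with \<open>L\<^bsup>j1\<^esup>\<close> every raised \<open>M\<^sub>m\<close> must be turned into \<open>M\<^sub>0\<close> or the center by
  modes \<open>L\<^sub>-\<^sub>n\<close> whose indices add up to \<open>m\<close>, so the partition \<open>j1\<close> has to refine \<open>j\<close>; similarly each
  \<open>Q\<^sub>r\<close> has to meet a \<open>Q\<^sub>-\<^sub>s\<close> with \<open>s \<ge> r\<close>.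

  For the form to be well defined one needs that \<open>U(g\<^sub>0)\<close> meets \<open>g\<^sub>- U(g) + U(g) g\<^sub>+\<close> trivially
  and that the Verma module is nonzero. Both follow from the Poincare-Birkhoff-Witt theorem, obtained
  from Bergman's diamond lemma: any prescription of values on the sorted words extends to a
  linear functional on \<open>U(g)\<close>.\<close>

text \<open>The form rests on two definite descriptions, one for the projection P and one for the
  value on a pair of vectors, and the Verma module is given only by its relations. Nothing can be
  computed before uniqueness is known, and uniqueness needs functionals on U(g) that separate sorted
  words. Hence the diamond lemma is run on the dual side: a functional is defined on words by
  recursion along the rewriting, so that confluence becomes an equality of complex numbers. One such
  functional carries the whole computation: extending the character of g_0 by zero, it reads off the
  coefficient of the vacuum in u 1. It factors through the Verma module and is invariant under the
  anti-involution; the form is its value at the product of bar a and b. The passage to the starred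
  vector exchanges the exponents of L and M, so that M always meets L, and [M,L] lies in the span of
  the M and the center, which commutes with all M and Q. Equal M-modes can meet an L-mode in several
  ways, whence the factorials on the diagonal.\<close>

definition lin_ext :: "('a \<Rightarrow> complex) \<Rightarrow> ('a \<Rightarrow>\<^sub>0 complex) \<Rightarrow> complex" where
  "lin_ext g p = (\<Sum>k\<in>Poly_Mapping.keys p. Poly_Mapping.lookup p k * g k)"

lemma lin_ext_zero [simp]: "lin_ext g 0 = 0"
  by (simp add: lin_ext_def)

lemma lin_ext_add: "lin_ext g (p + q) = lin_ext g p + lin_ext g q"
  unfolding lin_ext_def by (rule setsum_keys_plus_distrib) (simp_all add: distrib_right)

lemma lin_ext_single [simp]: "lin_ext g (Poly_Mapping.single k c) = c * g k"
  by (cases "c = 0") (simp_all add: lin_ext_def)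

lemma lin_ext_uminus: "lin_ext g (- p) = - lin_ext g p"
  by (metis add_eq_0_iff lin_ext_add lin_ext_zero right_minus)

lemma lin_ext_diff: "lin_ext g (p - q) = lin_ext g p - lin_ext g q"
  using lin_ext_add[of g p "- q"] by (simp add: lin_ext_uminus)

lemma lin_ext_cong:
  "(\<And>k. k \<in> Poly_Mapping.keys p \<Longrightarrow> g k = h k) \<Longrightarrow> lin_ext g p = lin_ext h p"
  by (simp add: lin_ext_def)

lemma lin_ext_eq_0: "(\<And>k. k \<in> Poly_Mapping.keys p \<Longrightarrow> g k = 0) \<Longrightarrow> lin_ext g p = 0"
  by (simp add: lin_ext_def)

lemma lin_ext_add_fun: "lin_ext (\<lambda>k. g k + h k) p = lin_ext g p + lin_ext h p"
  by (simp add: lin_ext_def distrib_left sum.distrib)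

lemma lin_ext_mult_fun: "lin_ext (\<lambda>k. c * g k) p = c * lin_ext g p"
  by (simp add: lin_ext_def sum_distrib_left mult.left_commute)

lemma lin_ext_mult_fun_right: "lin_ext (\<lambda>k. g k * c) p = lin_ext g p * c"
  by (simp add: lin_ext_def sum_distrib_right mult.assoc)

lemma lin_ext_divide_fun: "lin_ext (\<lambda>k. g k / c) p = lin_ext g p / c"
  by (simp add: lin_ext_def sum_divide_distrib)

lemma lin_ext_swap:
  "lin_ext (\<lambda>k. lin_ext (g k) q) p = lin_ext (\<lambda>l. lin_ext (\<lambda>k. g k l) p) q"
  unfolding lin_ext_def sum_distrib_left
  by (subst sum.swap) (simp add: mult.left_commute)

section \<open>The superalgebra axioms: skew-symmetry, parity, Jacobi identity\<close>

definition parity_sign :: "gen \<Rightarrow> gen \<Rightarrow> complex" where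
  "parity_sign x y = (if odd_gen x \<and> odd_gen y then - 1 else 1)"

lemma parity_sign_commute: "parity_sign x y = parity_sign y x"
  by (auto simp: parity_sign_def)

lemma parity_sign_square [simp]: "parity_sign x y * parity_sign x y = 1"
  by (simp add: parity_sign_def)

text \<open>The Virasoro cocycle, shared by [L,L] and [L,M]. \<open>odd_central_term\<close> is its
  companion for [Q,Q]; its condition \<open>m + n + 1 = 0\<close> says that the modes m + 1/2 and n
  + 1/2 add up to zero.\<close>

definition central_term :: "int \<Rightarrow> int \<Rightarrow> complex" where
  "central_term m n = (if m + n = 0 then of_int (m ^ 3 - m) / 12 else 0)"

definition odd_central_term :: "int \<Rightarrow> int \<Rightarrow> complex" where
  "odd_central_term m n = (if m + n + 1 = 0 then (half m ^ 2 - 1 / 4) / 3 else 0)"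

lemma lin_ext_bracket:
  "lin_ext g (bracket (gL m) (gL n)) = of_int (m - n) * g (gL (m + n)) + central_term m n * g gC1"
  "lin_ext g (bracket (gL m) (gM n)) = of_int (m - n) * g (gM (m + n)) + central_term m n * g gC2"
  "lin_ext g (bracket (gM n) (gL m)) = - of_int (m - n) * g (gM (m + n)) - central_term m n * g gC2"
  "lin_ext g (bracket (gQ m) (gQ n)) = 2 * g (gM (m + n + 1)) + odd_central_term m n * g gC2"
  "lin_ext g (bracket (gL m) (gQ n)) = (of_int m / 2 - half n) * g (gQ (m + n))"
  "lin_ext g (bracket (gQ n) (gL m)) = - (of_int m / 2 - half n) * g (gQ (m + n))"
  "lin_ext g (bracket (gM m) (gM n)) = 0"
  "lin_ext g (bracket (gM m) (gQ n)) = 0"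
  "lin_ext g (bracket (gQ n) (gM m)) = 0"
  "lin_ext g (bracket x gC1) = 0" "lin_ext g (bracket gC1 x) = 0"
  "lin_ext g (bracket x gC2) = 0" "lin_ext g (bracket gC2 x) = 0"
proof -
  show "lin_ext g (bracket x gC1) = 0" "lin_ext g (bracket gC1 x) = 0"
    "lin_ext g (bracket x gC2) = 0" "lin_ext g (bracket gC2 x) = 0"
    by (cases x; simp)+
qed (simp_all only: bracket.simps lin_ext_add lin_ext_uminus lin_ext_single lin_ext_zero
    central_term_def odd_central_term_def minus_add_distrib minus_mult_left diff_conv_add_uminus)

lemma central_term_skew: "central_term n m = - central_term m n"
proof (cases "m + n = 0")
  case True
  then have "n = - m" by linarith
  then show ?thesis by (simp add: central_term_def field_simps)
qed (simp add: central_term_def add.commute)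

lemma odd_central_term_commute: "odd_central_term n m = odd_central_term m n"
proof (cases "m + n + 1 = 0")
  case True
  then have "n = - m - 1" by linarith
  then show ?thesis unfolding \<open>n = _\<close>
    by (simp add: odd_central_term_def half_def power2_eq_square algebra_simps)
qed (simp add: odd_central_term_def add.commute)

lemma lin_ext_bracket_skew:
  "lin_ext g (bracket y x) = - parity_sign x y * lin_ext g (bracket x y)"
proof (cases x; cases y)
  fix m n assume "x = gL m" "y = gL n"
  then show ?thesis
    using central_term_skew[of n m]
    by (simp add: parity_sign_def lin_ext_bracket algebra_simps del: bracket.simps)
qed (simp_all add: parity_sign_def lin_ext_bracket odd_central_term_commute algebra_simps
    del: bracket.simps)

lemma bracket_same_even: "\<not> odd_gen x \<Longrightarrow> bracket x x = 0"
  by (cases x) auto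

text \<open>A coefficient is itself a linear functional, so questions about the support of a bracket
  reduce to the table \<open>lin_ext_bracket\<close>.\<close>

lemma lookup_eq_lin_ext: "Poly_Mapping.lookup p z = lin_ext (\<lambda>k. if k = z then 1 else 0) p"
  by (simp add: lin_ext_def if_distrib in_keys_iff cong: if_cong)

lemma odd_gen_bracket:
  "z \<in> Poly_Mapping.keys (bracket x y) \<Longrightarrow> odd_gen z \<longleftrightarrow> odd_gen x \<noteq> odd_gen y"
  unfolding in_keys_iff lookup_eq_lin_ext
  by (cases x; cases y) (auto simp: lin_ext_bracket split: if_splits simp del: bracket.simps)

text \<open>The central component of the Jacobi identity for L_m, L_n and L_p or M_p. Outside m + n
  + p = 0 every term vanishes; on it the claim is a polynomial identity.\<close>

lemma central_term_cocycle:
  "of_int (n - p) * central_term m (n + p) =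
     of_int (m - n) * central_term (m + n) p + of_int (m - p) * central_term n (m + p)"
proof (cases "m + n + p = 0")
  case True
  then have p: "p = - m - n" by linarith
  show ?thesis
    unfolding p central_term_def by (simp add: power3_eq_cube) (simp add: field_simps)
qed (simp add: central_term_def add.assoc add.left_commute)

text \<open>The central component of the Jacobi identity for L_m and two odd elements.\<close>

lemma odd_central_term_cocycle:
  "2 * central_term m (n + p + 1) =
     (of_int m / 2 - half n) * odd_central_term (m + n) p
     + (of_int m / 2 - half p) * odd_central_term n (m + p)"
proof (cases "m + n + p + 1 = 0")
  case True
  then have p: "p = - m - n - 1" by linarith
  show ?thesis
    unfolding p central_term_def odd_central_term_def half_def
    by (simp add: power3_eq_cube power2_eq_square) (simp add: field_simps)
qed (simp add: central_term_def odd_central_term_def add.assoc add.left_commute)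

text \<open>The super-Jacobi identity tested against an arbitrary linear functional
  \<open>g\<close>. Only the types LLL, LLM and LQQ, in any order, involve a cocycle condition; the
  other cases are identities between structure constants.\<close>

lemma jacobi:
  "lin_ext (\<lambda>t. lin_ext g (bracket x t)) (bracket y z) =
     lin_ext (\<lambda>t. lin_ext g (bracket t z)) (bracket x y)
     + parity_sign x y * lin_ext (\<lambda>t. lin_ext g (bracket y t)) (bracket x z)"
proof -
  have half_add: "half (m + n) = half m + of_int n" for m n
    by (simp add: half_def)
  \<comment> \<open>Replacing 1/2 by an element \<open>e\<close> with \<open>2 * e = 1\<close>
    removes division, which leaves polynomial identities for \<open>algebra\<close>.\<close>
  obtain e :: complex where e: "2 * e = 1" "\<And>a. a / 2 = a * e"
    by (rule that[of "1 / 2"]) simp_all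
  note simps = lin_ext_bracket add.assoc add.commute add.left_commute of_int_add of_int_diff
    parity_sign_def odd_gen.simps if_True if_False simp_thms mult_1 mult_zero_right add_0_left add_0_right mult_minus1 half_add of_int_1
  show ?thesis
  proof (cases x; cases y; cases z)
    fix m n p assume xyz: "x = gL m" "y = gL n" "z = gL p"
    show ?thesis
      unfolding xyz using central_term_cocycle[of n p m]
      by (simp only: simps) algebra
  next
    fix m n p assume xyz: "x = gL m" "y = gL n" "z = gM p"
    show ?thesis
      unfolding xyz using central_term_cocycle[of n p m]
      by (simp only: simps) algebra
  next
    fix m n p assume xyz: "x = gL m" "y = gM n" "z = gL p"
    show ?thesis
      unfolding xyz using central_term_cocycle[of p n m]
      by (simp only: simps) algebra
  next
    fix m n p assume xyz: "x = gM m" "y = gL n" "z = gL p"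
    show ?thesis
      unfolding xyz using central_term_cocycle[of p m n]
      by (simp only: simps) algebra
  next
    fix m n p assume xyz: "x = gL m" "y = gQ n" "z = gQ p"
    show ?thesis
      unfolding xyz using e(1) odd_central_term_cocycle[of m n p]
      by (simp only: simps half_def e(2)) algebra
  next
    fix m n p assume xyz: "x = gQ m" "y = gL n" "z = gQ p"
    show ?thesis
      unfolding xyz using e(1) odd_central_term_cocycle[of n m p]
      by (simp only: simps half_def e(2)) algebra
  next
    fix m n p assume xyz: "x = gQ m" "y = gQ n" "z = gL p"
    show ?thesis
      unfolding xyz using e(1) odd_central_term_cocycle[of p m n] odd_central_term_commute[of n "p + m"]
      by (simp only: simps half_def e(2)) algebra
  next
    fix m n p assume xyz: "x = gL m" "y = gL n" "z = gQ p"
    show ?thesis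
      unfolding xyz by (simp only: simps half_def) (simp add: field_simps)
  next
    fix m n p assume xyz: "x = gL m" "y = gQ n" "z = gL p"
    show ?thesis
      unfolding xyz by (simp only: simps half_def) (simp add: field_simps)
  next
    fix m n p assume xyz: "x = gQ m" "y = gL n" "z = gL p"
    show ?thesis
      unfolding xyz by (simp only: simps half_def) (simp add: field_simps)
  qed (simp_all add: lin_ext_bracket parity_sign_def half_def algebra_simps del: bracket.simps)
qed

section \<open>Straightening of words\<close>

text \<open>Chosen so that \<open>g\<^sub>-\<close>, \<open>g\<^sub>0\<close>, \<open>g\<^sub>+\<close> are the ranks below \<open>0\<close>, from \<open>0\<close> to \<open>3\<close>, and from \<open>4\<close> on.\<close>

fun gen_rank :: "gen \<Rightarrow> int" where
  "gen_rank (gL n) = 5 * n"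
| "gen_rank (gM n) = 5 * n + 1"
| "gen_rank (gQ n) = 5 * n + 4"
| "gen_rank gC1 = 2"
| "gen_rank gC2 = 3"

lemma gen_rank_eq_iff [simp]: "gen_rank x = gen_rank y \<longleftrightarrow> x = y"
  by (cases x; cases y; simp; presburger)

text \<open>The adjacent pairs forbidden in a sorted PBW word: inversions, and squares of odd
  generators, which are redundant because Q^2 is half of [Q,Q].\<close>

definition reducible :: "gen \<Rightarrow> gen \<Rightarrow> bool" where
  "reducible x y \<longleftrightarrow> gen_rank y < gen_rank x \<or> (x = y \<and> odd_gen x)"

primrec inversions :: "gen list \<Rightarrow> nat" where
  "inversions [] = 0"
| "inversions (x # xs) = length (filter (\<lambda>y. gen_rank y < gen_rank x) xs) + inversions xs"

lemma inversions_swap: "gen_rank y < gen_rank x \<Longrightarrow> inversions (u @ y # x # v) < inversions (u @ x # y # v)"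
  by (induction u) auto

text \<open>Length decides before inversions: passing to a letter of the bracket shortens the word,
  passing to the swapped pair keeps the length and removes an inversion.\<close>

definition word_order :: "(gen list \<times> gen list) set" where
  "word_order = measures [length, inversions]"

lemma wf_word_order: "wf word_order"
  by (simp add: word_order_def)

lemma word_order_shorter: "length w' < length w \<Longrightarrow> (w', w) \<in> word_order"
  by (simp add: word_order_def)

lemma word_order_swap: "gen_rank y < gen_rank x \<Longrightarrow> (u @ y # x # v, u @ x # y # v) \<in> word_order"
  using inversions_swap[of y x u v] by (simp add: word_order_def)

lemma word_order_trans: "(a, b) \<in> word_order \<Longrightarrow> (b, c) \<in> word_order \<Longrightarrow> (a, c) \<in> word_order"
  by (auto simp: word_order_def)

text \<open>One rewriting step as seen by a functional \<open>G\<close> on the middle part of a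
  word: xy becomes the signed yx plus [x,y], and an odd square xx becomes half of [x,x].\<close>

definition reduct :: "gen \<Rightarrow> gen \<Rightarrow> (gen list \<Rightarrow> complex) \<Rightarrow> complex" where
  "reduct x y G = (if x = y then lin_ext (\<lambda>z. G [z]) (bracket x y) / 2
     else parity_sign x y * G [y, x] + lin_ext (\<lambda>z. G [z]) (bracket x y))"

lemma reduct_cong:
  assumes "x \<noteq> y \<Longrightarrow> G [y, x] = H [y, x]"
    and "\<And>z. z \<in> Poly_Mapping.keys (bracket x y) \<Longrightarrow> G [z] = H [z]"
  shows "reduct x y G = reduct x y H"
proof -
  have "lin_ext (\<lambda>z. G [z]) (bracket x y) = lin_ext (\<lambda>z. H [z]) (bracket x y)"
    using assms(2) by (rule lin_ext_cong)
  with assms(1) show ?thesis by (auto simp: reduct_def)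
qed

lemma reduct_eq_0:
  assumes "x \<noteq> y \<Longrightarrow> G [y, x] = 0"
    and "\<And>z. z \<in> Poly_Mapping.keys (bracket x y) \<Longrightarrow> G [z] = 0"
  shows "reduct x y G = 0"
  using reduct_cong[of x y G "\<lambda>_. 0"] assms by (simp add: reduct_def lin_ext_def)

lemma reduct_mult_right: "reduct x y (\<lambda>l. G l * c) = reduct x y G * c"
  by (simp add: reduct_def lin_ext_mult_fun_right distrib_right)

text \<open>Settles the harmless ambiguities of the diamond lemma: rewritings at disjoint places
  commute.\<close>

lemma reduct_swap:
  "reduct x y (\<lambda>l. reduct x' y' (G l)) = reduct x' y' (\<lambda>l'. reduct x y (\<lambda>l. G l l'))"
  using lin_ext_swap[of "\<lambda>z z'. G [z] [z']" "bracket x' y'" "bracket x y"]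
  by (cases "x = y"; cases "x' = y'")
    (simp_all add: reduct_def lin_ext_add_fun lin_ext_mult_fun lin_ext_divide_fun algebra_simps)

definition splits :: "gen list \<Rightarrow> gen list \<Rightarrow> gen \<Rightarrow> gen \<Rightarrow> gen list \<Rightarrow> bool" where
  "splits w u x y v \<longleftrightarrow> w = u @ x # y # v \<and> reducible x y"

definition normal_word :: "gen list \<Rightarrow> bool" where
  "normal_word w \<longleftrightarrow> (\<forall>u x y v. \<not> splits w u x y v)"

text \<open>The value at \<open>w\<close> of the functional that extends \<open>f\<close> from the sorted words. The test in the
  recursive call never fails; it only makes termination provable.\<close>

function nf_eval :: "(gen list \<Rightarrow> complex) \<Rightarrow> gen list \<Rightarrow> complex" where
  "nf_eval f w = (if normal_word w then f w
     else (case (SOME (u, x, y, v). splits w u x y v) of (u, x, y, v) \<Rightarrow>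
       reduct x y (\<lambda>l. if (u @ l @ v, w) \<in> word_order then nf_eval f (u @ l @ v) else 0)))"
  by pat_completeness auto
termination
  by (relation "inv_image word_order snd") (simp_all add: wf_word_order)

declare nf_eval.simps [simp del]

lemma word_order_reduct:
  assumes "reducible x y"
  shows "x \<noteq> y \<Longrightarrow> (u @ y # x # v, u @ x # y # v) \<in> word_order"
    and "(u @ z # v, u @ x # y # v) \<in> word_order"
  using assms word_order_swap by (auto simp: reducible_def intro: word_order_shorter)

lemma nf_normal: "normal_word w \<Longrightarrow> nf_eval f w = f w"
  by (simp add: nf_eval.simps)

lemma nf_step:
  assumes "\<not> normal_word w"
  obtains u x y v where "w = u @ x # y # v" "reducible x y" "nf_eval f w = reduct x y (\<lambda>l. nf_eval f (u @ l @ v))"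
proof -
  obtain u x y v where s: "(SOME (u, x, y, v). splits w u x y v) = (u, x, y, v)"
    by (metis prod_cases4)
  have "\<exists>p. case p of (u, x, y, v) \<Rightarrow> splits w u x y v"
    using assms by (auto simp: normal_word_def)
  from someI_ex[OF this] have sp: "splits w u x y v"
    unfolding s by simp
  then have w: "w = u @ x # y # v" "reducible x y" by (simp_all add: splits_def)
  have "nf_eval f w = reduct x y (\<lambda>l. if (u @ l @ v, w) \<in> word_order then nf_eval f (u @ l @ v) else 0)"
    using assms by (subst nf_eval.simps) (simp add: s)
  also have "\<dots> = reduct x y (\<lambda>l. nf_eval f (u @ l @ v))"
    by (rule reduct_cong) (use word_order_reduct[OF w(2)] w(1) in auto)
  finally show ?thesis using that w by blast
qed

lemma parity_sign_bracket:
  "t \<in> Poly_Mapping.keys (bracket b c) \<Longrightarrow> parity_sign a t = parity_sign a b * parity_sign a c"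
  using odd_gen_bracket[of t b c] by (auto simp: parity_sign_def)

lemma lin_ext_parity_sign:
  "lin_ext (\<lambda>t. parity_sign a t * g t) (bracket b c)
     = parity_sign a b * parity_sign a c * lin_ext g (bracket b c)"
proof -
  have "lin_ext (\<lambda>t. parity_sign a t * g t) (bracket b c)
      = lin_ext (\<lambda>t. parity_sign a b * parity_sign a c * g t) (bracket b c)"
    by (rule lin_ext_cong) (simp add: parity_sign_bracket)
  then show ?thesis by (simp add: lin_ext_mult_fun)
qed

text \<open>The relation is assumed for inverted pairs only; super-skew-symmetry of the bracket
  extends it to all pairs.\<close>

lemma straighten:
  assumes diamond: "\<And>u x y v. length (u @ x # y # v) = n \<Longrightarrow> reducible x y \<Longrightarrow>
      nf_eval f (u @ x # y # v) = reduct x y (\<lambda>l. nf_eval f (u @ l @ v))"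
    and len: "length (u @ x # y # v) = n"
  shows "nf_eval f (u @ x # y # v) = parity_sign x y * nf_eval f (u @ y # x # v)
      + lin_ext (\<lambda>z. nf_eval f (u @ z # v)) (bracket x y)"
proof -
  consider "gen_rank y < gen_rank x" | "gen_rank x < gen_rank y" | "x = y" "odd_gen x" | "x = y" "\<not> odd_gen x"
    using gen_rank_eq_iff by fastforce
  then show ?thesis
  proof cases
    case 1
    then show ?thesis
      using diamond[OF len] by (auto simp: reducible_def reduct_def)
  next
    case 2
    then have "nf_eval f (u @ y # x # v) = parity_sign y x * nf_eval f (u @ x # y # v)
        + lin_ext (\<lambda>z. nf_eval f (u @ z # v)) (bracket y x)"
      using diamond[of u y x v] len by (auto simp: reducible_def reduct_def)
    then show ?thesis
      by (simp add: lin_ext_bracket_skew[of _ y x] parity_sign_def split: if_splits)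
  next
    case 3
    then have "nf_eval f (u @ x # y # v) = lin_ext (\<lambda>z. nf_eval f (u @ z # v)) (bracket x y) / 2"
      using diamond[OF len] by (auto simp: reducible_def reduct_def)
    with 3 show ?thesis by (simp add: parity_sign_def field_simps)
  next
    case 4
    then show ?thesis by (simp add: parity_sign_def bracket_same_even)
  qed
qed

text \<open>The overlap ambiguity of a word xyz, rewritten first at xy or first at yz. After both
  routes are continued to zyx, the difference is the Jacobi identity. The three-letter assumptions
  concern only words below xyz, where an induction can provide them; \<open>two\<close> may be used
  for all pairs because its words are shorter.\<close>

lemma overlap:
  assumes xy: "reducible x y" and yz: "reducible y z"
    and two: "\<And>a b. N [a, b] = parity_sign a b * N [b, a] + lin_ext (\<lambda>t. N [t]) (bracket a b)"
    and yxz: "x \<noteq> y \<Longrightarrow> N [y, x, z] = reduct x z (\<lambda>l. N (y # l))"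
    and yzx: "x \<noteq> y \<Longrightarrow> N [y, z, x] = reduct y z (\<lambda>l. N (l @ [x]))"
    and xzy: "y \<noteq> z \<Longrightarrow> N [x, z, y] = reduct x z (\<lambda>l. N (l @ [y]))"
    and zxy: "y \<noteq> z \<Longrightarrow> N [z, x, y] = reduct x y (\<lambda>l. N (z # l))"
  shows "reduct x y (\<lambda>l. N (l @ [z])) = reduct y z (\<lambda>l. N (x # l))"
proof -
  \<comment> \<open>\<open>B\<close> and \<open>C\<close> keep one letter to the left or right of a
    bracket; \<open>J\<close> and \<open>K\<close> are the double brackets left over when that
    letter is moved across.\<close>
  define B where "B a b c = lin_ext (\<lambda>t. N [a, t]) (bracket b c)" for a b c
  define C where "C a b c = lin_ext (\<lambda>t. N [t, a]) (bracket b c)" for a b c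
  define J where "J a b c = lin_ext (\<lambda>t. lin_ext (\<lambda>s. N [s]) (bracket a t)) (bracket b c)" for a b c
  define K where "K a b c = lin_ext (\<lambda>t. lin_ext (\<lambda>s. N [s]) (bracket t a)) (bracket b c)" for a b c
  have BC: "B a b c = parity_sign a b * parity_sign a c * C a b c + J a b c" for a b c
    unfolding B_def C_def J_def by (subst two) (simp add: lin_ext_add_fun lin_ext_parity_sign)
  have CB: "C a b c = parity_sign a b * parity_sign a c * B a b c + K a b c" for a b c
    unfolding B_def C_def K_def
    by (subst two) (simp add: lin_ext_add_fun lin_ext_parity_sign parity_sign_commute[of _ a])
  have Jac: "J x y z = K z x y + parity_sign x y * J y x z"
    unfolding J_def K_def by (rule jacobi)
  consider "x \<noteq> y" "y \<noteq> z" | "x = y" "odd_gen x" "y \<noteq> z" | "x \<noteq> y" "y = z" "odd_gen y"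
    | "x = y" "y = z" "odd_gen x"
    using xy yz by (auto simp: reducible_def)
  then show ?thesis
  proof cases
    case 1
    then have "x \<noteq> z" using xy yz by (auto simp: reducible_def)
    have 2: "N [y, x, z] = parity_sign x z * N [y, z, x] + B y x z"
      "N [y, z, x] = parity_sign y z * N [z, y, x] + C x y z"
      "N [x, z, y] = parity_sign x z * N [z, x, y] + C y x z"
      "N [z, x, y] = parity_sign x y * N [z, y, x] + B z x y"
      using 1 \<open>x \<noteq> z\<close> yxz yzx xzy zxy by (simp_all add: reduct_def B_def C_def)
    have "reduct x y (\<lambda>l. N (l @ [z])) = parity_sign x y * N [y, x, z] + C z x y"
      "reduct y z (\<lambda>l. N (x # l)) = parity_sign y z * N [x, z, y] + B x y z"
      using 1 by (simp_all add: reduct_def B_def C_def)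
    then show ?thesis
      using 2 Jac CB[of z x y] BC[of x y z] BC[of y x z]
      by (simp add: parity_sign_commute[of z] parity_sign_commute[of y x])
        (simp add: parity_sign_def algebra_simps split: if_splits)
  next
    case 2
    then have "x \<noteq> z" by auto
    have 3: "N [x, z, x] = parity_sign x z * N [z, x, x] + C x x z" "N [z, x, x] = B z x x / 2"
      using 2 \<open>x \<noteq> z\<close> xzy zxy by (simp_all add: reduct_def B_def C_def)
    have "reduct x y (\<lambda>l. N (l @ [z])) = C z x x / 2"
      "reduct y z (\<lambda>l. N (x # l)) = parity_sign x z * N [x, z, x] + B x x z"
      using 2 by (simp_all add: reduct_def B_def C_def)
    \<comment> \<open>An odd square carries the factor 1/2, so the two sides are compared after
      doubling.\<close>
    then have "reduct x y (\<lambda>l. N (l @ [z])) * 2 = reduct y z (\<lambda>l. N (x # l)) * 2"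
      using 3 Jac CB[of z x x] BC[of x x z] 2
      by (simp add: parity_sign_commute[of z]) (simp add: parity_sign_def algebra_simps split: if_splits)
    then show ?thesis by simp
  next
    case 3
    then have "x \<noteq> z" by auto
    have 4: "N [y, x, y] = parity_sign x y * N [y, y, x] + B y x y" "N [y, y, x] = C x y y / 2"
      using 3 \<open>x \<noteq> z\<close> yxz yzx by (simp_all add: reduct_def B_def C_def)
    have "reduct x y (\<lambda>l. N (l @ [z])) = parity_sign x y * N [y, x, y] + C y x y"
      "reduct y z (\<lambda>l. N (x # l)) = B x y y / 2"
      using 3 by (simp_all add: reduct_def B_def C_def)
    then have "reduct x y (\<lambda>l. N (l @ [z])) * 2 = reduct y z (\<lambda>l. N (x # l)) * 2"
      using 4 Jac BC[of x y y] CB[of y x y] BC[of y x y] 3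
      by (simp add: parity_sign_commute[of y x]) (simp add: parity_sign_def algebra_simps split: if_splits)
    then show ?thesis by simp
  next
    case 4
    \<comment> \<open>Skew-symmetry gives K = - J, and the Jacobi identity for x = y = z gives J = K
      - J. Hence 3 J = 0, that is, [x,[x,x]] = 0.\<close>
    have "K x x x = lin_ext (\<lambda>t. - (parity_sign x t * lin_ext (\<lambda>s. N [s]) (bracket x t))) (bracket x x)"
      unfolding K_def by (subst lin_ext_bracket_skew) simp
    also have "\<dots> = - J x x x"
      using lin_ext_parity_sign[of x "\<lambda>t. lin_ext (\<lambda>s. N [s]) (bracket x t)" x x]
        lin_ext_mult_fun[of "-1" "\<lambda>t. parity_sign x t * lin_ext (\<lambda>s. N [s]) (bracket x t)"]
      by (simp add: J_def parity_sign_def)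
    finally have "J x x x = 0"
      using Jac 4 by (simp add: parity_sign_def)
    then have "B x x x = C x x x"
      using BC[of x x x] by simp
    with 4 show ?thesis
      by (simp add: reduct_def B_def C_def)
  qed
qed

text \<open>Two reducible pairs of one word at different places are either disjoint, where
  \<open>reduct_swap\<close> applies, or share one letter, where \<open>overlap\<close> applies. All
  words met on the way are smaller, so the induction hypothesis \<open>IH\<close> covers
  them.\<close>

lemma diamond_local:
  assumes IH: "\<And>u x y v. (u @ x # y # v, w) \<in> word_order \<Longrightarrow> reducible x y \<Longrightarrow>
      nf_eval f (u @ x # y # v) = reduct x y (\<lambda>l. nf_eval f (u @ l @ v))"
    and w: "w = u @ x # y # v" "w = u' @ x' # y' # v'" and bads: "reducible x y" "reducible x' y'"
    and len: "length u < length u'"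
  shows "reduct x y (\<lambda>l. nf_eval f (u @ l @ v)) = reduct x' y' (\<lambda>l. nf_eval f (u' @ l @ v'))"
proof -
  from w len obtain s where s: "u' = u @ s" "x # y # v = s @ x' # y' # v'" "s \<noteq> []"
    by (auto simp: append_eq_append_conv2)
  then obtain s' where s': "s = x # s'" "y # v = s' @ x' # y' # v'"
    by (cases s) auto
  show ?thesis
  proof (cases s')
    case (Cons a t)
    then have t: "s = x # y # t" "v = t @ x' # y' # v'" using s' by auto
    have double_weight: "w = u @ x # y # t @ x' # y' # v'" using w(1) t by simp
    have "reduct x y (\<lambda>l. nf_eval f (u @ l @ v))
        = reduct x y (\<lambda>l. reduct x' y' (\<lambda>l'. nf_eval f (u @ l @ t @ l' @ v')))"
    proof (rule reduct_cong)
      assume "x \<noteq> y"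
      then have "(u @ y # x # v, w) \<in> word_order"
        using word_order_reduct(1)[OF bads(1)] w(1) by simp
      then show "nf_eval f (u @ [y, x] @ v) = reduct x' y' (\<lambda>l'. nf_eval f (u @ [y, x] @ t @ l' @ v'))"
        using IH[of "u @ [y, x] @ t" x' y' v'] bads t by simp
    next
      fix z
      have "(u @ z # v, w) \<in> word_order"
        using word_order_reduct(2)[OF bads(1)] w(1) by simp
      then show "nf_eval f (u @ [z] @ v) = reduct x' y' (\<lambda>l'. nf_eval f (u @ [z] @ t @ l' @ v'))"
        using IH[of "u @ [z] @ t" x' y' v'] bads t by simp
    qed
    also have "\<dots> = reduct x' y' (\<lambda>l'. reduct x y (\<lambda>l. nf_eval f (u @ l @ t @ l' @ v')))"
      by (rule reduct_swap)
    also have "\<dots> = reduct x' y' (\<lambda>l'. nf_eval f (u' @ l' @ v'))"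
    proof (rule reduct_cong)
      assume "x' \<noteq> y'"
      then have "(u' @ y' # x' # v', w) \<in> word_order"
        using word_order_reduct(1)[OF bads(2)] w(2) by simp
      then show "reduct x y (\<lambda>l. nf_eval f (u @ l @ t @ [y', x'] @ v')) = nf_eval f (u' @ [y', x'] @ v')"
        using IH[of u x y "t @ [y', x'] @ v'"] bads s(1) t by simp
    next
      fix z
      have "(u' @ z # v', w) \<in> word_order"
        using word_order_reduct(2)[OF bads(2)] w(2) by simp
      then show "reduct x y (\<lambda>l. nf_eval f (u @ l @ t @ [z] @ v')) = nf_eval f (u' @ [z] @ v')"
        using IH[of u x y "t @ [z] @ v'"] bads s(1) t by simp
    qed
    finally show ?thesis .
  next
    case Nil
    then have t: "u' = u @ [x]" "x' = y" "v = y' # v'" using s s' by auto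
    have double_weight: "w = u @ x # y # y' # v'" using w(1) t by simp
    have yy': "reducible y y'" using bads t by simp
    let ?N = "\<lambda>l. nf_eval f (u @ l @ v')"
    have yxz: "(u @ y # x # y' # v', w) \<in> word_order" if "x \<noteq> y"
      using word_order_reduct(1)[OF bads(1) that, of u "y' # v'"] double_weight by simp
    have xzy: "(u @ x # y' # y # v', w) \<in> word_order" if "y \<noteq> y'"
      using word_order_reduct(1)[OF yy' that, of "u @ [x]" v'] double_weight by simp
    \<comment> \<open>If at least one of the two pairs is a strict inversion, so are the outer
      letters; this lets the rewriting go on after the first swap.\<close>
    have xz: "reducible x y' \<and> x \<noteq> y'" if "x \<noteq> y \<or> y \<noteq> y'"
      using that bads(1) yy' by (auto simp: reducible_def)
    have yzx: "(u @ y # y' # x # v', w) \<in> word_order" if "x \<noteq> y"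
      using word_order_trans[OF _ yxz[OF that]] word_order_reduct(1)[of x y' "u @ [y]" v'] xz that by simp
    have zxy: "(u @ y' # x # y # v', w) \<in> word_order" if "y \<noteq> y'"
      using word_order_trans[OF _ xzy[OF that]] word_order_reduct(1)[of x y' u "y # v'"] xz that by simp
    have "reduct x y (\<lambda>l. ?N (l @ [y'])) = reduct y y' (\<lambda>l. ?N (x # l))"
    proof (rule overlap[OF bads(1) yy', of ?N])
      show "?N [a, b] = parity_sign a b * ?N [b, a] + lin_ext (\<lambda>t. ?N [t]) (bracket a b)" for a b
      proof -
        have "nf_eval f (p @ c # d # q) = reduct c d (\<lambda>l. nf_eval f (p @ l @ q))"
          if "length (p @ c # d # q) = length (u @ a # b # v')" "reducible c d" for p c d q
          \<comment> \<open>These words are one letter shorter than \<open>w\<close>, hence below it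
            whatever their inversions.\<close>
          using that double_weight by (intro IH word_order_shorter) simp_all
        then have "nf_eval f (u @ a # b # v') = parity_sign a b * nf_eval f (u @ b # a # v')
            + lin_ext (\<lambda>z. nf_eval f (u @ z # v')) (bracket a b)"
          by (rule straighten[OF _ refl])
        then show ?thesis by simp
      qed
      show "?N [y, x, y'] = reduct x y' (\<lambda>l. ?N (y # l))" if "x \<noteq> y"
        using IH[of "u @ [y]" x y' v'] yxz[OF that] xz that by simp
      show "?N [y, y', x] = reduct y y' (\<lambda>l. ?N (l @ [x]))" if "x \<noteq> y"
        using IH[of u y y' "x # v'"] yzx[OF that] yy' by simp
      show "?N [x, y', y] = reduct x y' (\<lambda>l. ?N (l @ [y]))" if "y \<noteq> y'"
        using IH[of u x y' "y # v'"] xzy[OF that] xz that by simp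
      show "?N [y', x, y] = reduct x y (\<lambda>l. ?N (y' # l))" if "y \<noteq> y'"
        using IH[of "u @ [y']" x y v'] zxy[OF that] bads(1) by simp
    qed
    then show ?thesis using t by simp
  qed
qed

text \<open>\<open>nf_eval\<close> rewrites at a place picked by choice. Comparing this place with
  the given one by \<open>diamond_local\<close> shows that the choice is immaterial.\<close>

lemma diamond:
  "reducible x y \<Longrightarrow> nf_eval f (u @ x # y # v) = reduct x y (\<lambda>l. nf_eval f (u @ l @ v))"
proof (induction "u @ x # y # v" arbitrary: u x y v rule: wf_induct_rule[OF wf_word_order])
  case less: 1
  let ?w = "u @ x # y # v"
  have IH: "nf_eval f (p @ a # b # q) = reduct a b (\<lambda>l. nf_eval f (p @ l @ q))"
    if "(p @ a # b # q, ?w) \<in> word_order" "reducible a b" for p a b q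
    using less(1)[OF that] .
  have "\<not> normal_word ?w"
    using less.prems by (auto simp: normal_word_def splits_def)
  then obtain u0 x0 y0 v0 where 0: "?w = u0 @ x0 # y0 # v0" "reducible x0 y0"
      "nf_eval f ?w = reduct x0 y0 (\<lambda>l. nf_eval f (u0 @ l @ v0))"
    by (rule nf_step)
  show ?case
  proof (cases "length u" "length u0" rule: linorder_cases)
    case less': less
    show ?thesis
      using diamond_local[OF IH refl 0(1) less.prems 0(2) less'] 0(3) by simp
  next
    case equal
    then show ?thesis using 0 by simp
  next
    case greater
    show ?thesis
      using diamond_local[OF IH 0(1) refl 0(2) less.prems greater] 0(3) by simp
  qed
qed

text \<open>This is exactly the vanishing on the generators of the ideal that defines U(g), so the
  functional descends to U(g).\<close>

lemma nf_commute:
  "nf_eval f (u @ x # y # v) = parity_sign x y * nf_eval f (u @ y # x # v)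
      + lin_ext (\<lambda>z. nf_eval f (u @ z # v)) (bracket x y)"
  by (rule straighten[OF diamond refl])

section \<open>Linear functionals on the enveloping algebra\<close>

definition tens_functional :: "(gen list \<Rightarrow> complex) \<Rightarrow> tens_alg \<Rightarrow> complex" where
  "tens_functional f p = lin_ext (\<lambda>w. nf_eval f (letters w)) p"

lemma tens_functional_tlin:
  "tens_functional f (Poly_Mapping.single (Wrd u) c * tlin p * Poly_Mapping.single (Wrd v) d)
     = c * d * lin_ext (\<lambda>z. nf_eval f (u @ z # v)) p"
  by (induction p rule: poly_mapping_additive_induct)
    (simp_all add: tens_functional_def tlin_single tlin_add lin_ext_add distrib_left distrib_right mult_single
      plus_wrd_def)

lemma tens_functional_super_rel: "tens_functional f (a * super_rel x y * b) = 0"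
proof (induction a rule: poly_mapping_additive_induct)
  case (single u c)
  show ?case
  proof (induction b rule: poly_mapping_additive_induct)
    case (single v d)
    have rel: "super_rel x y = Poly_Mapping.single (Wrd [x, y]) 1
        - Poly_Mapping.single (Wrd [y, x]) (parity_sign x y) - tlin (bracket x y)"
      by (simp add: super_rel_def tgen_def tscal_def mult_single plus_wrd_def zero_wrd_def
          parity_sign_def)
    have "tens_functional f (Poly_Mapping.single u c * super_rel x y * Poly_Mapping.single v d)
      = c * d * (nf_eval f (letters u @ x # y # letters v)
          - parity_sign x y * nf_eval f (letters u @ y # x # letters v))
        - tens_functional f (Poly_Mapping.single u c * tlin (bracket x y) * Poly_Mapping.single v d)"
      unfolding rel tens_functional_def
      by (simp add: left_diff_distrib right_diff_distrib mult_single lin_ext_diff plus_wrd_def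
          mult.left_commute mult.commute)
    also have "\<dots> = 0"
      using tens_functional_tlin[of f "letters u" c "bracket x y" "letters v" d]
        nf_commute[of f "letters u" x y "letters v"]
      by simp
    finally show ?case .
  qed (simp_all add: tens_functional_def distrib_left lin_ext_add)
qed (simp_all add: tens_functional_def distrib_right lin_ext_add)

lemma tens_functional_super_ideal: "p \<in> super_ideal \<Longrightarrow> tens_functional f p = 0"
proof (induction rule: super_ideal.induct)
  case zero
  show ?case by (simp add: tens_functional_def)
next
  case (rel a x y b)
  show ?case by (rule tens_functional_super_rel)
next
  case (add p q)
  then show ?case by (simp add: tens_functional_def lin_ext_add)
qed

lift_definition uea_functional :: "(gen list \<Rightarrow> complex) \<Rightarrow> uea \<Rightarrow> complex" is tens_functional
  using tens_functional_super_ideal by (force simp: super_cong_def tens_functional_def lin_ext_diff)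

lemma uea_functional_add: "uea_functional f (u + v) = uea_functional f u + uea_functional f v"
  by transfer (simp add: tens_functional_def lin_ext_add)

lemma uea_functional_zero [simp]: "uea_functional f 0 = 0"
  by transfer (simp add: tens_functional_def)

lemma uea_functional_uminus: "uea_functional f (- u) = - uea_functional f u"
  by (metis add_eq_0_iff uea_functional_add uea_functional_zero right_minus)

lemma uea_functional_diff: "uea_functional f (u - v) = uea_functional f u - uea_functional f v"
  using uea_functional_add[of f u "- v"] by (simp add: uea_functional_uminus)

lemma uea_functional_sum: "uea_functional f (sum g A) = (\<Sum>x\<in>A. uea_functional f (g x))"
  by (induction A rule: infinite_finite_induct) (simp_all add: uea_functional_add)

section \<open>Scalars, words and straightening inside the enveloping algebra\<close>

lemma super_cong_refl: "super_cong p p"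
  by (simp add: super_cong_def super_ideal.zero)

lemma uscal_0 [simp]: "uscal 0 = 0"
  by transfer (simp add: tscal_def super_cong_refl)

lemma uscal_1 [simp]: "uscal 1 = 1"
  by transfer (simp add: tscal_def super_cong_refl)

lemma uscal_add: "uscal (c + d) = uscal c + uscal d"
  by transfer (simp add: tscal_def single_add super_cong_refl)

lemma uscal_mult: "uscal (c * d) = uscal c * uscal d"
  by transfer (simp add: tscal_def mult_single super_cong_refl)

lemma uscal_uminus: "uscal (- c) = - uscal c"
  by transfer (simp add: tscal_def single_uminus super_cong_refl)

lemma uscal_commute: "uscal c * u = u * uscal c"
proof transfer
  fix c :: complex and p :: tens_alg
  have "tscal c * p = p * tscal c"
    by (induction p rule: poly_mapping_additive_induct)
      (simp_all add: tscal_def mult_single distrib_left distrib_right mult.commute)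
  then show "super_cong (tscal c * p) (p * tscal c)" by (simp add: super_cong_refl)
qed

lemma uscal_left_commute: "u * (uscal c * v) = uscal c * (u * v)"
  by (metis mult.assoc uscal_commute)

abbreviation uword :: "gen list \<Rightarrow> uea" where
  "uword w \<equiv> prod_list (map ugen w)"

lemma abs_uea_single: "abs_uea (Poly_Mapping.single (Wrd w) c) = uscal c * uword w"
proof (induction w arbitrary: c)
  case Nil
  show ?case
    by (simp add: uscal.abs_eq tscal_def zero_wrd_def)
next
  case (Cons x w)
  have "Poly_Mapping.single (Wrd (x # w)) c = tgen x * Poly_Mapping.single (Wrd w) c"
    by (simp add: tgen_def mult_single plus_wrd_def)
  then have "abs_uea (Poly_Mapping.single (Wrd (x # w)) c)
      = abs_uea (tgen x) * abs_uea (Poly_Mapping.single (Wrd w) c)"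
    by (simp only: times_uea.abs_eq)
  then have "abs_uea (Poly_Mapping.single (Wrd (x # w)) c) = ugen x * (uscal c * uword w)"
    by (simp only: ugen.abs_eq[symmetric] Cons)
  then show ?case by (simp add: uscal_left_commute)
qed

lemma uea_induct [case_names word add]:
  assumes "\<And>c w. P (uscal c * uword w)" "\<And>u v. P u \<Longrightarrow> P v \<Longrightarrow> P (u + v)"
  shows "P u"
proof (induction u rule: uea.abs_induct)
  case (1 p)
  show ?case
  proof (induction p rule: poly_mapping_additive_induct)
    case zero
    show ?case using assms(1)[of 0] by (simp flip: zero_uea.abs_eq)
  next
    case (single w c)
    then show ?case using assms(1)[of c "letters w"] abs_uea_single[of "letters w" c] by simp
  next
    case (add p q)
    then show ?case using assms(2) by (simp add: plus_uea.abs_eq[symmetric])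
  qed
qed

lemma uea_functional_word: "uea_functional f (uscal c * uword w) = c * nf_eval f w"
  unfolding abs_uea_single[symmetric] by (simp add: uea_functional.abs_eq tens_functional_def)

lemma uea_functional_uscal_mult: "uea_functional f (uscal c * u) = c * uea_functional f u"
  by (induction u rule: uea_induct)
    (simp_all add: uea_functional_word uea_functional_add distrib_left uscal_mult[symmetric] mult.assoc[symmetric])

lift_definition ulin :: "(gen \<Rightarrow>\<^sub>0 complex) \<Rightarrow> uea" is tlin .

lemma ulin_zero [simp]: "ulin 0 = 0"
  by transfer (simp add: super_cong_refl)

lemma ulin_add: "ulin (p + q) = ulin p + ulin q"
  by transfer (simp add: super_cong_refl tlin_add)

lemma ulin_single [simp]: "ulin (Poly_Mapping.single x c) = uscal c * ugen x"
  by transfer (simp add: super_cong_refl tlin_single tscal_def tgen_def mult_single)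

lemma ulin_eq_sum: "ulin p = (\<Sum>z\<in>Poly_Mapping.keys p. uscal (Poly_Mapping.lookup p z) * ugen z)"
proof -
  have p: "p = (\<Sum>z\<in>Poly_Mapping.keys p. Poly_Mapping.single z (Poly_Mapping.lookup p z))"
    by (rule poly_mapping_eqI) (auto simp: lookup_sum lookup_single when_def in_keys_iff)
  have "ulin (sum g A) = (\<Sum>z\<in>A. ulin (g z))" for g :: "gen \<Rightarrow> _" and A
    by (induction A rule: infinite_finite_induct) (simp_all add: ulin_add)
  from this[of "\<lambda>z. Poly_Mapping.single z (Poly_Mapping.lookup p z)" "Poly_Mapping.keys p"]
  show ?thesis unfolding p[symmetric] by simp
qed

lemma ugen_commute:
  "ugen x * ugen y = uscal (parity_sign x y) * (ugen y * ugen x) + ulin (bracket x y)"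
proof transfer
  fix x y
  have "tgen x * tgen y - (tscal (parity_sign x y) * (tgen y * tgen x) + tlin (bracket x y))
      = 1 * super_rel x y * 1"
    by (simp add: super_rel_def parity_sign_def mult.assoc)
  then show "super_cong (tgen x * tgen y)
      (tscal (parity_sign x y) * (tgen y * tgen x) + tlin (bracket x y))"
    unfolding super_cong_def by (metis super_ideal.rel)
qed

lemma uword_commute:
  "uword (u @ x # y # v) = uscal (parity_sign x y) * uword (u @ y # x # v)
     + (\<Sum>z\<in>Poly_Mapping.keys (bracket x y).
          uscal (Poly_Mapping.lookup (bracket x y) z) * uword (u @ z # v))"
proof -
  have "uword (u @ x # y # v) = uword u * (ugen x * ugen y) * uword v"
    by (simp add: mult.assoc)
  also have "\<dots> = uword u * (uscal (parity_sign x y) * (ugen y * ugen x)) * uword v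
      + uword u * ulin (bracket x y) * uword v"
    by (simp only: ugen_commute[of x y] distrib_left distrib_right)
  also have "uword u * (uscal (parity_sign x y) * (ugen y * ugen x)) * uword v
      = uscal (parity_sign x y) * uword (u @ y # x # v)"
    by (simp add: uscal_left_commute mult.assoc)
  also have "uword u * ulin (bracket x y) * uword v = (\<Sum>z\<in>Poly_Mapping.keys (bracket x y).
          uscal (Poly_Mapping.lookup (bracket x y) z) * uword (u @ z # v))"
    by (simp add: ulin_eq_sum sum_distrib_left sum_distrib_right uscal_left_commute mult.assoc)
  finally show ?thesis .
qed

text \<open>The counterpart of \<open>reduct\<close> for elements. The coefficients 0 and 1/2 at x =
  y ensure that every word with nonzero coefficient on the right is smaller in
  \<open>word_order\<close>.\<close>

lemma uword_reducible:
  assumes "reducible x y"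
  shows "uword (u @ x # y # v) = uscal (if x = y then 0 else parity_sign x y) * uword (u @ y # x # v)
     + (\<Sum>z\<in>Poly_Mapping.keys (bracket x y).
          uscal ((if x = y then 1 / 2 else 1) * Poly_Mapping.lookup (bracket x y) z) * uword (u @ z # v))"
proof (cases "x = y")
  case True
  let ?W = "uword (u @ x # x # v)"
  let ?S = "\<Sum>z\<in>Poly_Mapping.keys (bracket x x).
    uscal (Poly_Mapping.lookup (bracket x x) z) * uword (u @ z # v)"
  \<comment> \<open>An odd x anticommutes with itself up to the bracket: W = S - W, hence W is half
    of S.\<close>
  from True assms have "?W = ?S - ?W"
    using uword_commute[of u x x v] by (simp add: reducible_def parity_sign_def uscal_uminus)
  then have "?W + ?W = ?S" by (simp only: eq_diff_eq)
  have "?W = (uscal (1 / 2) + uscal (1 / 2)) * ?W"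
    by (simp flip: uscal_add)
  also have "\<dots> = uscal (1 / 2) * (?W + ?W)"
    by (simp only: distrib_left distrib_right)
  also have "\<dots> = uscal (1 / 2) * ?S" using \<open>?W + ?W = ?S\<close> by simp
  also have "\<dots> = (\<Sum>z\<in>Poly_Mapping.keys (bracket x x).
      uscal (1 / 2 * Poly_Mapping.lookup (bracket x x) z) * uword (u @ z # v))"
    by (simp only: sum_distrib_left uscal_mult mult.assoc)
  finally show ?thesis
    using True by simp
qed (use uword_commute[of u x y v] in simp)

section \<open>The triangular decomposition in terms of ranks\<close>

lemma g_minus_iff: "x \<in> g_minus \<longleftrightarrow> gen_rank x < 0"
  by (cases x) (auto simp: g_minus_def)

lemma g_plus_iff: "x \<in> g_plus \<longleftrightarrow> 4 \<le> gen_rank x"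
  by (cases x) (auto simp: g_plus_def)

lemma g_zero_iff: "x \<in> g_zero \<longleftrightarrow> 0 \<le> gen_rank x \<and> gen_rank x < 4"
proof (cases x)
  case (gQ m)
  have "\<not> (0 \<le> 5 * m + 4 \<and> 5 * m + 4 < (4 :: int))" by presburger
  with gQ show ?thesis by (simp add: g_zero_def)
qed (auto simp: g_zero_def)

lemma gen_trichotomy: "x \<in> g_minus \<or> x \<in> g_zero \<or> x \<in> g_plus"
  by (auto simp: g_minus_iff g_zero_iff g_plus_iff)

lemma bracket_closed:
  assumes "z \<in> Poly_Mapping.keys (bracket x y)"
  shows "x \<in> g_minus \<Longrightarrow> y \<in> g_minus \<Longrightarrow> z \<in> g_minus"
    and "x \<in> g_plus \<Longrightarrow> y \<in> g_plus \<Longrightarrow> z \<in> g_plus"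
    and "x \<in> g_plus \<Longrightarrow> y \<in> g_zero \<Longrightarrow> z \<in> g_plus"
  using assms unfolding in_keys_iff lookup_eq_lin_ext g_minus_iff g_plus_iff g_zero_iff
  by (cases x; cases y;
      auto simp: lin_ext_bracket central_term_def odd_central_term_def split: if_splits
        simp del: bracket.simps)+

lemma bracket_g_zero:
  assumes "x \<in> g_zero" "y \<in> g_zero"
  shows "bracket x y = 0"
  using assms by (auto simp: g_zero_def)

text \<open>The recursion of \<open>nf_eval\<close> never leaves a set \<open>K\<close> closed under
  rewriting, so only the zero values of \<open>f\<close> on \<open>K\<close> are ever
  consulted.\<close>

lemma nf_eq_0:
  assumes swap: "\<And>u x y v. u @ x # y # v \<in> K \<Longrightarrow> reducible x y \<Longrightarrow> x \<noteq> y \<Longrightarrow> u @ y # x # v \<in> K"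
    and shorten: "\<And>u x y v z. u @ x # y # v \<in> K \<Longrightarrow> reducible x y \<Longrightarrow> z \<in> Poly_Mapping.keys (bracket x y) \<Longrightarrow>
      u @ z # v \<in> K"
    and zero: "\<And>w. w \<in> K \<Longrightarrow> f w = 0"
    and "w \<in> K"
  shows "nf_eval f w = 0"
  using \<open>w \<in> K\<close>
proof (induction w rule: wf_induct_rule[OF wf_word_order])
  case (1 w)
  show ?case
  proof (cases "normal_word w")
    case True
    then show ?thesis using zero 1(2) by (simp add: nf_normal)
  next
    case False
    then obtain u x y v where w: "w = u @ x # y # v" "reducible x y"
        "nf_eval f w = reduct x y (\<lambda>l. nf_eval f (u @ l @ v))"
      by (rule nf_step)
    have "reduct x y (\<lambda>l. nf_eval f (u @ l @ v)) = 0"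
    proof (rule reduct_eq_0)
      show "nf_eval f (u @ [y, x] @ v) = 0" if "x \<noteq> y"
        using 1(1)[of "u @ y # x # v"] swap[of u x y v] word_order_reduct(1)[OF w(2) that, of u v]
          1(2) w that by simp
      show "nf_eval f (u @ [z] @ v) = 0" if "z \<in> Poly_Mapping.keys (bracket x y)" for z
        using 1(1)[of "u @ z # v"] shorten[of u x y v z] word_order_reduct(2)[OF w(2), of u z v]
          1(2) w that by simp
    qed
    with w show ?thesis by simp
  qed
qed

lemma reducible_cases:
  assumes "reducible x y"
  shows "y \<in> g_minus \<or> x \<notin> g_minus" "x \<in> g_plus \<or> y \<notin> g_plus"
  using assms by (auto simp: reducible_def g_minus_iff g_plus_iff)

text \<open>Sorting replaces the first letter only by one of lower rank or by a bracket with such a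
  letter; g_- has the lowest ranks and is closed under brackets. \<open>nf_last_plus\<close> is the
  mirror image.\<close>

lemma nf_hd_minus:
  assumes f: "\<And>w. w \<noteq> [] \<Longrightarrow> hd w \<in> g_minus \<Longrightarrow> f w = 0" and x: "x \<in> g_minus"
  shows "nf_eval f (x # w) = 0"
proof (rule nf_eq_0[of "{w. w \<noteq> [] \<and> hd w \<in> g_minus}"])
  fix u x y v
  assume *: "u @ x # y # v \<in> {w. w \<noteq> [] \<and> hd w \<in> g_minus}" "reducible x y"
  then show "u @ y # x # v \<in> {w. w \<noteq> [] \<and> hd w \<in> g_minus}"
    using reducible_cases(1)[of x y] by (cases u) auto
  show "u @ z # v \<in> {w. w \<noteq> [] \<and> hd w \<in> g_minus}" if "z \<in> Poly_Mapping.keys (bracket x y)" for z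
    using * reducible_cases(1)[of x y] bracket_closed(1)[OF that] by (cases u) auto
qed (use assms in auto)

lemma nf_last_plus:
  assumes f: "\<And>w. w \<noteq> [] \<Longrightarrow> last w \<in> g_plus \<Longrightarrow> f w = 0" and x: "x \<in> g_plus"
  shows "nf_eval f (w @ [x]) = 0"
proof (rule nf_eq_0[of "{w. w \<noteq> [] \<and> last w \<in> g_plus}"])
  fix u x y v
  assume *: "u @ x # y # v \<in> {w. w \<noteq> [] \<and> last w \<in> g_plus}" "reducible x y"
  then show "u @ y # x # v \<in> {w. w \<noteq> [] \<and> last w \<in> g_plus}"
    using reducible_cases(2)[of x y] by (cases v) auto
  show "u @ z # v \<in> {w. w \<noteq> [] \<and> last w \<in> g_plus}" if "z \<in> Poly_Mapping.keys (bracket x y)" for z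
    using * reducible_cases(2)[of x y] bracket_closed(2)[OF that] by (cases v) auto
qed (use assms in auto)

lemma normal_append: "normal_word (u @ v) \<Longrightarrow> normal_word u \<and> normal_word v"
  unfolding normal_word_def splits_def by (metis append.assoc append_Cons)

lemma sorted_if_normal: "normal_word w \<Longrightarrow> sorted (map gen_rank w)"
proof (induction w)
  case (Cons x w)
  have "normal_word w" using normal_append[of "[x]" w] Cons.prems by simp
  moreover have "gen_rank x \<le> gen_rank y" if "w = y # v" for y v
    using Cons.prems that unfolding normal_word_def splits_def reducible_def
    by (metis append_Nil not_le)
  ultimately show ?case using Cons.IH by (cases w) auto
qed simp

lemma normal_cases:
  assumes "normal_word w"
  obtains "set w \<subseteq> g_zero" | x w' where "w = x # w'" "x \<in> g_minus" | w' x where "w = w' @ [x]" "x \<in> g_plus"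
proof -
  have s: "sorted (map gen_rank w)" using assms by (rule sorted_if_normal)
  consider x where "x \<in> set w" "x \<in> g_minus" | x where "x \<in> set w" "x \<in> g_plus" | "set w \<subseteq> g_zero"
    using gen_trichotomy by blast
  then show ?thesis
  proof cases
    case 1
    then obtain y w' where w: "w = y # w'" by (cases w) auto
    have "gen_rank y \<le> gen_rank x" using s w 1(1) by auto
    then show ?thesis using 1(2) w that(2) by (auto simp: g_minus_iff)
  next
    case 2
    then obtain y w' where w: "w = w' @ [y]" by (cases w rule: rev_cases) auto
    have "gen_rank x \<le> gen_rank y" using s w 2(1) by (auto simp: sorted_append)
    then show ?thesis using 2(2) w that(3) by (auto simp: g_plus_iff)
  next
    case 3
    then show ?thesis by (rule that(1))
  qed
qed

section \<open>The projection onto the Cartan part\<close>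

lemma g_disjoint: "x \<in> g_minus \<Longrightarrow> x \<notin> g_zero" "x \<in> g_plus \<Longrightarrow> x \<notin> g_zero"
  by (auto simp: g_minus_iff g_zero_iff g_plus_iff)

lemma uea_functional_off_zero:
  assumes hd: "\<And>w. w \<noteq> [] \<Longrightarrow> hd w \<in> g_minus \<Longrightarrow> f w = 0"
    and last: "\<And>w. w \<noteq> [] \<Longrightarrow> last w \<in> g_plus \<Longrightarrow> f w = 0"
    and "u \<in> off_zero"
  shows "uea_functional f u = 0"
  using \<open>u \<in> off_zero\<close>
proof (induction rule: off_zero.induct)
  case (minus x u)
  show ?case
  proof (induction u rule: uea_induct)
    case (word c w)
    have "ugen x * (uscal c * uword w) = uscal c * uword (x # w)"
      by (simp add: uscal_left_commute)
    then show ?case using nf_hd_minus[of f x w] hd minus by (simp only: uea_functional_word) simp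
  qed (simp add: distrib_left uea_functional_add)
next
  case (plus x u)
  show ?case
  proof (induction u rule: uea_induct)
    case (word c w)
    have "uscal c * uword w * ugen x = uscal c * uword (w @ [x])"
      by (simp add: mult.assoc)
    then show ?case using nf_last_plus[of f x w] last plus by (simp only: uea_functional_word) simp
  qed (simp add: distrib_right uea_functional_add)
qed (simp_all add: uea_functional_add)

lemma off_zero_uscal: "u \<in> off_zero \<Longrightarrow> uscal c * u \<in> off_zero"
proof (induction rule: off_zero.induct)
  case (minus x u)
  then show ?case by (simp add: uscal_left_commute[symmetric] off_zero.minus)
next
  case (plus x u)
  then show ?case by (simp add: mult.assoc[symmetric] off_zero.plus)
qed (auto simp: distrib_left intro: off_zero.intros)

lemma off_zero_diff: "u \<in> off_zero \<Longrightarrow> v \<in> off_zero \<Longrightarrow> u - v \<in> off_zero"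
  using off_zero_uscal[of v "- 1"] off_zero.add[of u "- v"] by (simp add: uscal_uminus)

lemma off_zero_sum: "(\<And>x. x \<in> A \<Longrightarrow> g x \<in> off_zero) \<Longrightarrow> sum g A \<in> off_zero"
  by (induction A rule: infinite_finite_induct) (simp_all add: off_zero.add off_zero.zero)

lemma usub_sum: "(\<And>x. x \<in> A \<Longrightarrow> g x \<in> usub G) \<Longrightarrow> sum g A \<in> usub G"
proof (induction A rule: infinite_finite_induct)
  case (insert x A)
  then show ?case by (simp add: usub.add)
qed (use usub.scal[of 0 G] in simp_all)

lemma usub_prod_list: "(\<And>x. x \<in> set us \<Longrightarrow> x \<in> usub G) \<Longrightarrow> prod_list us \<in> usub G"
proof (induction us)
  case Nil
  show ?case using usub.scal[of 1 G] by simp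
qed (simp add: usub.mult)

lemma usub_uminus: "u \<in> usub G \<Longrightarrow> - u \<in> usub G"
  using usub.mult[OF usub.scal[of "- 1" G], of u] by (simp add: uscal_uminus)

lemma usub_uword: "set w \<subseteq> G \<Longrightarrow> uword w \<in> usub G"
  by (rule usub_prod_list) (auto intro: usub.gen)

text \<open>Existence of the projection. A sorted word lies in U(g_0), or begins in g_-, or ends in
  g_+; in the last two cases its projection is 0. Other words are straightened by induction.\<close>

lemma proj0_word: "\<exists>v\<in>usub g_zero. uword w - v \<in> off_zero"
proof (induction w rule: wf_induct_rule[OF wf_word_order])
  case (1 w)
  show ?case
  proof (cases "normal_word w")
    case True
    then show ?thesis
    proof (cases rule: normal_cases)
      case 1
      then show ?thesis using off_zero.zero usub_uword by (intro bexI[of _ "uword w"]) simp_all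
    next
      case (2 x w')
      then show ?thesis
        using off_zero.minus[of x "uword w'"] usub.scal[of 0] by (intro bexI[of _ 0]) simp_all
    next
      case (3 w' x)
      then show ?thesis
        using off_zero.plus[of x "uword w'"] usub.scal[of 0] by (intro bexI[of _ 0]) simp_all
    qed
  next
    case False
    then obtain u x y v where w: "w = u @ x # y # v" and reducible: "reducible x y"
      by (auto simp: normal_word_def splits_def)
    define K where "K = Poly_Mapping.keys (bracket x y)"
    define d where "d = (if x = y then 0 else parity_sign x y)"
    define e where "e z = (if x = y then 1 / 2 else 1) * Poly_Mapping.lookup (bracket x y) z" for z
    have eq: "uword w = uscal d * uword (u @ y # x # v) + (\<Sum>z\<in>K. uscal (e z) * uword (u @ z # v))"
      unfolding w K_def d_def e_def by (rule uword_reducible[OF reducible])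
    have d: "x = y \<Longrightarrow> d = 0" by (simp add: d_def)
    have "\<exists>v'\<in>usub g_zero. uword (u @ z # v) - v' \<in> off_zero" for z
      using 1[of "u @ z # v"] word_order_reduct(2)[OF reducible] w by simp
    then obtain p where p: "\<And>z. p z \<in> usub g_zero" "\<And>z. uword (u @ z # v) - p z \<in> off_zero"
      by metis
    \<comment> \<open>For x = y the swapped word is not smaller, but its coefficient
      \<open>d\<close> is 0 and the witness 0 serves.\<close>
    obtain q where q: "q \<in> usub g_zero" "uscal d * uword (u @ y # x # v) - uscal d * q \<in> off_zero"
    proof (cases "x = y")
      case True
      then show ?thesis using that[of 0] usub.scal[of 0] d off_zero.zero by simp
    next
      case False
      then obtain q where "q \<in> usub g_zero" "uword (u @ y # x # v) - q \<in> off_zero"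
        using 1[of "u @ y # x # v"] word_order_reduct(1)[OF reducible False] w by auto
      then show ?thesis
        using that[of q] off_zero_uscal[of _ d] by (metis right_diff_distrib)
    qed
    have "uscal d * q + (\<Sum>z\<in>K. uscal (e z) * p z) \<in> usub g_zero"
      using p q by (intro usub.add usub_sum usub.mult usub.scal)
    moreover have "(\<Sum>z\<in>K. uscal (e z) * uword (u @ z # v) - uscal (e z) * p z) \<in> off_zero"
      using off_zero_uscal[OF p(2)] by (intro off_zero_sum) (metis right_diff_distrib)
    from off_zero.add[OF q(2) this]
    have "uword w - (uscal d * q + (\<Sum>z\<in>K. uscal (e z) * p z)) \<in> off_zero"
      unfolding eq by (simp add: sum_subtractf algebra_simps)
    ultimately show ?thesis by blast
  qed
qed

lemma proj0_exists: "\<exists>v\<in>usub g_zero. u - v \<in> off_zero"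
proof (induction u rule: uea_induct)
  case (word c w)
  obtain v where "v \<in> usub g_zero" "uword w - v \<in> off_zero"
    using proj0_word by blast
  then show ?case
    using off_zero_uscal[of "uword w - v" c] usub.mult[OF usub.scal[of c]]
    by (intro bexI[of _ "uscal c * v"]) (simp_all add: right_diff_distrib)
next
  case (add u v)
  then obtain u' v' where "u' \<in> usub g_zero" "u - u' \<in> off_zero" "v' \<in> usub g_zero" "v - v' \<in> off_zero"
    by blast
  then show ?case
    using off_zero.add[of "u - u'" "v - v'"]
    by (intro bexI[of _ "u' + v'"]) (simp_all add: usub.add algebra_simps)
qed

text \<open>U(g_0) written through sorted words, whose coefficients can be read off by
  functionals.\<close>

definition zero_span :: "uea set" where
  "zero_span = {abs_uea p | p. \<forall>k\<in>Poly_Mapping.keys p. normal_word (letters k) \<and> set (letters k) \<subseteq> g_zero}"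

lemma abs_uea_sum:
  "abs_uea p = (\<Sum>k\<in>Poly_Mapping.keys p. uscal (Poly_Mapping.lookup p k) * uword (letters k))"
proof -
  have p: "p = (\<Sum>z\<in>Poly_Mapping.keys p. Poly_Mapping.single z (Poly_Mapping.lookup p z))"
    by (rule poly_mapping_eqI) (auto simp: lookup_sum lookup_single when_def in_keys_iff)
  have "abs_uea (sum g A) = (\<Sum>z\<in>A. abs_uea (g z))" for g :: "wrd \<Rightarrow> _" and A
    by (induction A rule: infinite_finite_induct)
      (simp_all flip: plus_uea.abs_eq zero_uea.abs_eq)
  from this[of "\<lambda>z. Poly_Mapping.single z (Poly_Mapping.lookup p z)" "Poly_Mapping.keys p"]
  have "abs_uea p = (\<Sum>z\<in>Poly_Mapping.keys p.
      abs_uea (Poly_Mapping.single (Wrd (letters z)) (Poly_Mapping.lookup p z)))"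
    unfolding p[symmetric] by simp
  then show ?thesis by (simp only: abs_uea_single)
qed

lemma zero_span_0: "0 \<in> zero_span"
  by (auto simp: zero_span_def zero_uea_def intro!: exI[of _ 0])

lemma zero_span_add:
  assumes "u \<in> zero_span" "v \<in> zero_span"
  shows "u + v \<in> zero_span"
proof -
  obtain p q where "u = abs_uea p" "v = abs_uea q"
    and "\<forall>k\<in>Poly_Mapping.keys p. normal_word (letters k) \<and> set (letters k) \<subseteq> g_zero"
    and "\<forall>k\<in>Poly_Mapping.keys q. normal_word (letters k) \<and> set (letters k) \<subseteq> g_zero"
    using assms by (auto simp: zero_span_def)
  then show ?thesis
    unfolding zero_span_def using keys_add[of p q]
    by (intro CollectI exI[of _ "p + q"]) (auto simp: plus_uea.abs_eq)
qed

lemma zero_span_sum: "(\<And>x. x \<in> A \<Longrightarrow> g x \<in> zero_span) \<Longrightarrow> sum g A \<in> zero_span"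
  by (induction A rule: infinite_finite_induct) (simp_all add: zero_span_add zero_span_0)

lemma zero_span_uscal:
  assumes "u \<in> zero_span"
  shows "uscal c * u \<in> zero_span"
proof -
  obtain p where p: "u = abs_uea p" "\<forall>k\<in>Poly_Mapping.keys p. normal_word (letters k) \<and> set (letters k) \<subseteq> g_zero"
    using assms by (auto simp: zero_span_def)
  have "Poly_Mapping.keys (tscal c * p) \<subseteq> Poly_Mapping.keys p"
    using keys_mult[of "tscal c" p] by (auto simp: tscal_def split: if_splits)
  with p show ?thesis
    unfolding zero_span_def
    by (intro CollectI exI[of _ "tscal c * p"]) (auto simp: uscal.abs_eq times_uea.abs_eq)
qed

text \<open>Brackets within g_0 vanish, so straightening merely permutes the letters.\<close>

lemma zero_span_word: "set w \<subseteq> g_zero \<Longrightarrow> uword w \<in> zero_span"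
proof (induction w rule: wf_induct_rule[OF wf_word_order])
  case (1 w)
  show ?case
  proof (cases "normal_word w")
    case True
    have "uword w = abs_uea (Poly_Mapping.single (Wrd w) 1)"
      by (simp add: abs_uea_single)
    then show ?thesis
      using True 1(2) unfolding zero_span_def by (intro CollectI exI) auto
  next
    case False
    then obtain u x y v where w: "w = u @ x # y # v" and reducible: "reducible x y"
      by (auto simp: normal_word_def splits_def)
    have xy: "x \<in> g_zero" "y \<in> g_zero" using w 1(2) by auto
    then have "x \<noteq> y" "parity_sign x y = 1"
      using reducible by (auto simp: reducible_def g_zero_def parity_sign_def)
    then have "uword w = uword (u @ y # x # v)"
      using uword_reducible[OF reducible, of u v] bracket_g_zero[OF xy] w by simp
    then show ?thesis
      using 1(1)[of "u @ y # x # v"] word_order_reduct(1)[OF reducible \<open>x \<noteq> y\<close>] 1(2) w by simp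
  qed
qed

lemma zero_span_mult:
  assumes "u \<in> zero_span" "v \<in> zero_span"
  shows "u * v \<in> zero_span"
proof -
  from assms(1) obtain p where p: "u = abs_uea p" "\<And>k. k \<in> Poly_Mapping.keys p \<Longrightarrow> set (letters k) \<subseteq> g_zero"
    unfolding zero_span_def by blast
  from assms(2) obtain q where q: "v = abs_uea q" "\<And>k. k \<in> Poly_Mapping.keys q \<Longrightarrow> set (letters k) \<subseteq> g_zero"
    unfolding zero_span_def by blast
  have uv: "uscal c * uword w * (uscal d * uword w') \<in> zero_span"
    if "set w \<subseteq> g_zero" "set w' \<subseteq> g_zero" for c d w w'
  proof -
    have "uscal c * uword w * (uscal d * uword w') = uscal c * (uscal d * uword (w @ w'))"
      by (simp add: mult.assoc uscal_left_commute[of "uword w"])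
    then show ?thesis using that zero_span_word[of "w @ w'"] by (simp add: zero_span_uscal)
  qed
  show ?thesis
    unfolding p(1) q(1) abs_uea_sum sum_product by (intro zero_span_sum uv p(2) q(2))
qed

lemma usub_g_zero_span: "u \<in> usub g_zero \<Longrightarrow> u \<in> zero_span"
proof (induction rule: usub.induct)
  case (scal c)
  show ?case using zero_span_uscal[OF zero_span_word[of "[]"], of c] by simp
next
  case (gen x)
  then show ?case using zero_span_word[of "[x]"] by simp
qed (simp_all add: zero_span_add zero_span_mult)

text \<open>Here linear independence of sorted words enters: the functional dual to one sorted word
  over g_0 kills g_- U(g) + U(g) g_+ and reads off the coefficient of that word, which is therefore
  0.\<close>

lemma zero_span_off_zero:
  assumes "u \<in> zero_span" "u \<in> off_zero"
  shows "u = 0"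
proof -
  obtain p where p: "u = abs_uea p" "\<And>k. k \<in> Poly_Mapping.keys p \<Longrightarrow> normal_word (letters k) \<and> set (letters k) \<subseteq> g_zero"
    using assms by (auto simp: zero_span_def)
  have "Poly_Mapping.keys p = {}"
  proof (rule ccontr)
    assume "Poly_Mapping.keys p \<noteq> {}"
    then obtain k0 where k0: "k0 \<in> Poly_Mapping.keys p" by blast
    define f :: "gen list \<Rightarrow> complex" where "f = (\<lambda>w. if w = letters k0 then 1 else 0)"
    have "set (letters k0) \<subseteq> g_zero" using p(2)[OF k0] by simp
    then have "uea_functional f u = 0"
      using g_disjoint by (intro uea_functional_off_zero \<open>u \<in> off_zero\<close>) (force simp: f_def)+
    moreover have "uea_functional f u = (\<Sum>k\<in>Poly_Mapping.keys p. Poly_Mapping.lookup p k * f (letters k))"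
      using p by (simp add: abs_uea_sum uea_functional_sum uea_functional_word nf_normal)
    moreover have "\<dots> = (\<Sum>k\<in>{k0}. Poly_Mapping.lookup p k * f (letters k))"
      using k0 wrd.expand by (intro sum.mono_neutral_right) (auto simp: f_def)
    ultimately have "Poly_Mapping.lookup p k0 = 0" by (simp add: f_def)
    with k0 show False by (simp add: in_keys_iff)
  qed
  with p show ?thesis by (simp add: abs_uea_sum)
qed

lemma proj0: "proj0 u \<in> usub g_zero" "u - proj0 u \<in> off_zero"
proof -
  have "\<exists>!v. v \<in> usub g_zero \<and> u - v \<in> off_zero"
  proof (rule ex_ex1I)
    show "\<exists>v. v \<in> usub g_zero \<and> u - v \<in> off_zero" using proj0_exists by blast
  next
    fix v v' assume v: "v \<in> usub g_zero \<and> u - v \<in> off_zero" "v' \<in> usub g_zero \<and> u - v' \<in> off_zero"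
    then have "v + - v' \<in> zero_span" by (intro usub_g_zero_span usub.add usub_uminus) simp_all
    moreover have "(u - v') - (u - v) \<in> off_zero" using v off_zero_diff by blast
    ultimately have "v - v' = 0" by (intro zero_span_off_zero) simp_all
    then show "v = v'" by simp
  qed
  from theI'[OF this] show "proj0 u \<in> usub g_zero" "u - proj0 u \<in> off_zero"
    unfolding proj0_def by simp_all
qed

lemma usub_g_zero_commute: "u \<in> usub g_zero \<Longrightarrow> v \<in> usub g_zero \<Longrightarrow> u * v = v * u"
proof (induction arbitrary: v rule: usub.induct)
  case (gen x)
  from gen(2) show ?case
  proof (induction rule: usub.induct)
    case (gen y)
    then show ?case
      using ugen_commute[of x y] bracket_g_zero[of x y] \<open>x \<in> g_zero\<close>
      by (auto simp: parity_sign_def g_zero_def)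
  next
    case (mult u v)
    then show ?case by (metis mult.assoc)
  qed (simp_all add: uscal_commute distrib_left distrib_right)
next
  case (mult a b)
  then show ?case by (metis mult.assoc)
qed (simp_all add: uscal_commute distrib_left distrib_right)

section \<open>The anti-involution and the projection\<close>

lemma ubar_add: "ubar (u + v) = ubar u + ubar v"
  by transfer (simp add: tbar_add super_cong_refl)

lemma ubar_mult: "ubar (u * v) = ubar v * ubar u"
  by transfer (simp add: tbar_mult super_cong_refl)

lemma ubar_uscal [simp]: "ubar (uscal c) = uscal c"
  by transfer (simp add: tscal_def tbar_single wbar_def zero_wrd_def super_cong_refl)

lemma ubar_ugen [simp]: "ubar (ugen x) = ugen (gbar x)"
  by transfer (simp add: tgen_def tbar_single wbar_def super_cong_refl)

lemma ubar_ubar [simp]: "ubar (ubar u) = u"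
proof transfer
  fix p
  have "tbar (tbar p) = p"
    by (induction p rule: poly_mapping_additive_induct) (simp_all add: tbar_single tbar_add)
  then show "super_cong (tbar (tbar p)) p" by (simp add: super_cong_refl)
qed

lemma ubar_prod_list: "ubar (prod_list us) = prod_list (rev (map ubar us))"
proof (induction us)
  case Nil
  show ?case using ubar_uscal[of 1] by simp
qed (simp add: ubar_mult)

lemma ubar_off_zero: "u \<in> off_zero \<Longrightarrow> ubar u \<in> off_zero"
proof (induction rule: off_zero.induct)
  case zero
  show ?case using ubar_uscal[of 0] off_zero.zero by simp
next
  case (minus x u)
  then have "gbar x \<in> g_plus" by (auto simp: g_minus_def g_plus_def)
  then show ?case by (simp add: ubar_mult off_zero.plus)
next
  case (plus x u)
  then have "gbar x \<in> g_minus" by (auto simp: g_minus_def g_plus_def)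
  then show ?case by (simp add: ubar_mult off_zero.minus)
qed (simp add: ubar_add off_zero.add)

text \<open>The generators of g_0 are fixed, and the reversal of products does no harm in a
  commutative algebra. With \<open>ubar_off_zero\<close>, which exchanges the two summands, the
  anti-involution preserves the projection; this is the source of the symmetry of the form.\<close>

lemma ubar_usub_g_zero: "u \<in> usub g_zero \<Longrightarrow> ubar u = u"
proof (induction rule: usub.induct)
  case (gen x)
  then show ?case by (auto simp: g_zero_def)
next
  case (mult u v)
  then show ?case using usub_g_zero_commute by (simp add: ubar_mult)
qed (simp_all add: ubar_add)

section \<open>The contravariant form as a highest weight functional\<close>

context
  fixes h1 h2 c1 c2 :: complex
begin

fun highest_weight :: "gen \<Rightarrow> complex" where
  "highest_weight (gL n) = (if n = 0 then h1 else 0)"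
| "highest_weight (gM n) = (if n = 0 then h2 else 0)"
| "highest_weight (gQ m) = 0"
| "highest_weight gC1 = c1"
| "highest_weight gC2 = c2"

primrec highest_weight_word :: "gen list \<Rightarrow> complex" where
  "highest_weight_word [] = 1"
| "highest_weight_word (x # w) = highest_weight x * highest_weight_word w"

lemma highest_weight_word_append [simp]: "highest_weight_word (u @ v) = highest_weight_word u * highest_weight_word v"
  by (induction u) auto

text \<open>The component of u 1 along the vacuum, equivalently the pairing of the vacuum with u
  1.\<close>

definition vac_coeff :: "uea \<Rightarrow> complex" where
  "vac_coeff = uea_functional highest_weight_word"

lemma highest_weight_g_minus: "x \<in> g_minus \<Longrightarrow> highest_weight x = 0"
  by (auto simp: g_minus_def)

lemma highest_weight_g_plus: "x \<in> g_plus \<Longrightarrow> highest_weight x = 0"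
  by (auto simp: g_plus_def)

lemma highest_weight_word_hd: "w \<noteq> [] \<Longrightarrow> hd w \<in> g_minus \<Longrightarrow> highest_weight_word w = 0"
  by (cases w) (auto simp: highest_weight_g_minus)

lemma highest_weight_word_last: "w \<noteq> [] \<Longrightarrow> last w \<in> g_plus \<Longrightarrow> highest_weight_word w = 0"
  by (cases w rule: rev_cases) (auto simp: highest_weight_g_plus)

lemma nf_highest_weight_word_g_zero: "set w \<subseteq> g_zero \<Longrightarrow> nf_eval highest_weight_word w = highest_weight_word w"
proof (induction w rule: wf_induct_rule[OF wf_word_order])
  case (1 w)
  show ?case
  proof (cases "normal_word w")
    case False
    then obtain u x y v where w: "w = u @ x # y # v" and reducible: "reducible x y"
        and nf_eval: "nf_eval highest_weight_word w = reduct x y (\<lambda>l. nf_eval highest_weight_word (u @ l @ v))"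
      by (rule nf_step)
    have xy: "x \<in> g_zero" "y \<in> g_zero" using w 1(2) by auto
    then have "x \<noteq> y" "parity_sign x y = 1"
      using reducible by (auto simp: reducible_def g_zero_def parity_sign_def)
    then have "nf_eval highest_weight_word w = nf_eval highest_weight_word (u @ y # x # v)"
      using nf_eval bracket_g_zero[OF xy] by (simp add: reduct_def)
    also have "\<dots> = highest_weight_word (u @ y # x # v)"
      using 1(1)[of "u @ y # x # v"] word_order_reduct(1)[OF reducible \<open>x \<noteq> y\<close>] 1(2) w by simp
    finally show ?thesis using w by simp
  qed (simp add: nf_normal)
qed

text \<open>Right multiplication by x in g_0 scales the functional, since x can be moved left past
  the letters of g_+ at the cost of brackets that stay in g_+.\<close>

lemma nf_highest_weight_word_snoc: "x \<in> g_zero \<Longrightarrow> nf_eval highest_weight_word (w @ [x]) = nf_eval highest_weight_word w * highest_weight x"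
proof (induction w rule: wf_induct_rule[OF wf_word_order])
  case (1 w)
  show ?case
  proof (cases "normal_word w")
    case True
    then show ?thesis
    proof (cases rule: normal_cases)
      case 1
      then show ?thesis
        using \<open>x \<in> g_zero\<close> nf_highest_weight_word_g_zero[of w] nf_highest_weight_word_g_zero[of "w @ [x]"]
        by simp
    next
      case (2 y w')
      then show ?thesis
        using nf_hd_minus[of highest_weight_word y w'] nf_hd_minus[of highest_weight_word y "w' @ [x]"] highest_weight_word_hd by simp
    next
      case (3 w' y)
      have "nf_eval highest_weight_word (w' @ [z]) = 0" if "z \<in> g_plus" for z w'
        using that by (intro nf_last_plus highest_weight_word_last)
      then have *: "nf_eval highest_weight_word (w' @ [z]) = 0" "nf_eval highest_weight_word (w' @ [x, y]) = 0" if "z \<in> g_plus" for z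
        using that 3(2) by (metis append.assoc append_Cons append_Nil)+
      have "lin_ext (\<lambda>z. nf_eval highest_weight_word (w' @ [z])) (bracket y x) = 0"
        using bracket_closed(3)[of _ y x] 3(2) \<open>x \<in> g_zero\<close> * by (intro lin_ext_eq_0) blast
      then show ?thesis
        using nf_commute[of highest_weight_word w' y x "[]"] * 3 by simp
    qed
  next
    case False
    then obtain u a b v where w: "w = u @ a # b # v" and reducible: "reducible a b"
        and nf_eval: "nf_eval highest_weight_word w = reduct a b (\<lambda>l. nf_eval highest_weight_word (u @ l @ v))"
      by (rule nf_step)
    \<comment> \<open>By \<open>diamond\<close>, the longer word may be rewritten at the place
      chosen for \<open>w\<close>.\<close>
    have "nf_eval highest_weight_word (w @ [x]) = reduct a b (\<lambda>l. nf_eval highest_weight_word (u @ l @ v @ [x]))"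
      using diamond[OF reducible, of highest_weight_word u "v @ [x]"] w by simp
    also have "\<dots> = reduct a b (\<lambda>l. nf_eval highest_weight_word (u @ l @ v) * highest_weight x)"
    proof (rule reduct_cong)
      assume "a \<noteq> b"
      then show "nf_eval highest_weight_word (u @ [b, a] @ v @ [x]) = nf_eval highest_weight_word (u @ [b, a] @ v) * highest_weight x"
        using 1(1)[of "u @ b # a # v"] word_order_reduct(1)[OF reducible] 1(2) w by simp
    next
      fix z
      show "nf_eval highest_weight_word (u @ [z] @ v @ [x]) = nf_eval highest_weight_word (u @ [z] @ v) * highest_weight x"
        using 1(1)[of "u @ z # v"] word_order_reduct(2)[OF reducible] 1(2) w by simp
    qed
    finally show ?thesis using nf_eval by (simp add: reduct_mult_right)
  qed
qed

lemma vac_coeff_add: "vac_coeff (u + v) = vac_coeff u + vac_coeff v"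
  and vac_coeff_diff: "vac_coeff (u - v) = vac_coeff u - vac_coeff v"
  and vac_coeff_0 [simp]: "vac_coeff 0 = 0"
  and vac_coeff_uscal_mult: "vac_coeff (uscal c * u) = c * vac_coeff u"
  by (simp_all add: vac_coeff_def uea_functional_add uea_functional_diff uea_functional_uscal_mult)

lemma vac_coeff_1 [simp]: "vac_coeff 1 = 1"
  using uea_functional_word[of highest_weight_word 1 "[]"] nf_highest_weight_word_g_zero[of "[]"] by (simp add: vac_coeff_def)

lemma vac_coeff_uscal [simp]: "vac_coeff (uscal c) = c"
  using vac_coeff_uscal_mult[of c 1] by simp

lemma vac_coeff_off_zero: "u \<in> off_zero \<Longrightarrow> vac_coeff u = 0"
  unfolding vac_coeff_def by (rule uea_functional_off_zero) (auto intro: highest_weight_word_hd highest_weight_word_last)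

lemma vac_coeff_g_plus: "x \<in> g_plus \<Longrightarrow> vac_coeff (u * ugen x) = 0"
  by (simp add: vac_coeff_off_zero off_zero.plus)

lemma vac_coeff_g_zero:
  assumes "x \<in> g_zero"
  shows "vac_coeff (u * ugen x) = vac_coeff u * highest_weight x"
proof (induction u rule: uea_induct)
  case (word c w)
  have "uscal c * uword w * ugen x = uscal c * uword (w @ [x])"
    by (simp add: mult.assoc)
  then show ?case
    using nf_highest_weight_word_snoc[OF assms, of w] by (simp only: vac_coeff_def uea_functional_word) simp
qed (simp add: vac_coeff_add distrib_right)

lemma vac_coeff_acts: "acts h1 h2 c1 c2 x a \<Longrightarrow> vac_coeff (u * x) = vac_coeff u * a"
proof (induction arbitrary: u rule: acts.induct)
  case (scal c)
  show ?case using vac_coeff_uscal_mult[of c u] by (simp add: uscal_commute)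
next
  case (mult x a y b)
  then show ?case by (simp add: mult.assoc[symmetric])
qed (simp_all add: vac_coeff_g_zero g_zero_def vac_coeff_g_plus distrib_left vac_coeff_add)

lemma acts_usub_g_zero: "v \<in> usub g_zero \<Longrightarrow> acts h1 h2 c1 c2 v (vac_coeff v)"
proof (induction rule: usub.induct)
  case (scal c)
  then show ?case by (simp add: acts.scal)
next
  case (gen x)
  have "vac_coeff (ugen x) = highest_weight x" using vac_coeff_g_zero[OF gen, of 1] by simp
  with gen show ?case by (auto simp: g_zero_def intro: acts.intros)
next
  case (mult u v)
  then have "vac_coeff (u * v) = vac_coeff u * vac_coeff v" by (simp add: vac_coeff_acts)
  with mult show ?case by (simp add: acts.mult)
qed (simp add: acts.add vac_coeff_add)

section \<open>Functionals on the Verma module and well-definedness of the form\<close>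

lemma verma_rels_add:
  assumes "p \<in> verma_rels h1 h2 c1 c2" "q \<in> verma_rels h1 h2 c1 c2"
  shows "p + q \<in> verma_rels h1 h2 c1 c2"
  using verma_rels.diff[OF assms(1) verma_rels.diff[OF verma_rels.zero assms(2)]] by simp

lemma on_vac_eq_iff:
  "on_vac h1 h2 c1 c2 u = on_vac h1 h2 c1 c2 v \<longleftrightarrow> pure u 1 - pure v 1 \<in> verma_rels h1 h2 c1 c2"
  (is "?L \<longleftrightarrow> ?R")
proof
  assume ?L
  moreover have "pure u 1 \<in> on_vac h1 h2 c1 c2 u"
    by (simp add: on_vac_def tensor_def verma_rels.zero)
  ultimately show ?R by (simp add: on_vac_def tensor_def)
next
  assume R: ?R
  show ?L
    unfolding on_vac_def tensor_def
  proof (intro Collect_cong iffI)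
    fix p assume "p - pure u 1 \<in> verma_rels h1 h2 c1 c2"
    from verma_rels_add[OF this R] show "p - pure v 1 \<in> verma_rels h1 h2 c1 c2" by simp
  next
    fix p assume "p - pure v 1 \<in> verma_rels h1 h2 c1 c2"
    from verma_rels.diff[OF this R] show "p - pure u 1 \<in> verma_rels h1 h2 c1 c2" by simp
  qed
qed

definition tensor_fun :: "(uea \<Rightarrow> complex) \<Rightarrow> pre_verma \<Rightarrow> complex" where
  "tensor_fun \<psi> p = (\<Sum>k\<in>Poly_Mapping.keys p. of_int (Poly_Mapping.lookup p k) * (\<psi> (fst k) * snd k))"

lemma tensor_fun_add: "tensor_fun \<psi> (p + q) = tensor_fun \<psi> p + tensor_fun \<psi> q"
  unfolding tensor_fun_def by (rule setsum_keys_plus_distrib) (simp_all add: distrib_right)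

lemma tensor_fun_diff: "tensor_fun \<psi> (p - q) = tensor_fun \<psi> p - tensor_fun \<psi> q"
  using tensor_fun_add[of \<psi> "p - q" q] by simp

lemma tensor_fun_pure: "tensor_fun \<psi> (pure u z) = \<psi> u * z"
  by (simp add: tensor_fun_def)

text \<open>The universal property of the tensor product: an additive map on which U(g_0 + g_+) acts
  from the right through its character is balanced, so it descends.\<close>

lemma tensor_fun_verma_rels:
  assumes "\<And>u v. \<psi> (u + v) = \<psi> u + \<psi> v"
    and "\<And>u x a. acts h1 h2 c1 c2 x a \<Longrightarrow> \<psi> (u * x) = \<psi> u * a"
    and "p \<in> verma_rels h1 h2 c1 c2"
  shows "tensor_fun \<psi> p = 0"
  using assms(3)
  by (induction rule: verma_rels.induct)
    (simp_all add: tensor_fun_diff tensor_fun_pure tensor_fun_add assms(1,2) algebra_simps,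
      simp add: tensor_fun_def)

lemma vac_coeff_on_vac_cong:
  assumes "on_vac h1 h2 c1 c2 u = on_vac h1 h2 c1 c2 v"
  shows "vac_coeff (a * u) = vac_coeff (a * v)"
proof -
  have "tensor_fun (\<lambda>u. vac_coeff (a * u)) (pure u 1 - pure v 1) = 0"
    using assms
    by (intro tensor_fun_verma_rels)
      (simp_all add: on_vac_eq_iff distrib_left vac_coeff_add vac_coeff_acts mult.assoc[symmetric])
  then show ?thesis by (simp add: tensor_fun_diff tensor_fun_pure)
qed

lemma on_vac_acts:
  assumes "acts h1 h2 c1 c2 v a"
  shows "on_vac h1 h2 c1 c2 v = on_vac h1 h2 c1 c2 (uscal a)"
proof -
  have "(pure (1 * v) 1 - pure 1 (a * 1)) - (pure (1 * uscal a) 1 - pure 1 (a * 1)) \<in> verma_rels h1 h2 c1 c2"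
    using assms by (intro verma_rels.diff verma_rels.balanced acts.scal)
  then show ?thesis by (simp add: on_vac_eq_iff)
qed

lemma vac_coeff_proj0: "vac_coeff (proj0 u) = vac_coeff u"
  using vac_coeff_off_zero[OF proj0(2)[of u]] by (simp add: vac_coeff_diff)

text \<open>The functional sees only the projection, and the anti-involution preserves the
  projection.\<close>

lemma vac_coeff_ubar: "vac_coeff (ubar u) = vac_coeff u"
proof -
  have "vac_coeff (ubar (u - proj0 u)) = 0"
    by (intro vac_coeff_off_zero ubar_off_zero proj0)
  moreover have "ubar u = ubar (u - proj0 u) + ubar (proj0 u)"
    by (simp flip: ubar_add)
  ultimately show ?thesis
    using ubar_usub_g_zero[OF proj0(1)[of u]] vac_coeff_proj0 by (simp add: vac_coeff_add)
qed

text \<open>The value does not depend on the representatives: for the second argument because the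
  functional descends to the Verma module, for the first because symmetry exchanges the
  arguments.\<close>

lemma cform_on_vac:
  assumes "a \<in> usub g_minus" "b \<in> usub g_minus"
  shows "cform h1 h2 c1 c2 (on_vac h1 h2 c1 c2 a) (on_vac h1 h2 c1 c2 b) = vac_coeff (ubar a * b)"
  unfolding cform_def
proof (rule the_equality)
  have "on_vac h1 h2 c1 c2 (proj0 u) = on_vac h1 h2 c1 c2 (uscal (vac_coeff u))" for u
    using on_vac_acts[OF acts_usub_g_zero[OF proj0(1)[of u]]] by (simp add: vac_coeff_proj0)
  with assms show "\<exists>a'\<in>usub g_minus. \<exists>b'\<in>usub g_minus. on_vac h1 h2 c1 c2 a = on_vac h1 h2 c1 c2 a' \<and>
      on_vac h1 h2 c1 c2 b = on_vac h1 h2 c1 c2 b' \<and>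
      on_vac h1 h2 c1 c2 (proj0 (ubar a' * b')) = on_vac h1 h2 c1 c2 (uscal (vac_coeff (ubar a * b)))"
    by blast
next
  fix c
  assume "\<exists>a'\<in>usub g_minus. \<exists>b'\<in>usub g_minus. on_vac h1 h2 c1 c2 a = on_vac h1 h2 c1 c2 a' \<and>
      on_vac h1 h2 c1 c2 b = on_vac h1 h2 c1 c2 b' \<and>
      on_vac h1 h2 c1 c2 (proj0 (ubar a' * b')) = on_vac h1 h2 c1 c2 (uscal c)"
  then obtain a' b' where a': "on_vac h1 h2 c1 c2 a = on_vac h1 h2 c1 c2 a'"
    and b': "on_vac h1 h2 c1 c2 b = on_vac h1 h2 c1 c2 b'"
    and c: "on_vac h1 h2 c1 c2 (proj0 (ubar a' * b')) = on_vac h1 h2 c1 c2 (uscal c)"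
    by blast
  have "c = vac_coeff (ubar a' * b')"
    using vac_coeff_on_vac_cong[OF c, of 1] by (simp add: vac_coeff_proj0)
  also have "\<dots> = vac_coeff (ubar a' * b)"
    using vac_coeff_on_vac_cong[OF b'] by simp
  also have "\<dots> = vac_coeff (ubar b * a')"
    using vac_coeff_ubar[of "ubar b * a'"] by (simp add: ubar_mult)
  also have "\<dots> = vac_coeff (ubar b * a)"
    using vac_coeff_on_vac_cong[OF a'] by simp
  also have "\<dots> = vac_coeff (ubar a * b)"
    using vac_coeff_ubar[of "ubar a * b"] by (simp add: ubar_mult)
  finally show "c = vac_coeff (ubar a * b)" .
qed

end

section \<open>Pairings of monomials\<close>

lemma uea_commute_even: "bracket x y = 0 \<Longrightarrow> \<not> odd_gen x \<or> \<not> odd_gen y \<Longrightarrow> ugen x * ugen y = ugen y * ugen x"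
  using ugen_commute[of x y] by (auto simp: parity_sign_def)

lemma gM_gM_commute: "ugen (gM m) * ugen (gM n) = ugen (gM n) * ugen (gM m)"
  by (rule uea_commute_even) simp_all

lemma gM_gQ_commute: "ugen (gM m) * ugen (gQ n) = ugen (gQ n) * ugen (gM m)"
  by (rule uea_commute_even) simp_all

lemma gC2_commute: "ugen gC2 * u = u * ugen gC2"
proof (induction u rule: uea_induct)
  case (word c w)
  have "ugen gC2 * uword w = uword w * ugen gC2"
  proof (induction w)
    case (Cons x w)
    have "ugen gC2 * ugen x = ugen x * ugen gC2"
      by (rule uea_commute_even) (cases x; simp)+
    with Cons show ?case by (metis list.simps(9) mult.assoc prod_list.Cons)
  qed simp
  then show ?case by (metis mult.assoc uscal_commute)
qed (simp add: distrib_left distrib_right)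

lemma commute_prod_list:
  fixes a :: "'a :: monoid_mult"
  shows "(\<And>x. x \<in> set xs \<Longrightarrow> a * x = x * a) \<Longrightarrow> a * prod_list xs = prod_list xs * a"
proof (induction xs)
  case (Cons x xs)
  then have "a * x = x * a" "a * prod_list xs = prod_list xs * a" by simp_all
  then show ?case by (metis mult.assoc prod_list.Cons)
qed simp

lemma sum_list_remove1: "m \<in> set ms \<Longrightarrow> sum_list ms = m + sum_list (remove1 m ms)" for m :: nat
  by (induction ms) auto

section \<open>Products of modes and their commutators\<close>

definition Mpos :: "nat list \<Rightarrow> uea" where
  "Mpos ms = prod_list (map (\<lambda>m. ugen (gM (int m))) ms)"

definition Mneg :: "nat list \<Rightarrow> uea" where
  "Mneg ms = prod_list (map (\<lambda>m. ugen (gM (- int m))) ms)"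

definition Lneg :: "nat list \<Rightarrow> uea" where
  "Lneg ns = prod_list (map (\<lambda>n. ugen (gL (- int n))) ns)"

text \<open>\<open>gQ (m - 1)\<close> is \<open>Q\<^bsub>m-1/2\<^esub>\<close>, the image of \<open>gQ (- m)\<close> under the anti-involution.\<close>

definition Qpos :: "nat list \<Rightarrow> uea" where
  "Qpos ms = prod_list (map (\<lambda>m. ugen (gQ (int m - 1))) ms)"

definition Qneg :: "nat list \<Rightarrow> uea" where
  "Qneg ns = prod_list (map (\<lambda>n. ugen (gQ (- int n))) ns)"

lemma gM_Mpos_commute: "ugen (gM n) * Mpos ms = Mpos ms * ugen (gM n)"
  unfolding Mpos_def by (rule commute_prod_list) (auto simp: gM_gM_commute)

lemma gM_Mneg_commute: "ugen (gM n) * Mneg ms = Mneg ms * ugen (gM n)"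
  unfolding Mneg_def by (rule commute_prod_list) (auto simp: gM_gM_commute)

lemma gM_Qpos_commute: "ugen (gM n) * Qpos ms = Qpos ms * ugen (gM n)"
  unfolding Qpos_def by (rule commute_prod_list) (auto simp: gM_gQ_commute)

lemma gM_Qneg_commute: "ugen (gM n) * Qneg ms = Qneg ms * ugen (gM n)"
  unfolding Qneg_def by (rule commute_prod_list) (auto simp: gM_gQ_commute)

lemma Mpos_commute:
  "Mpos ms * Mneg ns = Mneg ns * Mpos ms"
  "Mpos ms * Qpos ns = Qpos ns * Mpos ms"
  "Mpos ms * Qneg ns = Qneg ns * Mpos ms"
  by (induction ms)
    (simp_all add: Mpos_def mult.assoc,
      simp_all add: gM_Mneg_commute gM_Qpos_commute gM_Qneg_commute flip: mult.assoc)

lemma Mneg_commute: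
  "Mneg ms * Qpos ns = Qpos ns * Mneg ms"
  "Mneg ms * Qneg ns = Qneg ns * Mneg ms"
  by (induction ms)
    (simp_all add: Mneg_def mult.assoc,
      simp_all add: gM_Qpos_commute gM_Qneg_commute flip: mult.assoc)

text \<open>The bracket [M_m, L_{-n}] as an element of U(g). The central term is written in n
  because it occurs only for m = n.\<close>

definition bracket_ML :: "nat \<Rightarrow> nat \<Rightarrow> uea" where
  "bracket_ML m n = uscal (of_nat m + of_nat n) * ugen (gM (int m - int n))
     + uscal (if m = n then (of_nat n ^ 3 - of_nat n) / 12 else 0) * ugen gC2"

lemma gM_gL_commute:
  "ugen (gM (int m)) * ugen (gL (- int n)) = ugen (gL (- int n)) * ugen (gM (int m)) + bracket_ML m n"
proof -
  have "bracket (gM (int m)) (gL (- int n)) = bas (gM (int m - int n)) (of_nat m + of_nat n)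
      + bas gC2 (if m = n then (of_nat n ^ 3 - of_nat n) / 12 else 0)"
    by (cases "m = n") (simp_all add: algebra_simps minus_divide_left flip: single_uminus)
  then have "ulin (bracket (gM (int m)) (gL (- int n))) = bracket_ML m n"
    by (simp add: ulin_add bracket_ML_def)
  then show ?thesis
    using ugen_commute[of "gM (int m)" "gL (- int n)"] by (simp add: parity_sign_def)
qed

definition bracket_QQ :: "nat \<Rightarrow> nat \<Rightarrow> uea" where
  "bracket_QQ m n = uscal 2 * ugen (gM (int m - int n))
     + uscal (if m = n then (half (int m - 1) ^ 2 - 1 / 4) / 3 else 0) * ugen gC2"

lemma gQ_gQ_commute:
  "ugen (gQ (int m - 1)) * ugen (gQ (- int n))
     = - (ugen (gQ (- int n)) * ugen (gQ (int m - 1))) + bracket_QQ m n"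
  using ugen_commute[of "gQ (int m - 1)" "gQ (- int n)"]
  by (simp add: parity_sign_def uscal_uminus ulin_add bracket_QQ_def)

lemma gM_bracket_ML: "ugen (gM k) * bracket_ML m n = bracket_ML m n * ugen (gM k)"
  by (simp add: bracket_ML_def distrib_left distrib_right gC2_commute gM_gM_commute[of k]
      uscal_left_commute mult.assoc)

lemma bracket_QQ_gQ: "ugen (gQ k) * bracket_QQ m n = bracket_QQ m n * ugen (gQ k)"
  by (simp add: bracket_QQ_def distrib_left distrib_right gC2_commute gM_gQ_commute
      uscal_left_commute mult.assoc)

lemma bracket_QQ_Qpos: "Qpos ms * bracket_QQ m n = bracket_QQ m n * Qpos ms"
  by (simp add: bracket_QQ_def distrib_left distrib_right gC2_commute gM_Qpos_commute
      uscal_left_commute mult.assoc)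

lemma Mpos_remove1: "m \<in> set ms \<Longrightarrow> ugen (gM (int m)) * Mpos (remove1 m ms) = Mpos ms"
proof (induction ms)
  case (Cons a ms)
  show ?case
  proof (cases "m = a")
    case False
    then have "ugen (gM (int m)) * Mpos (remove1 m ms) = Mpos ms" using Cons by simp
    with False show ?thesis
      by (simp add: Mpos_def) (metis gM_gM_commute mult.assoc)
  qed (simp add: Mpos_def)
qed simp

text \<open>The Leibniz rule. Each bracket commutes with all M-modes, so it can be collected on the
  left. The sum runs over list entries, so repeated modes count repeatedly.\<close>

lemma Mpos_gL:
  "Mpos ms * ugen (gL (- int n)) = ugen (gL (- int n)) * Mpos ms
     + (\<Sum>m\<leftarrow>ms. bracket_ML m n * Mpos (remove1 m ms))"
proof (induction ms)
  case Nil
  show ?case by (simp add: Mpos_def)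
next
  case (Cons a ms)
  let ?a = "ugen (gM (int a))" and ?L = "ugen (gL (- int n))"
  have step: "?a * (\<Sum>m\<leftarrow>ms. bracket_ML m n * Mpos (remove1 m ms))
      = (\<Sum>m\<leftarrow>ms. bracket_ML m n * Mpos (remove1 m (a # ms)))"
  proof -
    have "?a * (bracket_ML m n * Mpos (remove1 m ms)) = bracket_ML m n * Mpos (remove1 m (a # ms))"
      if "m \<in> set ms" for m
    proof -
      have "?a * (bracket_ML m n * Mpos (remove1 m ms)) = bracket_ML m n * (?a * Mpos (remove1 m ms))"
        by (metis gM_bracket_ML mult.assoc)
      also have "?a * Mpos (remove1 m ms) = Mpos (remove1 m (a # ms))"
        using that Mpos_remove1[of a ms] by (auto simp: Mpos_def)
      finally show ?thesis .
    qed
    then show ?thesis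
      by (simp add: sum_list_const_mult[symmetric] cong: map_cong)
  qed
  have "Mpos (a # ms) * ?L = ?a * (Mpos ms * ?L)" by (simp add: Mpos_def mult.assoc)
  also have "\<dots> = (?a * ?L) * Mpos ms + (\<Sum>m\<leftarrow>ms. bracket_ML m n * Mpos (remove1 m (a # ms)))"
    by (simp only: Cons distrib_left step mult.assoc)
  also have "(?a * ?L) * Mpos ms = ?L * Mpos (a # ms) + bracket_ML a n * Mpos ms"
    by (simp only: gM_gL_commute distrib_right) (simp add: Mpos_def mult.assoc)
  finally show ?case by (simp add: add.assoc)
qed

text \<open>The super-Leibniz rule: reaching position i means passing i odd factors, hence the sign.
  The brackets commute with the Q-modes and can stand in front.\<close>

lemma gQ_Qneg:
  "ugen (gQ (int m - 1)) * Qneg ns = uscal ((- 1) ^ length ns) * Qneg ns * ugen (gQ (int m - 1))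
     + (\<Sum>i<length ns. uscal ((- 1) ^ i) * (bracket_QQ m (ns ! i) * Qneg (take i ns @ drop (Suc i) ns)))"
proof (induction ns)
  case Nil
  show ?case by (simp add: Qneg_def)
next
  case (Cons n ns)
  let ?m = "ugen (gQ (int m - 1))" and ?n = "ugen (gQ (- int n))"
  let ?t = "\<lambda>ns i. bracket_QQ m (ns ! i) * Qneg (take i ns @ drop (Suc i) ns)"
  have step: "- (?n * (uscal ((- 1) ^ i) * ?t ns i)) = uscal ((- 1) ^ Suc i) * ?t (n # ns) (Suc i)" for i
  proof -
    have "?n * ?t ns i = bracket_QQ m (ns ! i) * (?n * Qneg (take i ns @ drop (Suc i) ns))"
      by (simp only: mult.assoc[symmetric] bracket_QQ_gQ)
    also have "\<dots> = ?t (n # ns) (Suc i)"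
      by (simp add: Qneg_def)
    finally have "?n * ?t ns i = ?t (n # ns) (Suc i)" .
    then show ?thesis
      unfolding uscal_left_commute[of ?n] by (simp add: uscal_uminus)
  qed
  have "?m * Qneg (n # ns) = (?m * ?n) * Qneg ns" by (simp add: Qneg_def mult.assoc)
  also have "\<dots> = - (?n * (?m * Qneg ns)) + bracket_QQ m n * Qneg ns"
    by (simp add: gQ_gQ_commute left_diff_distrib mult.assoc)
  also have "?n * (?m * Qneg ns) = uscal ((- 1) ^ length ns) * Qneg (n # ns) * ?m
      + (\<Sum>i<length ns. ?n * (uscal ((- 1) ^ i) * ?t ns i))"
    unfolding Cons by (simp add: distrib_left sum_distrib_left Qneg_def mult.assoc uscal_left_commute[of ?n])
  also have "- \<dots> = uscal ((- 1) ^ length (n # ns)) * Qneg (n # ns) * ?m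
      + (\<Sum>i<length ns. uscal ((- 1) ^ Suc i) * ?t (n # ns) (Suc i))"
    by (simp only: minus_add_distrib sum_negf[symmetric] step) (simp add: uscal_uminus)
  finally show ?case
    by (simp add: sum.lessThan_Suc_shift del: sum.lessThan_Suc)
qed

text \<open>Twice the weight of the \<open>Q\<close>-monomials, so as to stay within the natural numbers.\<close>

definition double_weight :: "nat list \<Rightarrow> nat" where
  "double_weight ns = (\<Sum>n\<leftarrow>ns. 2 * n - 1)"

lemma double_weight_delete: "i < length ns \<Longrightarrow> double_weight ns = (2 * ns ! i - 1) + double_weight (take i ns @ drop (Suc i) ns)"
  by (subst (1) id_take_nth_drop[of i ns]) (simp_all add: double_weight_def)

lemma in_set_delete: "z \<in> set (take i ns @ drop (Suc i) ns) \<Longrightarrow> z \<in> set ns"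
  by (auto dest: in_set_takeD in_set_dropD)

context
  fixes h1 h2 c1 c2 :: complex
begin

text \<open>Equality of u 1 and v 1 up to the radical of the form. It survives left but not right
  multiplication, so products are evaluated from the right.\<close>

definition vac_eq :: "uea \<Rightarrow> uea \<Rightarrow> bool" (infix "\<approx>" 50) where
  "u \<approx> v \<longleftrightarrow> (\<forall>a. vac_coeff h1 h2 c1 c2 (a * u) = vac_coeff h1 h2 c1 c2 (a * v))"

lemma vac_eq_refl [simp]: "u \<approx> u"
  by (simp add: vac_eq_def)

lemma vac_eq_trans [trans]: "u \<approx> v \<Longrightarrow> v \<approx> w \<Longrightarrow> u \<approx> w"
  by (simp add: vac_eq_def)

lemma vac_eq_add: "u \<approx> v \<Longrightarrow> u' \<approx> v' \<Longrightarrow> u + u' \<approx> v + v'"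
  by (simp add: vac_eq_def distrib_left vac_coeff_add)

lemma vac_eq_mult_left: "u \<approx> v \<Longrightarrow> a * u \<approx> a * v"
  by (simp add: vac_eq_def mult.assoc[symmetric])

lemma vac_eq_mult_left_0: "u \<approx> 0 \<Longrightarrow> a * u \<approx> 0"
  using vac_eq_mult_left[of u 0 a] by simp

lemma vac_eq_vac_coeff: "u \<approx> uscal c \<Longrightarrow> vac_coeff h1 h2 c1 c2 u = c"
  unfolding vac_eq_def by (metis mult_1 vac_coeff_uscal)

lemma vac_eq_vac_coeff_mult: "u \<approx> uscal c \<Longrightarrow> vac_coeff h1 h2 c1 c2 (a * u) = c * vac_coeff h1 h2 c1 c2 a"
  unfolding vac_eq_def by (metis uscal_commute vac_coeff_uscal_mult)

lemma vac_eq_g_plus: "x \<in> g_plus \<Longrightarrow> a * ugen x \<approx> 0"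
  by (simp add: vac_eq_def mult.assoc[symmetric] vac_coeff_g_plus)

lemma vac_eq_g_zero: "x \<in> g_zero \<Longrightarrow> ugen x \<approx> uscal (highest_weight h1 h2 c1 c2 x)"
  by (simp add: vac_eq_def vac_coeff_g_zero vac_coeff_uscal_mult flip: uscal_commute)

lemma vac_eq_uscal_mult: "u \<approx> uscal c \<Longrightarrow> uscal d * u \<approx> uscal (d * c)"
  using vac_eq_mult_left[of u "uscal c" "uscal d"] by (simp add: uscal_mult)

lemma vac_eq_sum_list:
  "(\<And>m. m \<in> set ms \<Longrightarrow> t m \<approx> uscal (f m)) \<Longrightarrow> sum_list (map t ms) \<approx> uscal (sum_list (map f ms))"
  by (induction ms) (simp_all add: vac_eq_add uscal_add)

lemma vac_eq_sum:
  "(\<And>i. i \<in> A \<Longrightarrow> t i \<approx> uscal (f i)) \<Longrightarrow> sum t A \<approx> uscal (sum f A)"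
  by (induction A rule: infinite_finite_induct) (simp_all add: vac_eq_add uscal_add)

text \<open>The scalar by which [M_r, L_{-r}] acts on the vacuum. \<open>odd_weight\<close> is the
  one of the bracket of Q-modes t - 1/2 and -(t - 1/2).\<close>

definition even_weight :: "nat \<Rightarrow> complex" where
  "even_weight r = of_nat r * (2 * h2 + (of_nat r ^ 2 - 1) / 12 * c2)"

definition odd_weight :: "nat \<Rightarrow> complex" where
  "odd_weight t = 2 * h2 + (4 * (of_nat t - 1 / 2) ^ 2 - 1) / 12 * c2"

lemma vac_eq_gM_gC2: "uscal a * ugen (gM 0) + uscal b * ugen gC2 \<approx> uscal (a * h2 + b * c2)"
proof -
  have "ugen (gM 0) \<approx> uscal h2" "ugen gC2 \<approx> uscal c2"
    using vac_eq_g_zero[of "gM 0"] vac_eq_g_zero[of gC2] by (simp_all add: g_zero_def)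
  then show ?thesis
    unfolding uscal_add by (intro vac_eq_add vac_eq_uscal_mult)
qed

lemma bracket_ML_same: "bracket_ML r r \<approx> uscal (even_weight r)"
proof -
  have "bracket_ML r r = uscal (of_nat r + of_nat r) * ugen (gM 0)
      + uscal ((of_nat r ^ 3 - of_nat r) / 12) * ugen gC2"
    by (simp add: bracket_ML_def)
  also have "\<dots> \<approx> uscal ((of_nat r + of_nat r) * h2 + (of_nat r ^ 3 - of_nat r) / 12 * c2)"
    by (rule vac_eq_gM_gC2)
  also have "\<dots> = uscal (even_weight r)"
    unfolding even_weight_def
    by (rule arg_cong[of _ _ uscal]) (simp add: power3_eq_cube power2_eq_square field_simps)
  finally show ?thesis .
qed

lemma bracket_QQ_same: "bracket_QQ t t \<approx> uscal (odd_weight t)"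
proof -
  have "bracket_QQ t t = uscal 2 * ugen (gM 0) + uscal ((half (int t - 1) ^ 2 - 1 / 4) / 3) * ugen gC2"
    by (simp add: bracket_QQ_def)
  also have "\<dots> \<approx> uscal (2 * h2 + (half (int t - 1) ^ 2 - 1 / 4) / 3 * c2)"
    by (rule vac_eq_gM_gC2)
  also have "\<dots> = uscal (odd_weight t)"
    unfolding odd_weight_def half_def
    by (rule arg_cong[of _ _ uscal]) (simp add: power2_eq_square field_simps)
  finally show ?thesis .
qed

section \<open>The pairing of M-modes with L-modes\<close>

text \<open>A product of positive total weight kills the vacuum. In place of a grading of U(g), the
  leftmost L-mode is removed and the excess weight is tracked.\<close>

lemma Mpos_Lneg_0:
  "\<lbrakk>\<And>m. m \<in> set ms \<Longrightarrow> 0 < m; sum_list ns < sum_list ms\<rbrakk> \<Longrightarrow> Mpos ms * Lneg ns \<approx> 0"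
proof (induction ns arbitrary: ms)
  case Nil
  then obtain ms' m where "ms = ms' @ [m]" by (cases ms rule: rev_cases) auto
  then show ?case
    using Nil vac_eq_g_plus[of "gM (int m)" "Mpos ms'"] by (simp add: Mpos_def Lneg_def g_plus_def)
next
  case (Cons n ns)
  have "bracket_ML m n * Mpos (remove1 m ms) * Lneg ns \<approx> uscal 0" if "m \<in> set ms" for m
  proof -
    have sum: "sum_list ms = m + sum_list (remove1 m ms)"
      using that by (rule sum_list_remove1)
    have pos: "0 < x" if "x \<in> set (remove1 m ms)" for x
      using that Cons.prems(1) set_remove1_subset[of m ms] by blast
    show ?thesis
    proof (cases "n < m")
      \<comment> \<open>The bracket is a positive mode M_{m-n} without central term, which joins the
        list; the M-weight drops only by n.\<close>
      case True
      then have "Mpos ((m - n) # remove1 m ms) * Lneg ns \<approx> 0"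
        using sum pos Cons.prems(2) by (intro Cons.IH) auto
      then have "uscal (of_nat m + of_nat n) * (Mpos ((m - n) # remove1 m ms) * Lneg ns) \<approx> 0"
        by (rule vac_eq_mult_left_0)
      with True show ?thesis
        by (simp add: bracket_ML_def Mpos_def mult.assoc of_nat_diff)
    next
      \<comment> \<open>The bracket, which need not kill the vacuum, stays on the left; since m is
        at most n, the remaining M-modes still outweigh the remaining L-modes.\<close>
      case False
      then have "Mpos (remove1 m ms) * Lneg ns \<approx> 0"
        using sum pos Cons.prems(2) by (intro Cons.IH) auto
      then show ?thesis by (simp add: mult.assoc vac_eq_mult_left_0)
    qed
  qed
  from vac_eq_sum_list[of ms "\<lambda>m. bracket_ML m n * Mpos (remove1 m ms) * Lneg ns" "\<lambda>_. 0", OF this]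
  have "(\<Sum>m\<leftarrow>ms. bracket_ML m n * Mpos (remove1 m ms) * Lneg ns) \<approx> 0" by simp
  moreover have "ugen (gL (- int n)) * (Mpos ms * Lneg ns) \<approx> 0"
    using Cons by (intro vac_eq_mult_left_0 Cons.IH) auto
  ultimately have "ugen (gL (- int n)) * (Mpos ms * Lneg ns)
      + (\<Sum>m\<leftarrow>ms. bracket_ML m n * Mpos (remove1 m ms) * Lneg ns) \<approx> 0 + 0"
    by (intro vac_eq_add)
  moreover have "Mpos ms * Lneg (n # ns) = ugen (gL (- int n)) * (Mpos ms * Lneg ns)
      + (\<Sum>m\<leftarrow>ms. bracket_ML m n * Mpos (remove1 m ms) * Lneg ns)"
    using Mpos_gL[of ms n]
    by (simp add: Lneg_def mult.assoc[symmetric] distrib_right sum_list_mult_const)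
  ultimately show ?case by simp
qed

text \<open>With r an upper bound for all M-modes, contracting L_{-r} with a smaller M_m removes too
  little M-weight, and the rest vanishes by \<open>Mpos_Lneg_0\<close>. So does the term with L_{-r}
  moved to the far left. What survives is one equal contribution for each copy of M_r.\<close>

lemma Mpos_Lneg_step:
  assumes ms: "\<And>m. m \<in> set ms \<Longrightarrow> 0 < m \<and> m \<le> r" and "0 < r" and sum: "sum_list ms = r + sum_list ns"
    and rest: "r \<in> set ms \<Longrightarrow> Mpos (remove1 r ms) * Lneg ns \<approx> uscal v"
  shows "Mpos ms * Lneg (r # ns) \<approx> uscal (of_nat (count_list ms r) * even_weight r * v)"
proof -
  have "bracket_ML m r * Mpos (remove1 m ms) * Lneg ns \<approx> uscal (if m = r then even_weight r * v else 0)"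
    if "m \<in> set ms" for m
  proof (cases "m = r")
    case True
    then have "bracket_ML r r * (Mpos (remove1 r ms) * Lneg ns) \<approx> bracket_ML r r * uscal v"
      using rest that by (intro vac_eq_mult_left) simp
    also have "\<dots> = uscal v * bracket_ML r r" by (rule uscal_commute[symmetric])
    also have "\<dots> \<approx> uscal (v * even_weight r)"
      by (rule vac_eq_uscal_mult) (rule bracket_ML_same)
    finally show ?thesis using True by (simp add: mult.assoc mult.commute)
  next
    case False
    have "sum_list ms = m + sum_list (remove1 m ms)"
      using that by (rule sum_list_remove1)
    moreover have "m < r" using ms[OF that] False by simp
    moreover have "0 < x" if "x \<in> set (remove1 m ms)" for x
      using that ms set_remove1_subset[of m ms] by blast
    ultimately have "Mpos (remove1 m ms) * Lneg ns \<approx> 0"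
      using sum by (intro Mpos_Lneg_0) auto
    then show ?thesis using False by (simp add: mult.assoc vac_eq_mult_left_0)
  qed
  from vac_eq_sum_list[of ms "\<lambda>m. bracket_ML m r * Mpos (remove1 m ms) * Lneg ns", OF this]
  have "(\<Sum>m\<leftarrow>ms. bracket_ML m r * Mpos (remove1 m ms) * Lneg ns)
      \<approx> uscal (\<Sum>m\<leftarrow>ms. if m = r then even_weight r * v else 0)" .
  moreover have "(\<Sum>m\<leftarrow>ms. if m = r then even_weight r * v else 0)
      = of_nat (count_list ms r) * even_weight r * v"
    by (induction ms) (simp_all add: algebra_simps)
  moreover have "ugen (gL (- int r)) * (Mpos ms * Lneg ns) \<approx> 0"
    using ms sum \<open>0 < r\<close> by (intro vac_eq_mult_left_0 Mpos_Lneg_0) auto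
  ultimately have "ugen (gL (- int r)) * (Mpos ms * Lneg ns)
      + (\<Sum>m\<leftarrow>ms. bracket_ML m r * Mpos (remove1 m ms) * Lneg ns)
      \<approx> 0 + uscal (of_nat (count_list ms r) * even_weight r * v)"
    by (intro vac_eq_add) simp_all
  moreover have "Mpos ms * Lneg (r # ns) = ugen (gL (- int r)) * (Mpos ms * Lneg ns)
      + (\<Sum>m\<leftarrow>ms. bracket_ML m r * Mpos (remove1 m ms) * Lneg ns)"
    using Mpos_gL[of ms r]
    by (simp add: Lneg_def mult.assoc[symmetric] distrib_right sum_list_mult_const)
  ultimately show ?thesis by simp
qed

text \<open>Above r the two partitions agree, so largest parts can be cancelled in pairs; as
  \<open>ns\<close> has more copies of r than \<open>ms\<close>, a copy of L_{-r} finally finds no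
  M_r, and \<open>Mpos_Lneg_step\<close> gives 0.\<close>

lemma Mpos_Lneg_neq:
  assumes "sorted_wrt (\<ge>) ns" "\<And>m. m \<in> set ms \<Longrightarrow> 0 < m" "\<And>n. n \<in> set ns \<Longrightarrow> 0 < n"
    and "sum_list ms = sum_list ns"
    and "count_list ms r < count_list ns r" "\<And>s. r < s \<Longrightarrow> count_list ms s = count_list ns s"
  shows "Mpos ms * Lneg ns \<approx> 0"
  using assms
proof (induction ns arbitrary: ms)
  case (Cons n ns)
  have r: "r \<le> n" "n \<in> set ms \<or> n = r"
  proof -
    have "r \<in> set (n # ns)" using Cons.prems(5) by (metis count_list_0_iff not_less_zero)
    then show "r \<le> n" using Cons.prems(1) by auto
    show "n \<in> set ms \<or> n = r"
    proof (rule ccontr)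
      assume "\<not> (n \<in> set ms \<or> n = r)"
      then have "count_list ms n = 0" "r < n" using \<open>r \<le> n\<close> by (auto simp: count_notin)
      then show False using Cons.prems(6)[of n] by simp
    qed
  qed
  have "m \<le> n" if "m \<in> set ms" for m
  proof (rule ccontr)
    assume "\<not> m \<le> n"
    then have "m \<notin> set (n # ns)" using Cons.prems(1) by auto
    then have "count_list (n # ns) m = 0" by (rule count_notin)
    moreover have "count_list ms m \<noteq> 0" using that by (simp add: count_list_0_iff)
    ultimately show False using Cons.prems(6)[of m] r(1) \<open>\<not> m \<le> n\<close> by simp
  qed
  moreover have "Mpos (remove1 n ms) * Lneg ns \<approx> uscal 0" if "n \<in> set ms"
  proof -
    have count: "count_list ms s = count_list (remove1 n ms) s + (if s = n then 1 else 0)" for s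
      using that by (induction ms) auto
    have count': "count_list (n # ns) s = count_list ns s + (if s = n then 1 else 0)" for s
      by simp
    have "Mpos (remove1 n ms) * Lneg ns \<approx> 0"
    proof (rule Cons.IH)
      show "sum_list (remove1 n ms) = sum_list ns"
        using Cons.prems(4) sum_list_remove1[OF that] by simp
      show "count_list (remove1 n ms) r < count_list ns r"
        using Cons.prems(5) count[of r] count'[of r] by linarith
      show "count_list (remove1 n ms) s = count_list ns s" if "r < s" for s
        using Cons.prems(6)[OF that] count[of s] count'[of s] by linarith
    qed (use Cons.prems set_remove1_subset[of n ms] in auto)
    then show ?thesis by simp
  qed
  ultimately have "Mpos ms * Lneg (n # ns) \<approx> uscal (of_nat (count_list ms n) * even_weight n * 0)"
    using Cons.prems by (intro Mpos_Lneg_step) auto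
  then show ?case by simp
qed simp

text \<open>The multiplicities found by successive contractions of equal modes multiply to a
  factorial. The index set \<open>A\<close> is fixed in advance so that the product keeps its range
  while \<open>ns\<close> shrinks; absent parts contribute 1.\<close>

lemma Mpos_Lneg_eq:
  assumes "sorted_wrt (\<ge>) ns" "\<And>n. n \<in> set ns \<Longrightarrow> 0 < n" "mset ms = mset ns"
    and "finite A" "set ns \<subseteq> A"
  shows "Mpos ms * Lneg ns
    \<approx> uscal (\<Prod>r\<in>A. fact (count_list ns r) * even_weight r ^ count_list ns r)"
  using assms
proof (induction ns arbitrary: ms)
  case Nil
  then show ?case by (simp add: Mpos_def Lneg_def)
next
  case (Cons n ns)
  let ?f = "\<lambda>ns r. fact (count_list ns r) * even_weight r ^ count_list ns r"
  have set: "set ms = set (n # ns)" using Cons.prems(3) mset_eq_setD by blast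
  have "Mpos (remove1 n ms) * Lneg ns \<approx> uscal (\<Prod>r\<in>A. ?f ns r)"
    using Cons.prems by (intro Cons.IH) (auto simp: mset_remove1)
  moreover have "sum_list ms = n + sum_list ns"
    using Cons.prems(3) by (metis sum_list.Cons sum_mset_sum_list)
  ultimately have "Mpos ms * Lneg (n # ns)
      \<approx> uscal (of_nat (count_list ms n) * even_weight n * (\<Prod>r\<in>A. ?f ns r))"
    using Cons.prems set by (intro Mpos_Lneg_step) auto
  moreover have "count_list ms n = Suc (count_list ns n)"
    using Cons.prems(3) by (metis count_list.simps(2) count_mset Suc_eq_plus1)
  moreover have "(\<Prod>r\<in>A. ?f (n # ns) r) = ?f (n # ns) n * (\<Prod>r\<in>A - {n}. ?f ns r)"
    using Cons.prems by (subst prod.remove[of A n]) auto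
  moreover have "(\<Prod>r\<in>A. ?f ns r) = ?f ns n * (\<Prod>r\<in>A - {n}. ?f ns r)"
    using Cons.prems by (subst prod.remove[of A n]) auto
  ultimately show ?case by (simp add: algebra_simps)
qed

section \<open>The pairing of Q-modes\<close>

text \<open>Contracting with a smaller mode leaves a positive M-mode, which commutes with the
  Q-modes through to the vacuum and kills it. Contracting with a larger one leaves an M-mode that is
  moved to the far left, and \<open>less\<close> disposes of the rest. Only equal modes
  contribute.\<close>

lemma Qpos_Qneg_step:
  assumes less: "\<And>i. i < length ns \<Longrightarrow> m < ns ! i \<Longrightarrow> Qpos ms * Qneg (take i ns @ drop (Suc i) ns) \<approx> 0"
    and eq: "\<And>i. i < length ns \<Longrightarrow> ns ! i = m \<Longrightarrow> Qpos ms * Qneg (take i ns @ drop (Suc i) ns) \<approx> uscal (v i)"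
    and "0 < m"
  shows "Qpos (ms @ [m]) * Qneg ns
    \<approx> uscal (\<Sum>i<length ns. if ns ! i = m then (- 1) ^ i * (odd_weight m * v i) else 0)"
proof -
  let ?rest = "\<lambda>i. Qneg (take i ns @ drop (Suc i) ns)"
  let ?t = "\<lambda>i. uscal ((- 1) ^ i) * (bracket_QQ m (ns ! i) * ?rest i)"
  have "Qpos ms * ?t i \<approx> uscal (if ns ! i = m then (- 1) ^ i * (odd_weight m * v i) else 0)"
    if i: "i < length ns" for i
  proof -
    have "Qpos ms * (bracket_QQ m (ns ! i) * ?rest i)
        \<approx> uscal (if ns ! i = m then odd_weight m * v i else 0)"
    proof (cases "ns ! i" m rule: linorder_cases)
      case less
      then have "bracket_QQ m (ns ! i) * ?rest i = uscal 2 * (?rest i * ugen (gM (int m - int (ns ! i))))"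
        by (simp add: bracket_QQ_def gM_Qneg_commute mult.assoc)
      moreover have "?rest i * ugen (gM (int m - int (ns ! i))) \<approx> 0"
        using less by (intro vac_eq_g_plus) (simp add: g_plus_def)
      ultimately show ?thesis using less by (simp add: vac_eq_mult_left_0)
    next
      case greater
      then have "bracket_QQ m (ns ! i) * (Qpos ms * ?rest i) \<approx> 0"
        using assms(1)[OF i greater] by (intro vac_eq_mult_left_0[of "Qpos ms * _"])
      with greater show ?thesis by (simp add: bracket_QQ_Qpos flip: mult.assoc)
    next
      case equal
      have "bracket_QQ m m * (Qpos ms * ?rest i) \<approx> bracket_QQ m m * uscal (v i)"
        using eq[OF i equal] by (intro vac_eq_mult_left)
      also have "bracket_QQ m m * uscal (v i) = uscal (v i) * bracket_QQ m m"
        by (rule uscal_commute[symmetric])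
      also have "\<dots> \<approx> uscal (v i * odd_weight m)"
        by (intro vac_eq_uscal_mult bracket_QQ_same)
      finally show ?thesis
        using equal by (simp add: bracket_QQ_Qpos mult.commute flip: mult.assoc)
    qed
    then have "uscal ((- 1) ^ i) * (Qpos ms * (bracket_QQ m (ns ! i) * ?rest i))
        \<approx> uscal ((- 1) ^ i * (if ns ! i = m then odd_weight m * v i else 0))"
      by (rule vac_eq_uscal_mult)
    moreover have "(- 1) ^ i * (if ns ! i = m then odd_weight m * v i else 0)
        = (if ns ! i = m then (- 1) ^ i * (odd_weight m * v i) else 0)"
      by simp
    ultimately show ?thesis
      by (simp only: uscal_left_commute)
  qed
  then have "(\<Sum>i<length ns. Qpos ms * ?t i)
      \<approx> uscal (\<Sum>i<length ns. if ns ! i = m then (- 1) ^ i * (odd_weight m * v i) else 0)"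
    by (intro vac_eq_sum) simp
  \<comment> \<open>\<open>0 < m\<close> makes \<open>gQ (int m - 1)\<close> a mode of at least 1/2,
    hence an element of g_+.\<close>
  moreover have "Qpos ms * (uscal ((- 1) ^ length ns) * Qneg ns) * ugen (gQ (int m - 1)) \<approx> 0"
    using \<open>0 < m\<close> by (intro vac_eq_g_plus) (simp add: g_plus_def)
  ultimately have "Qpos ms * (uscal ((- 1) ^ length ns) * Qneg ns) * ugen (gQ (int m - 1))
      + (\<Sum>i<length ns. Qpos ms * ?t i)
      \<approx> 0 + uscal (\<Sum>i<length ns. if ns ! i = m then (- 1) ^ i * (odd_weight m * v i) else 0)"
    by (intro vac_eq_add)
  moreover have "Qpos (ms @ [m]) * Qneg ns
      = Qpos ms * (uscal ((- 1) ^ length ns) * Qneg ns) * ugen (gQ (int m - 1)) + (\<Sum>i<length ns. Qpos ms * ?t i)"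
  proof -
    have "Qpos (ms @ [m]) * Qneg ns = Qpos ms * (ugen (gQ (int m - 1)) * Qneg ns)"
      by (simp add: Qpos_def mult.assoc)
    then show ?thesis
      by (simp only: gQ_Qneg distrib_left sum_distrib_left mult.assoc)
  qed
  ultimately show ?thesis by simp
qed

lemma Qpos_Qneg_0:
  "\<lbrakk>\<And>m. m \<in> set ms \<Longrightarrow> 0 < m; \<And>n. n \<in> set ns \<Longrightarrow> 0 < n; double_weight ns < double_weight ms\<rbrakk> \<Longrightarrow> Qpos ms * Qneg ns \<approx> 0"
proof (induction ms arbitrary: ns rule: rev_induct)
  case Nil
  then show ?case by (simp add: double_weight_def)
next
  case (snoc m ms)
  have "Qpos ms * Qneg (take i ns @ drop (Suc i) ns) \<approx> 0" if i: "i < length ns" "m \<le> ns ! i" for i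
  proof (rule snoc.IH)
    show "double_weight (take i ns @ drop (Suc i) ns) < double_weight ms"
      using double_weight_delete[OF i(1)] i(2) snoc.prems(3) by (simp add: double_weight_def)
    show "0 < z" if "z \<in> set (take i ns @ drop (Suc i) ns)" for z
      using in_set_delete[OF that] by (rule snoc.prems(2))
  qed (use snoc.prems(1) in simp)
  then have "Qpos (ms @ [m]) * Qneg ns
      \<approx> uscal (\<Sum>i<length ns. if ns ! i = m then (- 1) ^ i * (odd_weight m * 0) else 0)"
    using snoc.prems by (intro Qpos_Qneg_step) auto
  then show ?case by (simp cong: if_cong)
qed

text \<open>A contraction of equal modes deletes the same element from two distinct sets, which stay
  distinct and of equal weight; a contraction with a larger mode is excluded by weight.\<close>

lemma Qpos_Qneg_neq:
  "\<lbrakk>\<And>m. m \<in> set ms \<Longrightarrow> 0 < m; \<And>n. n \<in> set ns \<Longrightarrow> 0 < n; double_weight ns = double_weight ms;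
    distinct ms; distinct ns; set ms \<noteq> set ns\<rbrakk> \<Longrightarrow> Qpos ms * Qneg ns \<approx> 0"
proof (induction ms arbitrary: ns rule: rev_induct)
  case Nil
  have "ns = []"
  proof (cases ns)
    case (Cons n ns')
    then have "0 < n" using Nil.prems(2) by simp
    then show ?thesis using Cons Nil.prems(3) by (simp add: double_weight_def)
  qed
  with Nil show ?case by simp
next
  case (snoc m ms)
  let ?rest = "\<lambda>i. take i ns @ drop (Suc i) ns"
  have pos: "0 < n" if "n \<in> set (?rest i)" for n i
    using in_set_delete[OF that] by (rule snoc.prems(2))
  have m: "0 < m" using snoc.prems(1) by simp
  have double_weight: "double_weight (ms @ [m]) = double_weight ms + (2 * m - 1)" by (simp add: double_weight_def)
  have greater: "Qpos ms * Qneg (?rest i) \<approx> 0" if i: "i < length ns" "m < ns ! i" for i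
    using double_weight_delete[OF i(1)] i(2) snoc.prems(1,3) pos m double_weight by (intro Qpos_Qneg_0) auto
  have equal: "Qpos ms * Qneg (?rest i) \<approx> uscal 0" if i: "i < length ns" "ns ! i = m" for i
  proof -
    have ns: "ns = take i ns @ m # drop (Suc i) ns"
      using id_take_nth_drop[OF i(1)] i(2) by simp
    then have "distinct (take i ns @ m # drop (Suc i) ns)" "set ns = insert m (set (?rest i))"
      using snoc.prems(5) by (metis, metis list.set(2) set_append Un_insert_right)
    then have "Qpos ms * Qneg (?rest i) \<approx> 0"
      using double_weight_delete[OF i(1)] i(2) snoc.prems pos double_weight by (intro snoc.IH) auto
    then show ?thesis by simp
  qed
  have "Qpos (ms @ [m]) * Qneg ns
      \<approx> uscal (\<Sum>i<length ns. if ns ! i = m then (- 1) ^ i * (odd_weight m * 0) else 0)"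
    using snoc.prems(2) greater equal m by (intro Qpos_Qneg_step) auto
  then show ?case by (simp cong: if_cong)
qed

text \<open>The reversal places equal modes next to each other, so the contraction happens at
  position 0 and no sign appears. Distinctness excludes a second equal mode, and weight excludes
  larger ones.\<close>

lemma Qpos_Qneg_eq:
  "\<lbrakk>\<And>n. n \<in> set ns \<Longrightarrow> 0 < n; distinct ns\<rbrakk>
    \<Longrightarrow> Qpos (rev ns) * Qneg ns \<approx> uscal (\<Prod>t\<in>set ns. odd_weight t)"
proof (induction ns)
  case Nil
  then show ?case by (simp add: Qpos_def Qneg_def)
next
  case (Cons n ns)
  let ?rest = "\<lambda>i. take i (n # ns) @ drop (Suc i) (n # ns)"
  let ?v = "\<Prod>t\<in>set ns. odd_weight t"
  have n: "0 < n" using Cons.prems(1) by simp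
  have zero: "i = 0" if "i < length (n # ns)" "(n # ns) ! i = n" for i
    using that Cons.prems(2) by (metis nth_Cons_0 nth_eq_iff_index_eq length_pos_if_in_set nth_mem)
  have "Qpos (rev ns) * Qneg (?rest i) \<approx> 0" if i: "i < length (n # ns)" "n < (n # ns) ! i" for i
  proof (rule Qpos_Qneg_0)
    have "double_weight (n # ns) = (2 * n - 1) + double_weight (rev ns)"
      by (simp add: double_weight_def flip: rev_map)
    then show "double_weight (?rest i) < double_weight (rev ns)" using double_weight_delete[OF i(1)] i(2) n by simp
    show "0 < x" if "x \<in> set (?rest i)" for x
      using in_set_delete[OF that] by (rule Cons.prems(1))
  qed (use Cons.prems in auto)
  moreover have "Qpos (rev ns) * Qneg (?rest i) \<approx> uscal ?v" if "i < length (n # ns)" "(n # ns) ! i = n" for i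
    using Cons zero[OF that] by simp
  ultimately have "Qpos (rev ns @ [n]) * Qneg (n # ns) \<approx> uscal (\<Sum>i<length (n # ns).
      if (n # ns) ! i = n then (- 1) ^ i * (odd_weight n * ?v) else 0)"
    using Cons.prems(1) n by (intro Qpos_Qneg_step) auto
  also have "(\<Sum>i<length (n # ns). if (n # ns) ! i = n then (- 1) ^ i * (odd_weight n * ?v) else 0)
      = (\<Sum>i\<in>{0}. if (n # ns) ! i = n then (- 1) ^ i * (odd_weight n * ?v) else 0)"
  proof (rule sum.mono_neutral_right)
    show "\<forall>i\<in>{..<length (n # ns)} - {0}.
        (if (n # ns) ! i = n then (- 1) ^ i * (odd_weight n * ?v) else 0) = 0"
      using zero by (metis DiffE insertI1 lessThan_iff)
  qed simp_all
  also have "\<dots> = (\<Prod>t\<in>set (n # ns). odd_weight t)"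
    using Cons.prems(2) by simp
  finally show ?case by simp
qed

end

section \<open>Exponent sequences as decreasing lists of modes\<close>

definition expand :: "seq \<Rightarrow> nat list" where
  "expand i = concat (map (\<lambda>s. replicate (Poly_Mapping.lookup i s) s)
     (rev (sorted_list_of_set (Poly_Mapping.keys i))))"

lemma ordered_prod_expand: "ordered_prod x i = prod_list (map x (expand i))"
proof -
  have "prod_list (map x (concat (map (\<lambda>s. replicate (f s) s) ss))) = prod_list (map (\<lambda>s. x s ^ f s) ss)"
    for f :: "nat \<Rightarrow> nat" and ss
    by (induction ss) (simp_all add: map_concat)
  then show ?thesis by (simp add: ordered_prod_def expand_def)
qed

lemma count_list_expand: "count_list (expand i) s = Poly_Mapping.lookup i s"
proof -
  have count: "count_list (concat (map (\<lambda>s. replicate (f s) s) ss)) s = (if s \<in> set ss then f s else 0)"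
    if "distinct ss" for f :: "nat \<Rightarrow> nat" and ss
  proof -
    have "count_list (replicate n a) s = (if a = s then n else 0)" for n and a :: nat
      by (induction n) auto
    with that show ?thesis by (induction ss) auto
  qed
  show ?thesis
    unfolding expand_def by (subst count) (auto simp: in_keys_iff)
qed

lemma set_expand: "set (expand i) = Poly_Mapping.keys i"
proof -
  have "s \<in> set (expand i) \<longleftrightarrow> count_list (expand i) s \<noteq> 0" for s
    by (simp add: count_list_0_iff)
  then show ?thesis by (auto simp: count_list_expand in_keys_iff)
qed

lemma sorted_expand: "sorted_wrt (\<ge>) (expand i)"
proof -
  have "sorted_wrt (\<ge>) (concat (map (\<lambda>s. replicate (f s) s) ss))"
    if "sorted_wrt (\<ge>) ss" for f :: "nat \<Rightarrow> nat" and ss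
    using that
  proof (induction ss)
    case (Cons a ss)
    have "sorted_wrt (\<ge>) (replicate n a)" for n
      by (induction n) auto
    with Cons show ?case by (auto simp: sorted_wrt_append)
  qed simp
  moreover have "sorted_wrt (\<ge>) (rev (sorted_list_of_set (Poly_Mapping.keys i)))"
    by (simp add: sorted_wrt_rev)
  ultimately show ?thesis unfolding expand_def by blast
qed

lemma sum_list_expand: "sum_list (map f (expand i)) = (\<Sum>s\<in>Poly_Mapping.keys i. Poly_Mapping.lookup i s * f s)" for f :: "nat \<Rightarrow> nat"
  by (simp add: sum_list_map_eq_sum_count set_expand count_list_expand)

lemma distinct_expand:
  assumes "k \<in> seqs01"
  shows "distinct (expand k)"
  unfolding distinct_count_atmost_1 count_mset count_list_expand set_expand
proof
  fix a
  have "Poly_Mapping.lookup k a \<le> 1" using assms by (simp add: seqs01_def)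
  then show "Poly_Mapping.lookup k a = (if a \<in> Poly_Mapping.keys k then 1 else 0)"
    by (simp add: in_keys_iff)
qed

lemma seq_size_expand: "seq_size i = real (sum_list (expand i))"
  using sum_list_expand[of "\<lambda>s. s" i] by (simp add: seq_size_def mult.commute)

lemma seqs_pos: "i \<in> seqs \<Longrightarrow> n \<in> set (expand i) \<Longrightarrow> 0 < n"
  by (rule gr0I) (simp add: set_expand in_keys_iff seqs_def)

lemma seq_size_half_expand:
  assumes "k \<in> seqs"
  shows "2 * seq_size_half k = real (double_weight (expand k))"
proof -
  have *: "real (Poly_Mapping.lookup k s * (2 * s - 1)) = 2 * ((real s - 1 / 2) * real (Poly_Mapping.lookup k s))"
    if "s \<in> Poly_Mapping.keys k" for s
  proof -
    have "0 < s" using seqs_pos[OF assms, of s] that by (simp add: set_expand)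
    then show ?thesis by (simp add: of_nat_diff field_simps)
  qed
  show ?thesis
    unfolding double_weight_def sum_list_expand seq_size_half_def of_nat_sum sum_distrib_left
    by (rule sum.cong[OF refl]) (rule *[symmetric])
qed

lemma seqs01_eqI:
  assumes "k \<in> seqs01" "k1 \<in> seqs01" "Poly_Mapping.keys k = Poly_Mapping.keys k1"
  shows "k = k1"
proof (rule poly_mapping_eqI)
  fix s
  have "Poly_Mapping.lookup k s \<le> 1" "Poly_Mapping.lookup k1 s \<le> 1"
    using assms(1,2) by (auto simp: seqs01_def)
  moreover have "Poly_Mapping.lookup k s = 0 \<longleftrightarrow> Poly_Mapping.lookup k1 s = 0"
    using assms(3) by (metis in_keys_iff)
  ultimately show "Poly_Mapping.lookup k s = Poly_Mapping.lookup k1 s" by linarith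
qed

lemma ubar_Mneg: "ubar (Mneg w) = Mpos (rev w)"
  by (simp add: Mneg_def Mpos_def ubar_prod_list rev_map comp_def)

lemma ubar_Qneg: "ubar (Qneg w) = Qpos (rev w)"
  by (simp add: Qneg_def Qpos_def ubar_prod_list rev_map comp_def)

lemma ubar_Mpos: "ubar (Mpos w) = Mneg (rev w)"
  by (metis ubar_Mneg ubar_ubar rev_rev_ident)

lemma monomial_expand: "monomial (i, j, k) = Qneg (expand k) * Mneg (expand j) * Lneg (expand i)"
  by (simp add: ordered_prod_expand Qneg_def Mneg_def Lneg_def)

lemma monomial_usub:
  assumes "i \<in> seqs" "j \<in> seqs" "k \<in> seqs"
  shows "monomial (i, j, k) \<in> usub g_minus"
proof -
  have "Qneg (expand k) \<in> usub g_minus"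
    unfolding Qneg_def using seqs_pos[OF assms(3)]
    by (intro usub_prod_list) (auto simp: g_minus_def intro!: usub.gen)
  moreover have "Mneg (expand j) \<in> usub g_minus"
    unfolding Mneg_def using seqs_pos[OF assms(2)]
    by (intro usub_prod_list) (auto simp: g_minus_def intro!: usub.gen)
  moreover have "Lneg (expand i) \<in> usub g_minus"
    unfolding Lneg_def using seqs_pos[OF assms(1)]
    by (intro usub_prod_list) (auto simp: g_minus_def intro!: usub.gen)
  ultimately show ?thesis unfolding monomial_expand by (intro usub.mult)
qed

section \<open>Decoupling of the Gram entries\<close>

context
  fixes h1 h2 c1 c2 :: complex and b :: "nat \<Rightarrow> expo" and x y :: nat and i j k i1 j1 k1 :: seq
  assumes bx: "b x = (i, j, k)" and seqs_x: "i \<in> seqs" "j \<in> seqs" "k \<in> seqs01"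
    and b_y: "b y = (i1, j1, k1)" and seqs_y: "i1 \<in> seqs" "j1 \<in> seqs" "k1 \<in> seqs01"
begin

text \<open>The modes of \<open>M\<close> commute with everything but the modes of \<open>L\<close>, so the pairing decouples
  into the three pairings of \<open>M\<^bsup>j\<^esup>\<close> with \<open>L\<^bsup>j1\<^esup>\<close>, of \<open>Q\<^bsup>k\<^esup>\<close> with \<open>Q\<^bsup>k1\<^esup>\<close>
  and of \<open>L\<^bsup>i\<^esup>\<close> with \<open>M\<^bsup>i1\<^esup>\<close>.\<close>

lemma gram_eq_vac_coeff:
  "gram h1 h2 c1 c2 b x y = vac_coeff h1 h2 c1 c2
     (ubar (Lneg (expand i)) * Mneg (expand i1) * (Qpos (rev (expand k)) * Qneg (expand k1))
       * (Mpos (rev (expand j)) * Lneg (expand j1)))"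
proof -
  let ?L = "ubar (Lneg (expand i))" and ?M = "Mpos (rev (expand j))" and ?Q = "Qpos (rev (expand k))"
  let ?Q1 = "Qneg (expand k1)" and ?M1 = "Mneg (expand i1)" and ?L1 = "Lneg (expand j1)"
  have "gram h1 h2 c1 c2 b x y = vac_coeff h1 h2 c1 c2 (ubar (monomial (i, j, k)) * monomial (j1, i1, k1))"
    unfolding gram_def bx b_y star.simps
    using seqs_x seqs_y by (intro cform_on_vac monomial_usub) (auto simp: seqs01_def)
  also have "ubar (monomial (i, j, k)) = ?L * (?M * ?Q)"
    unfolding monomial_expand by (simp add: ubar_mult ubar_Mneg ubar_Qneg)
  also have "?L * (?M * ?Q) * monomial (j1, i1, k1) = ?L * (?M * ?Q * ?Q1 * ?M1) * ?L1"
    unfolding monomial_expand by (simp add: mult.assoc)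
  also have "?M * ?Q * ?Q1 * ?M1 = ?Q * (?M * ?Q1) * ?M1"
    by (subst Mpos_commute(2)) (simp only: mult.assoc)
  also have "\<dots> = ?Q * ?Q1 * (?M * ?M1)"
    by (subst Mpos_commute(3)) (simp only: mult.assoc)
  also have "\<dots> = ?Q * (?Q1 * ?M1) * ?M"
    by (subst Mpos_commute(1)) (simp only: mult.assoc)
  also have "\<dots> = ?Q * ?M1 * ?Q1 * ?M"
    by (subst Mneg_commute(2)[symmetric]) (simp only: mult.assoc)
  also have "\<dots> = ?M1 * (?Q * ?Q1) * ?M"
    by (subst Mneg_commute(1)[symmetric]) (simp only: mult.assoc)
  finally show ?thesis by (simp add: mult.assoc)
qed

lemma gram_factor:
  assumes M: "vac_eq h1 h2 c1 c2 (Mpos (rev (expand j)) * Lneg (expand j1)) (uscal \<alpha>)"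
  shows "gram h1 h2 c1 c2 b x y = \<alpha> * vac_coeff h1 h2 c1 c2
     (ubar (Lneg (expand i)) * Mneg (expand i1) * (Qpos (rev (expand k)) * Qneg (expand k1)))"
  unfolding gram_eq_vac_coeff by (rule vac_eq_vac_coeff_mult[OF M])

text \<open>The remaining factor pairs L^i with M^{i1}. The anti-involution turns it into a pairing
  of M^{i1} with L^i, so the same lemmas apply with the two vectors in exchanged roles.\<close>

lemma gram_factor_Q:
  assumes M: "vac_eq h1 h2 c1 c2 (Mpos (rev (expand j)) * Lneg (expand j1)) (uscal \<alpha>)"
    and Q: "vac_eq h1 h2 c1 c2 (Qpos (rev (expand k)) * Qneg (expand k1)) (uscal \<beta>)"
  shows "gram h1 h2 c1 c2 b x y = \<alpha> * (\<beta> * vac_coeff h1 h2 c1 c2 (Mpos (rev (expand i1)) * Lneg (expand i)))"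
proof -
  have "vac_coeff h1 h2 c1 c2 (ubar (Lneg (expand i)) * Mneg (expand i1))
      = vac_coeff h1 h2 c1 c2 (Mpos (rev (expand i1)) * Lneg (expand i))"
    using vac_coeff_ubar[of h1 h2 c1 c2 "Mpos (rev (expand i1)) * Lneg (expand i)"]
    by (simp add: ubar_mult ubar_Mpos)
  then show ?thesis
    unfolding gram_factor[OF M] vac_eq_vac_coeff_mult[OF Q] by simp
qed

end

lemma Mpos_Lneg_expand_eq:
  assumes "i \<in> seqs"
  shows "vac_eq h1 h2 c1 c2 (Mpos (rev (expand i)) * Lneg (expand i))
    (uscal (\<Prod>r\<in>Poly_Mapping.keys i. fact (Poly_Mapping.lookup i r)
       * even_weight h2 c2 r ^ Poly_Mapping.lookup i r))"
  using Mpos_Lneg_eq[OF sorted_expand[of i] seqs_pos[OF assms], of "rev (expand i)" "Poly_Mapping.keys i" h1 h2 c1 c2]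
  by (simp add: set_expand count_list_expand)

lemma Mpos_Lneg_expand_neq:
  assumes "i \<in> seqs" "j \<in> seqs" "seq_size j = seq_size i" "seq_gt i j"
  shows "vac_eq h1 h2 c1 c2 (Mpos (rev (expand j)) * Lneg (expand i)) (uscal 0)"
proof -
  have count: "count_list (rev (expand i)) s = Poly_Mapping.lookup i s" for i s
    by (metis count_list_expand count_mset mset_rev)
  obtain r where "Poly_Mapping.lookup j r < Poly_Mapping.lookup i r"
      "\<And>s. r < s \<Longrightarrow> Poly_Mapping.lookup j s = Poly_Mapping.lookup i s"
    using assms(4) unfolding seq_gt_def by metis
  then have "vac_eq h1 h2 c1 c2 (Mpos (rev (expand j)) * Lneg (expand i)) 0"
    using assms(3) seqs_pos[OF assms(1)] seqs_pos[OF assms(2)]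
    by (intro Mpos_Lneg_neq[OF sorted_expand, of _ _ r])
      (simp_all add: count count_list_expand seq_size_expand sum_list_rev)
  then show ?thesis by simp
qed

text \<open>Each clause of the order kills one decoupled pairing: (i) and (ii) that of M^j with
  L^{j1}, (iii) and (iv) that of Q^k with Q^{k1}, (v) that of M^{i1} with L^i. On the diagonal, i_r
  equal modes contribute a factorial and the i_r-th power of the whole weight including r; a key t
  of \<open>k\<close> stands for the mode t - 1/2.\<close>

theorem lemma3p1:
  fixes h1 h2 c1 c2 :: complex and n :: real and b :: "nat \<Rightarrow> expo"
  assumes n_half_integer: "\<exists>m::nat. m > 0 \<and> n = real m / 2"
    and listing: "decreasing_listing n b"
  shows "(\<forall>x\<in>{1..card (basis_expos n)}. \<forall>y\<in>{1..card (basis_expos n)}.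
            x < y \<longrightarrow> gram h1 h2 c1 c2 b x y = 0)
    \<and> (\<forall>x\<in>{1..card (basis_expos n)}. \<forall>i j k. b x = (i, j, k) \<longrightarrow>
         gram h1 h2 c1 c2 b x x =
           (\<Prod>r\<in>Poly_Mapping.keys i. fact (Poly_Mapping.lookup i r)
              * (of_nat r * (2 * h2 + (of_nat r ^ 2 - 1) / 12 * c2)) ^ Poly_Mapping.lookup i r)
         * (\<Prod>t\<in>Poly_Mapping.keys k.
              (2 * h2 + (4 * (of_nat t - 1 / 2) ^ 2 - 1) / 12 * c2) ^ Poly_Mapping.lookup k t)
         * (\<Prod>s\<in>Poly_Mapping.keys j. fact (Poly_Mapping.lookup j s)
              * (of_nat s * (2 * h2 + (of_nat s ^ 2 - 1) / 12 * c2)) ^ Poly_Mapping.lookup j s))"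
proof (intro conjI ballI allI impI)
  fix x y assume xy: "x \<in> {1..card (basis_expos n)}" "y \<in> {1..card (basis_expos n)}" "x < y"
  obtain i j k i1 j1 k1 where b: "b x = (i, j, k)" "b y = (i1, j1, k1)"
    by (metis prod_cases3)
  have basis: "b x \<in> basis_expos n" "b y \<in> basis_expos n"
    using listing xy unfolding decreasing_listing_def by (auto dest: bij_betwE)
  then have seqs: "i \<in> seqs" "j \<in> seqs" "k \<in> seqs01" "i1 \<in> seqs" "j1 \<in> seqs" "k1 \<in> seqs01"
    and size: "seq_size i + seq_size j + seq_size_half k = n" "seq_size i1 + seq_size j1 + seq_size_half k1 = n"
    by (auto simp: b basis_expos_def)
  then have k: "k \<in> seqs" "k1 \<in> seqs" by (simp_all add: seqs01_def)
  note factor = gram_factor[where b = b and x = x and y = y, OF b(1) seqs(1-3) b(2) seqs(4-6)]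
  note factor_Q = gram_factor_Q[where b = b and x = x and y = y, OF b(1) seqs(1-3) b(2) seqs(4-6)]
  note half = seq_size_half_expand[OF k(1)] seq_size_half_expand[OF k(2)]
  have double_weight_rev: "double_weight (rev w) = double_weight w" for w
    by (simp add: double_weight_def flip: rev_map)
  \<comment> \<open>For equal \<open>j\<close> some scalar value is all that matters, since another
    factor of the pairing is 0.\<close>
  have M_eq: "\<exists>\<alpha>. vac_eq h1 h2 c1 c2 (Mpos (rev (expand j)) * Lneg (expand j1)) (uscal \<alpha>)" if "j = j1"
    using Mpos_Lneg_expand_eq[OF seqs(2)] that by blast
  have "expo_gt (b x) (b y)"
    using listing xy unfolding decreasing_listing_def by blast
  then consider (j_size) "seq_size j > seq_size j1"
    | (j) "seq_size j = seq_size j1" "seq_gt j1 j"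
    | (k_size) "j = j1" "seq_size_half k > seq_size_half k1"
    | (k) "j = j1" "seq_size_half k = seq_size_half k1" "seq_gt k k1"
    | (i) "j = j1" "k = k1" "seq_gt i i1"
    unfolding b by auto
  then show "gram h1 h2 c1 c2 b x y = 0"
  proof cases
    case j_size
    then have "vac_eq h1 h2 c1 c2 (Mpos (rev (expand j)) * Lneg (expand j1)) 0"
      using seqs_pos[OF seqs(2)] by (intro Mpos_Lneg_0) (simp_all add: seq_size_expand sum_list_rev)
    then show ?thesis using factor[of h1 h2 c1 c2 0] by simp
  next
    case j
    then show ?thesis
      using factor[OF Mpos_Lneg_expand_neq[OF seqs(5,2)]] by simp
  next
    case k_size
    then have "vac_eq h1 h2 c1 c2 (Qpos (rev (expand k)) * Qneg (expand k1)) 0"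
      using seqs_pos[OF k(1)] seqs_pos[OF k(2)] half by (intro Qpos_Qneg_0) (simp_all add: double_weight_rev)
    then have Q: "vac_eq h1 h2 c1 c2 (Qpos (rev (expand k)) * Qneg (expand k1)) (uscal 0)"
      by simp
    obtain \<alpha> where M: "vac_eq h1 h2 c1 c2 (Mpos (rev (expand j)) * Lneg (expand j1)) (uscal \<alpha>)"
      using M_eq[OF k_size(1)] ..
    show ?thesis unfolding factor_Q[OF M Q] by simp
  next
    case k': k
    \<comment> \<open>Sequences with entries 0 and 1 are determined by their supports.\<close>
    have "set (expand k) \<noteq> set (expand k1)"
      using seqs01_eqI[OF seqs(3,6)] k'(3) seq_gt_irrefl by (auto simp: set_expand)
    then have "vac_eq h1 h2 c1 c2 (Qpos (rev (expand k)) * Qneg (expand k1)) 0"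
      using seqs_pos[OF k(1)] seqs_pos[OF k(2)] half k'(2) distinct_expand[OF seqs(3)] distinct_expand[OF seqs(6)]
      by (intro Qpos_Qneg_neq) (simp_all add: double_weight_rev)
    then have Q: "vac_eq h1 h2 c1 c2 (Qpos (rev (expand k)) * Qneg (expand k1)) (uscal 0)"
      by simp
    obtain \<alpha> where M: "vac_eq h1 h2 c1 c2 (Mpos (rev (expand j)) * Lneg (expand j1)) (uscal \<alpha>)"
      using M_eq[OF k'(1)] ..
    show ?thesis unfolding factor_Q[OF M Q] by simp
  next
    case i
    \<comment> \<open>Equal \<open>j\<close> and \<open>k\<close> and the common total weight n
      force \<open>i\<close> and \<open>i1\<close> to have equal size.\<close>
    have "vac_eq h1 h2 c1 c2 (Mpos (rev (expand i1)) * Lneg (expand i)) (uscal 0)"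
      using size i by (intro Mpos_Lneg_expand_neq seqs) simp_all
    then have "vac_coeff h1 h2 c1 c2 (Mpos (rev (expand i1)) * Lneg (expand i)) = 0"
      by (rule vac_eq_vac_coeff)
    moreover have Q: "vac_eq h1 h2 c1 c2 (Qpos (rev (expand k)) * Qneg (expand k1))
        (uscal (\<Prod>t\<in>set (expand k). odd_weight h2 c2 t))"
      unfolding i(2)[symmetric] using seqs_pos[OF k(1)] distinct_expand[OF seqs(3)] by (rule Qpos_Qneg_eq)
    moreover obtain \<alpha> where M: "vac_eq h1 h2 c1 c2 (Mpos (rev (expand j)) * Lneg (expand j1)) (uscal \<alpha>)"
      using M_eq[OF i(1)] ..
    ultimately show ?thesis unfolding factor_Q[OF M Q] by simp
  qed
next
  fix x i j k assume x: "x \<in> {1..card (basis_expos n)}" and b: "b x = (i, j, k)"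
  have "b x \<in> basis_expos n"
    using listing x unfolding decreasing_listing_def by (auto dest: bij_betwE)
  then have seqs: "i \<in> seqs" "j \<in> seqs" "k \<in> seqs01"
    by (auto simp: b basis_expos_def)
  then have k: "k \<in> seqs" "\<And>s. Poly_Mapping.lookup k s \<le> 1" by (simp_all add: seqs01_def)
  have "(\<Prod>t\<in>set (expand k). odd_weight h2 c2 t)
      = (\<Prod>t\<in>Poly_Mapping.keys k. odd_weight h2 c2 t ^ Poly_Mapping.lookup k t)"
    unfolding set_expand
  proof (rule prod.cong)
    fix t assume "t \<in> Poly_Mapping.keys k"
    then have "Poly_Mapping.lookup k t = 1" using k(2)[of t] by (simp add: in_keys_iff)
    then show "odd_weight h2 c2 t = odd_weight h2 c2 t ^ Poly_Mapping.lookup k t" by simp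
  qed simp
  moreover have "vac_eq h1 h2 c1 c2 (Qpos (rev (expand k)) * Qneg (expand k))
      (uscal (\<Prod>t\<in>set (expand k). odd_weight h2 c2 t))"
    using seqs_pos[OF k(1)] distinct_expand[OF seqs(3)] by (rule Qpos_Qneg_eq)
  note gram_factor_Q[where b = b and x = x and y = x, OF b seqs b seqs Mpos_Lneg_expand_eq[OF seqs(2)] this]
    vac_eq_vac_coeff[OF Mpos_Lneg_expand_eq[OF seqs(1)]]
  ultimately show "gram h1 h2 c1 c2 b x x =
           (\<Prod>r\<in>Poly_Mapping.keys i. fact (Poly_Mapping.lookup i r)
              * (of_nat r * (2 * h2 + (of_nat r ^ 2 - 1) / 12 * c2)) ^ Poly_Mapping.lookup i r)
         * (\<Prod>t\<in>Poly_Mapping.keys k.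
              (2 * h2 + (4 * (of_nat t - 1 / 2) ^ 2 - 1) / 12 * c2) ^ Poly_Mapping.lookup k t)
         * (\<Prod>s\<in>Poly_Mapping.keys j. fact (Poly_Mapping.lookup j s)
              * (of_nat s * (2 * h2 + (of_nat s ^ 2 - 1) / 12 * c2)) ^ Poly_Mapping.lookup j s)"
    unfolding even_weight_def odd_weight_def by (simp only: mult.commute mult.left_commute)
qed

end
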